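(* Let $d\ge 1$, and let $X(\boldsymbol t)=-\int_0^\infty\int_{\mathbb R^d}\frac1{2\lambda}e^{-\lambda\|\boldsymbol t-\boldsymbol u\|}\Lambda(d\boldsymbol u,d\lambda)$, $\boldsymbol t\in\mathbb R^d$, be the supCAR random field with characteristic quadruple $(0,b,W,\pi)$ (see context). Assume that one of the following holds: (i) $b>0$, $\int_0^\infty\frac{|\ln\lambda|^{d}}{\lambda^{d+2}}\pi(d\lambda)<\infty$ and $\int_{1\le|x|<\infty}|x|(\ln|x|)^{d-1}W(dx)<\infty$; (ii) $b=0$, $\int_0^\infty\frac{|\ln\lambda|^{d-1}}{\lambda^{d+1}}\pi(d\lambda)<\infty$, $\int_{1\le|x|<\infty}|x|(\ln|x|)^{d-1}W(dx)<\infty$, $\int_0^{1/2}\frac{|\ln\lambda|^{d-1}}{\lambda^{d+2}}\int_{-2\lambda}^{2\lambda}x^2W(dx)\pi(d\lambda)<\infty$ and, for $k=1,2$, $\int_0^{1/2}\frac{|\ln\lambda|^{d}}{\lambda^{d+2-k}}\int_{2\lambda\le|x|\le1}|x|^{2-k}W(dx)\pi(d\lambda)<\infty$. Assume also that the mean and the variance of $X(\boldsymbol t)$ are finite and that $EX(\boldsymbol t)=0$, $\boldsymbol t\in\mathbb R^d$. Then the covariance function $r(\boldsymbol t)=\mathrm{cov}(X(\boldsymbol 0),X(\boldsymbol t))$ of $X$ is $$r(\boldsymbol t)=-c_2\,\mathcal K''(0)\,\|\boldsymbol t\|^{\frac d2+1}\int_0^\infty\lambda^{-\frac d2-1}K_{\frac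 d2+1}(\lambda\|\boldsymbol t\|)\,\pi(d\lambda),$$ and the spectral density of $X$ is $$f(\boldsymbol\omega)=-c_1^2\,\mathcal K''(0)\int_0^\infty\frac{\pi(d\lambda)}{(\|\boldsymbol\omega\|^2+\lambda^2)^{d+1}},\quad\boldsymbol\omega\in\mathbb R^d,$$ where $$c_2=\frac{c_1^2}{\Gamma(d+1)}\left(\frac\pi2\right)^{d/2},\qquad c_1=\begin{cases}-2^{d/2-1}\,\Gamma\left(\frac{d+1}2\right)/\sqrt\pi,& d\text{ odd},\\-2^{-d/2}\,\Gamma(d)/\Gamma\left(\frac d2\right),& d\text{ even}.\end{cases}$$
   Context: Notation: $\|\cdot\|$ is the Euclidean norm, $\mathrm{Leb}$ is Lebesgue measure on $\mathbb R^d$, $\mathbb R^+=(0,\infty)$, and $C(s\ddagger\xi):=\log E e^{is\xi}$ is the cumulant function of a random variable $\xi$. Let $\tau(x)=x$ for $|x|\le1$ and $\tau(x)=\mathrm{sign}(x)$ for $|x|>1$. Let $b\ge0$, let $W$ be a Lévy measure on $\mathbb R$ (a Radon measure with $W(\{0\})=0$ and $\int_{\mathbb R}\min(1,x^2)W(dx)<\infty$), let $\pi$ be a probability measure on $\mathbb R^+$ (in the constants $c_1,c_2$ the symbol $\pi$ denotes the number), and put $$\mathcal K(s)=-\frac b2s^2+\int_{\mathbb R}\left(e^{isx}-1-is\tau(x)\right)W(dx),\quad s\in\mathbb R.$$ Let $\mathcal S'$ be a ring of Borel subsets of $\mathbb R^+\times\mathbb R^d$ closed under countable intersections and containing an increasing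 sequence of sets whose union is the whole space; $\sigma(\mathcal S')$ is the generated $\sigma$-algebra. $\Lambda$ is an independently scattered infinitely divisible random measure on $\mathcal S'$: for disjoint $A_n\in\mathcal S'$ the variables $\Lambda(A_n)$ are independent, $\Lambda(\bigcup_nA_n)=\sum_n\Lambda(A_n)$ a.s. if $\bigcup_nA_n\in\mathcal S'$, and $C(s\ddagger\Lambda(A))=[\pi\times\mathrm{Leb}](A)\,\mathcal K(s)$ for $A\in\mathcal S'$ with $[\pi\times\mathrm{Leb}](A)<\infty$. Integrals with respect to $\Lambda$ are Rajput–Rosinski integrals: for a simple function $f=\sum_{i=1}^na_i\mathbb 1_{A_i}$ with disjoint $A_i\in\mathcal S'$, $\int_Af\,d\Lambda=\sum_ia_i\Lambda(A\cap A_i)$; a function $f$ is $\Lambda$-integrable if there are simple functions $f_n\to f$ almost everywhere (with respect to $\pi\times\mathrm{Leb}$) such that $\int_Af_n\,d\Lambda$ converges in probability for every $A\in\sigma(\mathcal S')$, and $\int_Af\,d\Lambda$ is then the limit in probability. $K_\nu$ denotes the modified Bessel function of the second kind of order $\nu$; at $\boldsymbol t=\boldsymbol 0$ the expression $\|\boldsymbol t\|^{d/2+1}K_{d/2+1}(\lambda\|\boldsymbol t\|)$ is understood as its limit as $\boldsymbol t\to\boldsymbol 0$. The spectral density $f$ is normalised by $r(\boldsymbol t)=\int_{\mathbb R^d}e^{i(\boldsymbol\omega,\boldsymbol t)}f(\boldsymbol\omega)\,d\boldsymbol\omega$. *)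

theory Defs
  imports "HOL-Probability.Probability"
begin

definition covariance :: "'w measure \<Rightarrow> ('w \<Rightarrow> real) \<Rightarrow> ('w \<Rightarrow> real) \<Rightarrow> real" where
  "covariance M Y Z =
    (LINT w|M. (Y w - integral\<^sup>L M Y) * (Z w - integral\<^sup>L M Z))"

definition tendsto_in_prob :: "'w measure \<Rightarrow> (nat \<Rightarrow> 'w \<Rightarrow> real) \<Rightarrow> ('w \<Rightarrow> real) \<Rightarrow> bool" where
  "tendsto_in_prob M Z Y \<longleftrightarrow>
    (\<forall>\<epsilon>>0. (\<lambda>k. measure M {w \<in> space M. \<bar>Z k w - Y w\<bar> \<ge> \<epsilon>}) \<longlonglongrightarrow> 0)"

text \<open>
  The cumulant function is the logarithm of the characteristic function. The branch meant
  is the distinguished one: continuous, with value 0 at 0. These requirements determine it uniquely.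
\<close>
definition has_cumulant_function :: "'w measure \<Rightarrow> ('w \<Rightarrow> real) \<Rightarrow> (real \<Rightarrow> complex) \<Rightarrow> bool" where
  "has_cumulant_function M \<xi> C \<longleftrightarrow>
    continuous_on UNIV C \<and> C 0 = 0 \<and> (\<forall>s. char (distr M borel \<xi>) s = exp (C s))"

text \<open>
  The power of a characteristic function is the characteristic function of the corresponding
  convolution power.
\<close>
definition infinitely_divisible :: "real measure \<Rightarrow> bool" where
  "infinitely_divisible \<mu> \<longleftrightarrow>
    (\<forall>n\<ge>1::nat. \<exists>\<nu>. real_distribution \<nu> \<and> (\<forall>s. char \<mu> s = char \<nu> s ^ n))"

text \<open>
  A Levy measure may have infinite mass near 0, so being Radon can only refer to the punctured
  line. There it is automatic: the integrability condition makes the measure finite on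
  compact subsets of the punctured line, and locally finite Borel measures are Radon there.
\<close>
definition levy_measure :: "real measure \<Rightarrow> bool" where
  "levy_measure W \<longleftrightarrow>
    sets W = sets borel \<and> emeasure W {0} = 0 \<and> (\<integral>\<^sup>+x. ennreal (min 1 (x\<^sup>2)) \<partial>W) < \<infinity>"

definition trunc :: "real \<Rightarrow> real" where
  "trunc x = (if \<bar>x\<bar> \<le> 1 then x else sgn x)"

definition levy_exponent :: "real \<Rightarrow> real measure \<Rightarrow> real \<Rightarrow> complex" where
  "levy_exponent b W s =
    - complex_of_real (b / 2 * s\<^sup>2)
    + (CLINT x|W. exp (\<i> * of_real (s * x)) - 1 - \<i> * of_real (s * trunc x))"

definition has_second_derivative_at :: "(real \<Rightarrow> complex) \<Rightarrow> complex \<Rightarrow> real \<Rightarrow> bool" where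
  "has_second_derivative_at F c x \<longleftrightarrow>
    (\<exists>F'. (\<forall>\<^sub>F y in nhds x. (F has_vector_derivative F' y) (at y)) \<and>
          (F' has_vector_derivative c) (at x))"

definition prob_on_positive_reals :: "real measure \<Rightarrow> bool" where
  "prob_on_positive_reals \<pi> \<longleftrightarrow>
    prob_space \<pi> \<and> sets \<pi> = sets (restrict_space borel {0<..})"

text \<open>The control measure, on the set of pairs (\<lambda>, u) with \<lambda> > 0.\<close>
abbreviation control_measure :: "real measure \<Rightarrow> (real \<times> 'a::euclidean_space) measure" where
  "control_measure \<pi> \<equiv> \<pi> \<Otimes>\<^sub>M lborel"

definition index_ring :: "'x measure \<Rightarrow> 'x set set \<Rightarrow> bool" where
  "index_ring \<mu> S \<longleftrightarrow>
    ring_of_sets (space \<mu>) S \<and> S \<subseteq> sets \<mu> \<and>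
    (\<forall>A :: nat \<Rightarrow> 'x set. range A \<subseteq> S \<longrightarrow> (\<Inter>n. A n) \<in> S) \<and>
    (\<exists>E :: nat \<Rightarrow> 'x set. range E \<subseteq> S \<and> incseq E \<and> (\<Union>n. E n) = space \<mu>)"

definition id_random_measure ::
  "'w measure \<Rightarrow> 'x measure \<Rightarrow> (real \<Rightarrow> complex) \<Rightarrow> 'x set set \<Rightarrow> ('x set \<Rightarrow> 'w \<Rightarrow> real) \<Rightarrow> bool" where
  "id_random_measure M \<mu> K S \<Lambda> \<longleftrightarrow>
    (\<forall>A\<in>S. \<Lambda> A \<in> borel_measurable M \<and> infinitely_divisible (distr M borel (\<Lambda> A))) \<and>
    (\<forall>A :: nat \<Rightarrow> 'x set. range A \<subseteq> S \<longrightarrow> disjoint_family A \<longrightarrow>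
      prob_space.indep_vars M (\<lambda>_. borel) (\<lambda>n. \<Lambda> (A n)) UNIV \<and>
      ((\<Union>n. A n) \<in> S \<longrightarrow> (AE w in M. (\<lambda>n. \<Lambda> (A n) w) sums \<Lambda> (\<Union>n. A n) w))) \<and>
    (\<forall>A\<in>S. emeasure \<mu> A < \<infinity> \<longrightarrow>
      has_cumulant_function M (\<Lambda> A) (\<lambda>s. of_real (measure \<mu> A) * K s))"

text \<open>
  A simple function is given by a representation: a number n of terms, coefficients a 0, ..., a (n-1)
  and disjoint sets B 0, ..., B (n-1) in the ring.
\<close>
definition simple_rep :: "'x set set \<Rightarrow> nat \<Rightarrow> (nat \<Rightarrow> 'x set) \<Rightarrow> bool" where
  "simple_rep S n B \<longleftrightarrow> B ` {..<n} \<subseteq> S \<and> disjoint_family_on B {..<n}"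

definition simple_fun :: "nat \<Rightarrow> (nat \<Rightarrow> real) \<Rightarrow> (nat \<Rightarrow> 'x set) \<Rightarrow> 'x \<Rightarrow> real" where
  "simple_fun n a B x = (\<Sum>i<n. a i * indicator (B i) x)"

definition simple_stoch_integral ::
  "('x set \<Rightarrow> 'w \<Rightarrow> real) \<Rightarrow> nat \<Rightarrow> (nat \<Rightarrow> real) \<Rightarrow> (nat \<Rightarrow> 'x set) \<Rightarrow> 'x set \<Rightarrow> 'w \<Rightarrow> real" where
  "simple_stoch_integral \<Lambda> n a B A w = (\<Sum>i<n. a i * \<Lambda> (A \<inter> B i) w)"

text \<open>
  Rajput--Rosinski integral of f over A. It is determined up to almost sure equality, whence a
  relation: Y is a version of the integral (in particular, f is integrable).
\<close>
definition has_stoch_integral ::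
  "'w measure \<Rightarrow> 'x measure \<Rightarrow> 'x set set \<Rightarrow> ('x set \<Rightarrow> 'w \<Rightarrow> real) \<Rightarrow> ('x \<Rightarrow> real) \<Rightarrow> 'x set \<Rightarrow>
    ('w \<Rightarrow> real) \<Rightarrow> bool" where
  "has_stoch_integral M \<mu> S \<Lambda> f A Y \<longleftrightarrow>
    Y \<in> borel_measurable M \<and> A \<in> sigma_sets (space \<mu>) S \<and>
    (\<exists>n a B.
      (\<forall>k. simple_rep S (n k) (B k)) \<and>
      (AE x in \<mu>. (\<lambda>k. simple_fun (n k) (a k) (B k) x) \<longlonglongrightarrow> f x) \<and>
      (\<forall>A' \<in> sigma_sets (space \<mu>) S. \<exists>Z \<in> borel_measurable M.
        tendsto_in_prob M (\<lambda>k. simple_stoch_integral \<Lambda> (n k) (a k) (B k) A') Z) \<and>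
      tendsto_in_prob M (\<lambda>k. simple_stoch_integral \<Lambda> (n k) (a k) (B k) A) Y)"

text \<open>
  X is (a version of) the field with characteristic quadruple (0, b, W, \<pi>) driven by \<Lambda>;
  the minus sign in front of the integral defining X t is moved to the other side.
\<close>
definition supCAR_field ::
  "'w measure \<Rightarrow> (real \<times> 'a::euclidean_space) set set \<Rightarrow> ((real \<times> 'a) set \<Rightarrow> 'w \<Rightarrow> real) \<Rightarrow>
    real \<Rightarrow> real measure \<Rightarrow> real measure \<Rightarrow> ('a \<Rightarrow> 'w \<Rightarrow> real) \<Rightarrow> bool" where
  "supCAR_field M S \<Lambda> b W \<pi> X \<longleftrightarrow>
    prob_space M \<and> 0 \<le> b \<and> levy_measure W \<and> prob_on_positive_reals \<pi> \<and>
    index_ring (control_measure \<pi>) S \<and>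
    id_random_measure M (control_measure \<pi>) (levy_exponent b W) S \<Lambda> \<and>
    (\<forall>t. has_stoch_integral M (control_measure \<pi>) S \<Lambda>
      (\<lambda>(l, u). 1 / (2 * l) * exp (- l * norm (t - u))) (space (control_measure \<pi>))
      (\<lambda>w. - X t w))"

definition supCAR_cond_i :: "nat \<Rightarrow> real \<Rightarrow> real measure \<Rightarrow> real measure \<Rightarrow> bool" where
  "supCAR_cond_i d b W \<pi> \<longleftrightarrow>
    b > 0 \<and>
    (\<integral>\<^sup>+l. ennreal (\<bar>ln l\<bar> ^ d / l ^ (d + 2)) \<partial>\<pi>) < \<infinity> \<and>
    (\<integral>\<^sup>+x\<in>{x. 1 \<le> \<bar>x\<bar>}. ennreal (\<bar>x\<bar> * ln \<bar>x\<bar> ^ (d - 1)) \<partial>W) < \<infinity>"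

definition supCAR_cond_ii :: "nat \<Rightarrow> real \<Rightarrow> real measure \<Rightarrow> real measure \<Rightarrow> bool" where
  "supCAR_cond_ii d b W \<pi> \<longleftrightarrow>
    b = 0 \<and>
    (\<integral>\<^sup>+l. ennreal (\<bar>ln l\<bar> ^ (d - 1) / l ^ (d + 1)) \<partial>\<pi>) < \<infinity> \<and>
    (\<integral>\<^sup>+x\<in>{x. 1 \<le> \<bar>x\<bar>}. ennreal (\<bar>x\<bar> * ln \<bar>x\<bar> ^ (d - 1)) \<partial>W) < \<infinity> \<and>
    (\<integral>\<^sup>+l\<in>{0<..1/2}. ennreal (\<bar>ln l\<bar> ^ (d - 1) / l ^ (d + 2)) *
        (\<integral>\<^sup>+x\<in>{-2*l..2*l}. ennreal (x\<^sup>2) \<partial>W) \<partial>\<pi>) < \<infinity> \<and>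
    (\<forall>k\<in>{1, 2::nat}.
      (\<integral>\<^sup>+l\<in>{0<..1/2}. ennreal (\<bar>ln l\<bar> ^ d / l ^ (d + 2 - k)) *
        (\<integral>\<^sup>+x\<in>{x. 2*l \<le> \<bar>x\<bar> \<and> \<bar>x\<bar> \<le> 1}. ennreal (\<bar>x\<bar> ^ (2 - k)) \<partial>W) \<partial>\<pi>) < \<infinity>)"

text \<open>
  Modified Bessel function of the second kind, for real order and positive real argument, by
  its integral representation (NIST DLMF, formula 10.32.9).
\<close>
definition besselK :: "real \<Rightarrow> real \<Rightarrow> real" where
  "besselK \<nu> x = (LBINT v:{0<..}. exp (- x * cosh v) * cosh (\<nu> * v))"

text \<open>The expression \<open>\<parallel>t\<parallel>\<^sup>\<nu> K\<^sub>\<nu>(l \<parallel>t\<parallel>)\<close>, extended to t = 0 by its limit.\<close>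
definition norm_powr_besselK :: "real \<Rightarrow> real \<Rightarrow> 'a::euclidean_space \<Rightarrow> real" where
  "norm_powr_besselK \<nu> l t =
    (let F = (\<lambda>s::'a. norm s powr \<nu> * besselK \<nu> (l * norm s))
     in if t = 0 then Lim (at 0) F else F t)"

definition const_c1 :: "nat \<Rightarrow> real" where
  "const_c1 d =
    (if odd d then - (2 powr (real d / 2 - 1)) * Gamma ((real d + 1) / 2) / sqrt pi
     else - (2 powr (- real d / 2)) * Gamma (real d) / Gamma (real d / 2))"

definition const_c2 :: "nat \<Rightarrow> real" where
  "const_c2 d = (const_c1 d)\<^sup>2 / Gamma (real d + 1) * (pi / 2) powr (real d / 2)"

definition is_spectral_density :: "('a::euclidean_space \<Rightarrow> real) \<Rightarrow> ('a \<Rightarrow> real) \<Rightarrow> bool" where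
  "is_spectral_density r f \<longleftrightarrow>
    (\<forall>\<omega>. 0 \<le> f \<omega>) \<and> integrable lborel f \<and>
    (\<forall>t. complex_of_real (r t) = (CLINT \<omega>|lborel. exp (\<i> * of_real (\<omega> \<bullet> t)) * of_real (f \<omega>)))"

end

theory Submission
  imports Defs
begin

text \<open>
  The field is a linear functional of an independently scattered measure, so its covariance is
  an inner product of kernels: with \<open>f\<^sub>t(l, u) = exp(- l |t - u|) / (2 l)\<close> and \<open>v = b + \<integral> x\<^sup>2
  W(dx) = - K''(0)\<close>, the covariance of \<open>X(0)\<close> and \<open>X(t)\<close> is \<open>v \<integral> f\<^sub>0 f\<^sub>t d(\<pi> \<times> Leb)\<close>. The two
  formulas of the theorem are two evaluations of this integral.

  The probabilistic difficulty is that the stochastic integral is a limit in probability, which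
  does not carry moments along. One follows an almost surely convergent subsequence of the
  integrals of simple functions \<open>f\<^sub>n\<close> over the whole space. Since the kernel is positive and
  integrable (this is what the moment condition on \<open>\<pi>\<close> is used for), the sets on which all late
  \<open>f\<^sub>n\<close> lie between \<open>1/(k+1)\<close> and \<open>k+1\<close> belong to the ring, have finite control measure and
  exhaust the space (\<open>exhausting_level_sets\<close>). Put \<open>\<psi> = - Re K\<close>. Over such a set \<open>A\<close> the
  characteristic function of the integral of \<open>f\<^sub>n\<close> has modulus \<open>exp (- \<integral>\<^sub>A \<psi>(s f\<^sub>n))\<close>, and
  omitting the independent integral over the complement can only increase the modulus. So
  Fatou's lemma gives \<open>\<integral> \<psi>(s f) \<le> - ln |E exp(i s X)|\<close>, and the finite variance of \<open>X\<close>, by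
  Fatou's lemma again as \<open>s \<rightarrow> 0\<close>, gives \<open>v \<integral> f\<^sup>2 < \<infinity>\<close> (\<open>variance_rate_mult_le\<close>). Hence \<open>v < \<infinity>\<close>,
  and either \<open>v = 0\<close>, in which case \<open>\<Lambda>\<close> vanishes almost surely, or \<open>f\<close> is square integrable.

  Now \<open>\<Lambda>(A)\<close> has variance \<open>v\<close> times the control measure of \<open>A\<close>, so that the centred integrals of
  simple functions satisfy an isometry (\<open>SI_isometry\<close>), and those of suitable cut-off \<open>f\<^sub>n\<close>
  converge in mean square. This limit differs from \<open>X\<close> by a random variable that is approximated
  by integrals over smaller and smaller complements of the exhausting sets; it is therefore
  independent of itself, and constant (\<open>remainder_constant\<close>). Constants do not affect
  covariances, and the inner product formula follows (\<open>stochastic_integral_is_L2_integral\<close>,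
  \<open>L2_integral_covariance\<close>).

  For the evaluation, \<open>exp(- l r)\<close> is written as a mixture of Gaussians in \<open>r\<close>
  (\<open>mix_integral_half\<close>). The convolution of two such kernels is a double mixture of convolutions
  of Gaussians, which a Beta integral reduces to the single mixture \<open>\<integral> s\<^bsup>d/2\<^esup> exp(- l\<^sup>2 s -
  |t|\<^sup>2 / (4 s)) ds\<close> over \<open>s > 0\<close>, up to a constant (\<open>nn_integral_exp_norm_convolution\<close>). The
  substitution \<open>s = r e\<^sup>v / (2 l)\<close> turns this mixture into the integral representation of \<open>K\<close> of
  order \<open>d/2 + 1\<close> (\<open>mix_integral_eq_besselK\<close>). On the other hand every Gaussian in it is a
  Fourier transform of a Gaussian, and mixing these yields the density \<open>1 / (|\<omega>|\<^sup>2 + l\<^sup>2)\<^bsup>d+1\<^esup>\<close>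
  (\<open>cauchy_density_fourier\<close>). Integration over \<open>\<pi>\<close> finishes the proof.
\<close>

section \<open>Gaussian integrals\<close>

text \<open>
  The integral over the whole line is reached from compact intervals \<open>[- n, n]\<close>; writing both
  sides as measures of increasing sets lets continuity from below replace a limit argument.
\<close>
lemma nn_integral_increasing_substitution:
  fixes f g g' :: "real \<Rightarrow> real"
  assumes [measurable]: "f \<in> borel_measurable borel"
    and deriv: "\<And>x. (g has_real_derivative g' x) (at x)"
    and cont: "continuous_on UNIV g'"
    and nonneg: "\<And>x. 0 \<le> g' x"
  shows "(\<integral>\<^sup>+x. ennreal (f x) * indicator (range g) x \<partial>lborel) =
    (\<integral>\<^sup>+x. ennreal (f (g x)) * ennreal (g' x) \<partial>lborel)"
proof -
  have mono: "mono g"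
    using deriv_nonneg_imp_mono[OF deriv nonneg] by (intro monoI) auto
  have contg: "continuous_on UNIV g"
    using deriv by (intro continuous_at_imp_continuous_on) (auto intro: DERIV_isCont)
  have [measurable]: "g \<in> borel_measurable borel" "g' \<in> borel_measurable borel"
    using contg cont by (auto intro: borel_measurable_continuous_onI)
  define A where "A n = {g (- real n)..g (real n)}" for n
  define B where "B n = {- real n..real n}" for n
  have U: "range g = (\<Union>n. A n)"
  proof (intro set_eqI iffI)
    fix y assume "y \<in> range g"
    then obtain x where "y = g x" by auto
    moreover obtain n :: nat where "\<bar>x\<bar> \<le> real n" using real_arch_simple by blast
    ultimately show "y \<in> (\<Union>n. A n)"
      using mono by (intro UN_I[of n]) (auto simp: mono_def A_def)
  next
    fix y assume "y \<in> (\<Union>n. A n)"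
    then obtain n :: nat where "g (- real n) \<le> y" "y \<le> g (real n)" by (auto simp: A_def)
    then show "y \<in> range g"
      using IVT'[of g "- real n" y "real n"] continuous_on_subset[OF contg] by auto
  qed
  have UB: "(\<Union>n. B n) = UNIV"
  proof -
    have "x \<in> (\<Union>n. B n)" for x
    proof -
      obtain n :: nat where "\<bar>x\<bar> \<le> real n" using real_arch_simple by blast
      then show ?thesis by (intro UN_I[of n]) (auto simp: B_def)
    qed
    then show ?thesis by auto
  qed
  have incA: "incseq A"
  proof (rule incseq_SucI)
    fix n show "A n \<le> A (Suc n)"
      using monoD[OF mono, of "- real (Suc n)" "- real n"] monoD[OF mono, of "real n"
          "real (Suc n)"]
      by (auto simp: A_def)
  qed
  have incB: "incseq B" by (intro incseq_SucI) (auto simp: B_def)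
  have [measurable]: "A n \<in> sets borel" "B n \<in> sets borel" for n by (auto simp: A_def B_def)
  let ?D = "density lborel (\<lambda>x. ennreal (f x))"
  let ?E = "density lborel (\<lambda>x. ennreal (f (g x)) * ennreal (g' x))"
  have "(\<integral>\<^sup>+x. ennreal (f x) * indicator (range g) x \<partial>lborel) = emeasure ?D (\<Union>n. A n)"
    unfolding U by (subst emeasure_density) auto
  also have "\<dots> = (SUP n. emeasure ?D (A n))"
    by (rule SUP_emeasure_incseq[symmetric]) (use incA in auto)
  also have "\<dots> = (SUP n. emeasure ?E (B n))"
  proof (rule SUP_cong[OF refl])
    fix n
    have sb: "set_borel_measurable borel {g (- real n)..g (real n)} f"
      by (simp add: set_borel_measurable_def)
    have "emeasure ?D (A n) = (\<integral>\<^sup>+x. ennreal (f x * indicator {g (- real n)..g (real n)} x)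
        \<partial>lborel)"
      by (subst emeasure_density) (auto intro!: nn_integral_cong split: split_indicator simp: A_def)
    also have "\<dots> = (\<integral>\<^sup>+x. ennreal (f (g x) * g' x * indicator {- real n..real n} x) \<partial>lborel)"
      by (rule nn_integral_substitution[OF sb deriv continuous_on_subset[OF cont] nonneg]) auto
    also have "\<dots> = emeasure ?E (B n)"
      by (subst emeasure_density)
        (auto intro!: nn_integral_cong split: split_indicator simp: B_def ennreal_mult'' nonneg)
    finally show "emeasure ?D (A n) = emeasure ?E (B n)" .
  qed
  also have "\<dots> = emeasure ?E (\<Union>n. B n)"
    by (rule SUP_emeasure_incseq) (use incB in auto)
  also have "\<dots> = (\<integral>\<^sup>+x. ennreal (f (g x)) * ennreal (g' x) \<partial>lborel)"
    unfolding UB by (subst emeasure_density) auto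
  finally show ?thesis .
qed

lemma nn_integral_gaussian:
  fixes a :: real assumes "a > 0"
  shows "(\<integral>\<^sup>+x. ennreal (exp (- (a * x\<^sup>2))) \<partial>lborel) = ennreal (sqrt (pi / a))"
proof -
  define \<sigma> where "\<sigma> = 1 / sqrt (2 * a)"
  have s: "\<sigma> > 0" "\<sigma>\<^sup>2 = 1 / (2 * a)" using assms by (auto simp: \<sigma>_def power_divide)
  have "exp (- (a * x\<^sup>2)) = sqrt (pi / a) * normal_density 0 \<sigma> x" for x
    using assms by (simp add: normal_density_def s field_simps)
  then have "(\<integral>\<^sup>+x. ennreal (exp (- (a * x\<^sup>2))) \<partial>lborel)
     = (\<integral>\<^sup>+x. ennreal (sqrt (pi / a)) * ennreal (normal_density 0 \<sigma> x) \<partial>lborel)"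
    using assms by (simp add: ennreal_mult')
  also have "\<dots> = ennreal (sqrt (pi / a)) * (\<integral>\<^sup>+x. ennreal (normal_density 0 \<sigma> x) \<partial>lborel)"
    by (rule nn_integral_cmult) auto
  also have "(\<integral>\<^sup>+x. ennreal (normal_density 0 \<sigma> x) \<partial>lborel) = 1"
    using integrable_normal_density[OF s(1), of 0] integral_normal_density[OF s(1), of 0]
    by (subst nn_integral_eq_integral) auto
  finally show ?thesis by simp
qed

lemma norm_sq_eq_sum_Basis: "(norm (u::'a::euclidean_space))\<^sup>2 = (\<Sum>b\<in>Basis. (u \<bullet> b)\<^sup>2)"
  by (simp add: norm_eq_sqrt_inner euclidean_inner[of u u] power2_eq_square sum_nonneg)

lemma nn_integral_gaussian_euclidean:
  fixes a :: real assumes "a > 0"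
  shows "(\<integral>\<^sup>+u. ennreal (exp (- (a * (norm (u::'a::euclidean_space))\<^sup>2))) \<partial>lborel) =
    ennreal ((pi / a) powr (real DIM('a) / 2))"
proof -
  have "(\<integral>\<^sup>+u. ennreal (exp (- (a * (norm (u::'a))\<^sup>2))) \<partial>lborel)
     = (\<integral>\<^sup>+u. (\<Prod>b\<in>Basis. ennreal (exp (- (a * ((u::'a) \<bullet> b)\<^sup>2)))) \<partial>lborel)"
    by (simp add: norm_sq_eq_sum_Basis sum_distrib_left sum_negf[symmetric] exp_sum prod_ennreal)
  also have "\<dots> = (\<Prod>b\<in>(Basis::'a set). (\<integral>\<^sup>+x. ennreal (exp (- (a * x\<^sup>2))) \<partial>lborel))"
    by (rule nn_integral_lborel_prod) auto
  also have "\<dots> = ennreal (sqrt (pi / a) ^ DIM('a))"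
    using assms by (simp add: nn_integral_gaussian prod_ennreal ennreal_power)
  also have "sqrt (pi / a) ^ DIM('a) = (pi / a) powr (real DIM('a) / 2)"
    using assms by (simp add: powr_half_sqrt[symmetric] powr_powr powr_realpow[symmetric] del:
        powr_half_sqrt)
  finally show ?thesis .
qed

text \<open>
  Completing the square: the exponent is a centred quadratic in \<open>u - b t / (a + b)\<close> plus a
  constant, and Lebesgue measure is translation invariant.
\<close>
lemma gaussian_convolution:
  fixes t :: "'a::euclidean_space"
  assumes "a > 0" "b > 0"
  shows "(\<integral>\<^sup>+u. ennreal (exp (- (a * (norm u)\<^sup>2)) * exp (- (b * (norm (t - u))\<^sup>2))) \<partial>lborel) =
    ennreal ((pi / (a + b)) powr (real DIM('a) / 2) * exp (- (a * b / (a + b) * (norm t)\<^sup>2)))"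
proof -
  define c where "c = b / (a + b)"
  define m where "m = c *\<^sub>R t"
  have ab: "a + b > 0" using assms by simp
  have c: "(a + b) * c = b" using ab by (simp add: c_def)
  have eq: "a * (norm u)\<^sup>2 + b * (norm (t - u))\<^sup>2 =
      (a + b) * (norm (- m + u))\<^sup>2 + a * b / (a + b) * (norm t)\<^sup>2" for u
  proof -
    have "(a + b) * (U - 2 * c * T + c\<^sup>2 * V) + a * c * V = a * U + b * (U - 2 * T + V)" for U T V
    proof -
      have "(a + b) * (U - 2 * c * T + c\<^sup>2 * V) + a * c * V =
          (a + b) * U - 2 * ((a + b) * c) * T + ((a + b) * c) * c * V + a * c * V"
        by (simp add: algebra_simps power2_eq_square)
      also have "\<dots> = (a + b) * U - 2 * b * T + (b * c + a * c) * V"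
        unfolding c by (simp add: algebra_simps)
      also have "b * c + a * c = b" using c by (simp add: algebra_simps)
      finally show ?thesis by (simp add: algebra_simps)
    qed
    moreover have "(norm (- m + u))\<^sup>2 = u \<bullet> u - 2 * c * (t \<bullet> u) + c\<^sup>2 * (t \<bullet> t)"
      unfolding power2_norm_eq_inner m_def by (simp add:
          algebra_simps inner_commute power2_eq_square)
    moreover have "(norm (t - u))\<^sup>2 = u \<bullet> u - 2 * (t \<bullet> u) + t \<bullet> t"
      unfolding power2_norm_eq_inner by (simp add: algebra_simps inner_commute)
    moreover have "a * b / (a + b) = a * c" by (simp add: c_def)
    ultimately show ?thesis by (simp only: power2_norm_eq_inner)
  qed
  have "(\<integral>\<^sup>+u. ennreal (exp (- (a * (norm u)\<^sup>2)) * exp (- (b * (norm (t - u))\<^sup>2))) \<partial>lborel)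
     = (\<integral>\<^sup>+u. ennreal (exp (- (a * b / (a + b) * (norm t)\<^sup>2))) *
          ennreal (exp (- ((a + b) * (norm (- m + u))\<^sup>2))) \<partial>lborel)"
  proof (intro nn_integral_cong)
    fix u
    have "exp (- (a * (norm u)\<^sup>2)) * exp (- (b * (norm (t - u))\<^sup>2))
       = exp (- (a * (norm u)\<^sup>2 + b * (norm (t - u))\<^sup>2))" by (simp add: exp_add[symmetric])
    also have "\<dots> = exp (- (a * b / (a + b) * (norm t)\<^sup>2)) * exp (- ((a + b) * (norm (- m + u))\<^sup>2))"
      unfolding eq by (simp add: exp_add[symmetric])
    finally show "ennreal (exp (- (a * (norm u)\<^sup>2)) * exp (- (b * (norm (t - u))\<^sup>2))) =
      ennreal (exp (- (a * b / (a + b) * (norm t)\<^sup>2))) *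
          ennreal (exp (- ((a + b) * (norm (- m + u))\<^sup>2)))" by (simp add: ennreal_mult'')
  qed
  also have "\<dots> = ennreal (exp (- (a * b / (a + b) * (norm t)\<^sup>2))) *
      (\<integral>\<^sup>+u. ennreal (exp (- ((a + b) * (norm (- m + u))\<^sup>2))) \<partial>lborel)"
    by (rule nn_integral_cmult) auto
  also have "(\<integral>\<^sup>+u. ennreal (exp (- ((a + b) * (norm (- m + u))\<^sup>2))) \<partial>lborel) =
      (\<integral>\<^sup>+u. ennreal (exp (- ((a + b) * (norm u)\<^sup>2))) \<partial>distr lborel borel ((+) (- m)))"
    by (subst nn_integral_distr) auto
  also have "\<dots> = ennreal ((pi / (a + b)) powr (real DIM('a) / 2))"
    by (subst lborel_distr_plus) (rule nn_integral_gaussian_euclidean[OF ab])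
  finally show ?thesis by (simp add: ennreal_mult'' mult.commute)
qed

lemma gaussian_fourier_real:
  fixes a t :: real assumes a: "a > 0"
  shows "integrable lborel (\<lambda>w. exp (\<i> * of_real (w * t)) * complex_of_real (exp (- (a * w\<^sup>2))))"
    and "(CLINT w|lborel. exp (\<i> * of_real (w * t)) * complex_of_real (exp (- (a * w\<^sup>2)))) =
      complex_of_real (sqrt (pi / a) * exp (- (t\<^sup>2 / (4 * a))))"
proof -
  have "integrable lborel (\<lambda>w. exp (- (a * w\<^sup>2)))"
    using nn_integral_gaussian[OF a] by (intro integrableI_nonneg) auto
  then show "integrable lborel (\<lambda>w. exp (\<i> * of_real (w * t))
      * complex_of_real (exp (- (a * w\<^sup>2))))"
    by (rule Bochner_Integration.integrable_bound) (auto simp: norm_mult)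
  define c where "c = 1 / sqrt (2 * a)"
  have c: "c > 0" "a * c\<^sup>2 = 1 / 2" "c\<^sup>2 = 1 / (2 * a)" using a by (auto simp: c_def power_divide)
  have "(CLINT w|lborel. exp (\<i> * of_real (w * t)) * complex_of_real (exp (- (a * w\<^sup>2))))
      = \<bar>c\<bar> *\<^sub>R (CLINT w|lborel. exp (\<i> * of_real ((0 + c * w) * t))
          * complex_of_real (exp (- (a * (0 + c * w)\<^sup>2))))"
    using c(1) by (intro lborel_integral_real_affine) auto
  also have "(\<lambda>w. exp (\<i> * of_real ((0 + c * w) * t))
      * complex_of_real (exp (- (a * (0 + c * w)\<^sup>2))))
     = (\<lambda>w. complex_of_real (sqrt (2 * pi)) * (std_normal_density w *\<^sub>R iexp ((c * t) * w)))"
  proof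
    fix w
    have "exp (- (a * (0 + c * w)\<^sup>2)) = sqrt (2 * pi) * std_normal_density w"
      using c(2) by (simp add: normal_density_def power_mult_distrib mult.assoc[symmetric])
    then show "exp (\<i> * of_real ((0 + c * w) * t)) * complex_of_real (exp (- (a * (0 + c * w)\<^sup>2))) =
       complex_of_real (sqrt (2 * pi)) * (std_normal_density w *\<^sub>R iexp ((c * t) * w))"
      by (simp add: scaleR_conv_of_real mult_ac)
  qed
  also have "(CLINT w|lborel. complex_of_real (sqrt (2 * pi))
      * (std_normal_density w *\<^sub>R iexp ((c * t) * w)))
     = complex_of_real (sqrt (2 * pi)) * char std_normal_distribution (c * t)"
    unfolding char_def by (subst integral_density)
      (auto simp: normal_density_nonneg mult_scaleR_right[symmetric] simp del: mult_scaleR_right)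
  also have "\<dots> = complex_of_real (sqrt (2 * pi) * exp (- (t\<^sup>2 / (4 * a))))"
    unfolding char_std_normal_distribution using c(3) by (simp add: power_mult_distrib)
  also have "\<bar>c\<bar> *\<^sub>R complex_of_real (sqrt (2 * pi) * exp (- (t\<^sup>2 / (4 * a)))) =
     complex_of_real (sqrt (pi / a) * exp (- (t\<^sup>2 / (4 * a))))"
  proof -
    have "c * sqrt (2 * pi) = sqrt (pi / a)"
      unfolding c_def using a by (simp add: real_sqrt_divide real_sqrt_mult)
    then show ?thesis using c(1) by (simp add: scaleR_conv_of_real mult.assoc[symmetric] flip:
        of_real_mult)
  qed
  finally show "(CLINT w|lborel. exp (\<i> * of_real (w * t)) * complex_of_real (exp (- (a * w\<^sup>2)))) =
      complex_of_real (sqrt (pi / a) * exp (- (t\<^sup>2 / (4 * a))))" .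
qed

text \<open>
  Both the character and the Gaussian are products over the coordinates, and so is Lebesgue
  measure.
\<close>
lemma gaussian_fourier_euclidean:
  fixes t :: "'a::euclidean_space" assumes a: "a > 0"
  shows "(CLINT \<omega>|lborel. exp (\<i> * of_real (\<omega> \<bullet> t)) * complex_of_real (exp (- (a * (norm \<omega>)\<^sup>2)))) =
      complex_of_real ((pi / a) powr (real DIM('a) / 2) * exp (- ((norm t)\<^sup>2 / (4 * a))))"
proof -
  let ?g = "\<lambda>b w. exp (\<i> * of_real (w * (t \<bullet> b))) * complex_of_real (exp (- (a * w\<^sup>2)))"
  interpret product_sigma_finite "\<lambda>b::'a. lborel :: real measure"
    by standard
  have "(CLINT \<omega>|lborel. exp (\<i> * of_real (\<omega> \<bullet> t)) * complex_of_real (exp (- (a * (norm \<omega>)\<^sup>2))))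
     = (CLINT \<omega>|lborel. (\<Prod>b\<in>Basis. ?g b ((\<omega>::'a) \<bullet> b)))"
  proof (intro Bochner_Integration.integral_cong refl)
    fix \<omega> :: 'a
    have "\<omega> \<bullet> t = (\<Sum>b\<in>Basis. (\<omega> \<bullet> b) * (t \<bullet> b))" by (rule euclidean_inner)
    then show "exp (\<i> * of_real (\<omega> \<bullet> t)) * complex_of_real (exp (- (a * (norm \<omega>)\<^sup>2)))
        = (\<Prod>b\<in>Basis. ?g b (\<omega> \<bullet> b))"
      by (simp add: norm_sq_eq_sum_Basis sum_distrib_left sum_negf[symmetric] exp_sum prod.distrib
          del: of_real_mult)
  qed
  also have "\<dots> = (CLINT f|(\<Pi>\<^sub>M b\<in>(Basis::'a set). lborel). (\<Prod>b\<in>Basis. ?g b (f b)))"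
    by (subst lborel_eq, subst integral_distr) (auto intro!: Bochner_Integration.integral_cong)
  also have "\<dots> = (\<Prod>b\<in>(Basis::'a set). (CLINT w|lborel. ?g b w))"
    by (rule product_integral_prod) (simp_all only: finite_Basis gaussian_fourier_real(1)[OF a])
  also have "\<dots> = (\<Prod>b\<in>(Basis::'a set). complex_of_real (sqrt (pi / a)
      * exp (- ((t \<bullet> b)\<^sup>2 / (4 * a)))))"
    by (simp only: gaussian_fourier_real(2)[OF a])
  also have "\<dots> = complex_of_real (sqrt (pi / a) ^ DIM('a) * exp (- ((norm t)\<^sup>2 / (4 * a))))"
    by (simp add: norm_sq_eq_sum_Basis sum_divide_distrib sum_negf[symmetric] exp_sum prod.distrib)
  also have "sqrt (pi / a) ^ DIM('a) = (pi / a) powr (real DIM('a) / 2)"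
    using a by (simp add: powr_half_sqrt[symmetric] powr_powr powr_realpow[symmetric] del:
        powr_half_sqrt)
  finally show ?thesis .
qed

section \<open>Mixtures of Gaussians\<close>

lemma nn_integral_Gamma_scaled:
  assumes "c > 0" "\<nu> > (0::real)"
  shows "(\<integral>\<^sup>+s. ennreal (indicator {0<..} s * (s powr (\<nu> - 1) * exp (- (c * s)))) \<partial>lborel) =
    ennreal (Gamma \<nu> / c powr \<nu>)"
proof -
  have "ennreal (Gamma \<nu>) = (\<integral>\<^sup>+t. ennreal (indicator {0..} t * t powr (\<nu> - 1) / exp t) \<partial>lborel)"
    using Gamma_conv_nn_integral_real[OF assms(2)] .
  also have "\<dots> = ennreal \<bar>c\<bar> * (\<integral>\<^sup>+s. ennreal (indicator {0..} (0 + c * s)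
      * (0 + c * s) powr (\<nu> - 1) / exp (0 + c * s)) \<partial>lborel)"
    using assms by (intro nn_integral_real_affine) auto
  also have "(\<integral>\<^sup>+s. ennreal (indicator {0..} (0 + c * s) * (0 + c * s) powr (\<nu> - 1) / exp
      (0 + c * s)) \<partial>lborel)
     = (\<integral>\<^sup>+s. ennreal (c powr (\<nu> - 1)) * ennreal (indicator {0<..} s
         * (s powr (\<nu> - 1) * exp (- (c * s)))) \<partial>lborel)"
  proof (intro nn_integral_cong)
    fix s
    show "ennreal (indicator {0..} (0 + c * s) * (0 + c * s) powr (\<nu> - 1) / exp (0 + c * s)) =
      ennreal (c powr (\<nu> - 1)) * ennreal (indicator {0<..} s * (s powr (\<nu> - 1) * exp (- (c * s))))"
      using assms
      by (cases "s > 0"; cases "s = 0")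
        (auto simp: ennreal_mult'[symmetric] powr_mult exp_minus field_simps indicator_def
            mult_less_0_iff zero_le_mult_iff)
  qed
  also have "\<dots> = ennreal (c powr (\<nu> - 1)) * (\<integral>\<^sup>+s.
      ennreal (indicator {0<..} s * (s powr (\<nu> - 1) * exp (- (c * s)))) \<partial>lborel)"
    by (rule nn_integral_cmult) auto
  finally have "ennreal (Gamma \<nu>) = ennreal (c powr \<nu>)
      * (\<integral>\<^sup>+s. ennreal (indicator {0<..} s * (s powr (\<nu> - 1) * exp (- (c * s)))) \<partial>lborel)"
    using assms by (simp add: mult.assoc[symmetric] ennreal_mult'[symmetric] powr_diff)
  then have "ennreal (1 / c powr \<nu>) * ennreal (Gamma \<nu>)
      = (ennreal (1 / c powr \<nu>) * ennreal (c powr \<nu>))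
      * (\<integral>\<^sup>+s. ennreal (indicator {0<..} s * (s powr (\<nu> - 1) * exp (- (c * s)))) \<partial>lborel)"
    by (simp add: mult.assoc)
  moreover have "ennreal (1 / c powr \<nu>) * ennreal (c powr \<nu>) = 1"
    using assms by (simp add: ennreal_mult'[symmetric])
  ultimately show ?thesis using assms by (simp add: ennreal_mult'[symmetric])
qed

text \<open>
  The weight that the mixtures of Gaussians \<open>exp (- r\<^sup>2 / (4 s))\<close> below carry at \<open>s\<close>. Up to a
  power of \<open>r / l\<close> its integral is a Bessel function of order \<open>\<nu>\<close>, but unlike the latter it is
  also regular at \<open>r = 0\<close>.
\<close>
definition mix_kernel :: "real \<Rightarrow> real \<Rightarrow> real \<Rightarrow> real \<Rightarrow> real" where
  "mix_kernel \<nu> l r s = indicator {0<..} s * (s powr (\<nu> - 1) * exp (- (l\<^sup>2 * s) - r\<^sup>2 / (4 * s)))"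

definition mix_integral :: "real \<Rightarrow> real \<Rightarrow> real \<Rightarrow> real" where
  "mix_integral \<nu> l r = (LINT s|lborel. mix_kernel \<nu> l r s)"

lemma mix_kernel_measurable [measurable]: "mix_kernel \<nu> l r \<in> borel_measurable borel"
  unfolding mix_kernel_def by measurable

lemma mix_kernel_nonneg: "0 \<le> mix_kernel \<nu> l r s"
  by (simp add: mix_kernel_def)

lemma mix_kernel_le: "mix_kernel \<nu> l r s \<le> mix_kernel \<nu> l 0 s"
  by (auto simp: mix_kernel_def indicator_def intro!: mult_left_mono)

lemma integrable_mix_kernel:
  assumes "l > 0" "\<nu> > 0" shows "integrable lborel (mix_kernel \<nu> l r)"
proof (rule Bochner_Integration.integrable_bound)
  show "integrable lborel (mix_kernel \<nu> l 0)"
    using nn_integral_Gamma_scaled[of "l\<^sup>2" \<nu>] assms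
    by (intro integrableI_nonneg) (auto simp: mix_kernel_nonneg mix_kernel_def)
  show "AE s in lborel. norm (mix_kernel \<nu> l r s) \<le> norm (mix_kernel \<nu> l 0 s)"
    using mix_kernel_le[of \<nu> l r] by (auto simp: abs_of_nonneg[OF mix_kernel_nonneg])
qed simp

lemma nn_integral_mix_kernel:
  assumes "l > 0" "\<nu> > 0"
  shows "(\<integral>\<^sup>+s. ennreal (mix_kernel \<nu> l r s) \<partial>lborel) = ennreal (mix_integral \<nu> l r)"
  unfolding mix_integral_def
  by (rule nn_integral_eq_integral) (auto intro: integrable_mix_kernel assms mix_kernel_nonneg)

lemma mix_integral_nonneg: "0 \<le> mix_integral \<nu> l r"
  unfolding mix_integral_def by (rule Bochner_Integration.integral_nonneg) (rule mix_kernel_nonneg)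

text \<open>
  With \<open>s = r e\<^sup>v / (2 l)\<close> the two terms \<open>l\<^sup>2 s\<close> and \<open>r\<^sup>2 / (4 s)\<close> become \<open>l r e\<^sup>v / 2\<close> and \<open>l r
  e\<^sup>-\<^sup>v / 2\<close>, whose sum is \<open>l r cosh v\<close>.
\<close>
lemma nn_integral_mix_kernel_exp_substitution:
  assumes "l > 0" "r > 0"
  shows "(\<integral>\<^sup>+s. ennreal (mix_kernel \<nu> l r s) \<partial>lborel) =
    ennreal ((r / (2 * l)) powr \<nu>) * (\<integral>\<^sup>+v. ennreal (exp (\<nu> * v) * exp (- (l * r * cosh v)))
        \<partial>lborel)"
proof -
  define c where "c = r / (2 * l)"
  have c: "c > 0" "l\<^sup>2 * c = l * r / 2" "r\<^sup>2 / (4 * c) = l * r / 2"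
    using assms by (auto simp: c_def power2_eq_square)
  let ?f = "\<lambda>s. s powr (\<nu> - 1) * exp (- (l\<^sup>2 * s) - r\<^sup>2 / (4 * s))"
  have R: "range (\<lambda>v. c * exp v) = {0<..}"
  proof (intro set_eqI iffI)
    fix x :: real assume "x \<in> {0<..}"
    then have "x = c * exp (ln (x / c))" using c by simp
    then show "x \<in> range (\<lambda>v. c * exp v)" by blast
  qed (use c in auto)
  have "(\<integral>\<^sup>+s. ennreal (mix_kernel \<nu> l r s) \<partial>lborel)
      = (\<integral>\<^sup>+s. ennreal (?f s) * indicator (range (\<lambda>v. c * exp v)) s \<partial>lborel)"
    unfolding R by (intro nn_integral_cong) (auto simp: mix_kernel_def split: split_indicator)
  also have "\<dots> = (\<integral>\<^sup>+v. ennreal (?f (c * exp v)) * ennreal (c * exp v) \<partial>lborel)"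
    by (rule nn_integral_increasing_substitution)
      (use c in \<open>auto intro!: derivative_eq_intros continuous_intros\<close>)
  also have "\<dots> = (\<integral>\<^sup>+v. ennreal (c powr \<nu>) * ennreal (exp (\<nu> * v) * exp (- (l * r * cosh v)))
      \<partial>lborel)"
  proof (intro nn_integral_cong)
    fix v :: real
    have 1: "(c * exp v) powr (\<nu> - 1) * (c * exp v) = c powr \<nu> * exp (\<nu> * v)"
    proof -
      have "(c * exp v) powr (\<nu> - 1) * (c * exp v) = (c * exp v) powr \<nu>"
        using c powr_mult_base[of "c * exp v" "\<nu> - 1"] by (simp add: mult.commute)
      also have "\<dots> = c powr \<nu> * exp (\<nu> * v)"
        using c by (simp add: powr_mult) (simp add: powr_def)
      finally show ?thesis .
    qed
    have "r\<^sup>2 / (4 * (c * exp v)) = (l * r / 2) * exp (- v)"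
      unfolding c(3)[symmetric] by (simp add: exp_minus field_simps)
    moreover have "l\<^sup>2 * (c * exp v) = (l * r / 2) * exp v" unfolding c(2)[symmetric] by simp
    ultimately have 2: "- (l\<^sup>2 * (c * exp v)) - r\<^sup>2 / (4 * (c * exp v)) = - (l * r * cosh v)"
      by (simp add: cosh_field_def algebra_simps)
    have "?f (c * exp v) * (c * exp v) = c powr \<nu> * (exp (\<nu> * v) * exp (- (l * r * cosh v)))"
      unfolding 2 using 1 by (simp add: mult_ac)
    then show "ennreal (?f (c * exp v)) * ennreal (c * exp v) =
        ennreal (c powr \<nu>) * ennreal (exp (\<nu> * v) * exp (- (l * r * cosh v)))"
      using c by (simp add: ennreal_mult''[symmetric])
  qed
  also have "\<dots> = ennreal (c powr \<nu>) * (\<integral>\<^sup>+v. ennreal (exp (\<nu> * v) * exp (- (l * r * cosh v)))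
      \<partial>lborel)"
    by (rule nn_integral_cmult) (auto simp: cosh_field_def)
  finally show ?thesis by (simp add: c_def)
qed

lemma nn_integral_fold_half_line:
  fixes h :: "real \<Rightarrow> real"
  assumes [measurable]: "h \<in> borel_measurable borel" and "\<And>v. 0 \<le> h v"
  shows "(\<integral>\<^sup>+v. ennreal (h v) \<partial>lborel) = (\<integral>\<^sup>+v. ennreal (indicator {0<..} v * (h v + h (- v)))
      \<partial>lborel)"
proof -
  have "(\<integral>\<^sup>+v. ennreal (h v) \<partial>lborel) =
      (\<integral>\<^sup>+v. ennreal (indicator {0<..} v * h v) + ennreal (indicator {..<0} v * h v) \<partial>lborel)"
    by (intro nn_integral_cong_AE eventually_mono[OF AE_lborel_singleton[of 0]])
      (auto split: split_indicator)
  also have "\<dots> = (\<integral>\<^sup>+v. ennreal (indicator {0<..} v * h v) \<partial>lborel)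
      + (\<integral>\<^sup>+v. ennreal (indicator {..<0} v * h v) \<partial>lborel)"
    by (rule nn_integral_add) auto
  also have "(\<integral>\<^sup>+v. ennreal (indicator {..<0} v * h v) \<partial>lborel) =
      (\<integral>\<^sup>+v. ennreal (indicator {0<..} v * h (- v)) \<partial>lborel)"
    by (subst nn_integral_real_affine[where c = "-1" and t = 0])
      (auto intro!: nn_integral_cong split: split_indicator)
  also have "(\<integral>\<^sup>+v. ennreal (indicator {0<..} v * h v) \<partial>lborel) + \<dots> =
      (\<integral>\<^sup>+v. ennreal (indicator {0<..} v * (h v + h (- v))) \<partial>lborel)"
    by (subst nn_integral_add[symmetric])
      (auto intro!: nn_integral_cong simp: assms ring_distribs)
  finally show ?thesis .
qed

lemma mix_integral_eq_besselK:
  assumes "l > 0" "r > 0" "\<nu> > 0"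
  shows "mix_integral \<nu> l r = 2 * (r / (2 * l)) powr \<nu> * besselK \<nu> (l * r)"
proof -
  let ?B = "\<lambda>v. indicator {0<..} v * (exp (- (l * r * cosh v)) * cosh (\<nu> * v))"
  have "ennreal (mix_integral \<nu> l r) =
     ennreal ((r / (2 * l)) powr \<nu>) * (\<integral>\<^sup>+v. ennreal (exp (\<nu> * v) * exp (- (l * r * cosh v)))
         \<partial>lborel)"
    using nn_integral_mix_kernel_exp_substitution[OF assms(1,2),
        of \<nu>] nn_integral_mix_kernel[OF assms(1,3), of r] by simp
  also have "(\<integral>\<^sup>+v. ennreal (exp (\<nu> * v) * exp (- (l * r * cosh v))) \<partial>lborel)
      = (\<integral>\<^sup>+v. ennreal 2 * ennreal (?B v) \<partial>lborel)"
  proof -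
    have "indicator {0<..} v * (exp (\<nu> * v) * exp (- (l * r * cosh v)) + exp (\<nu> * - v)
        * exp (- (l * r * cosh (- v)))) = 2 * ?B v" for v :: real
      by (simp add: cosh_field_def[of "\<nu> * v"] algebra_simps split: split_indicator)
    note eq = this
    have "(\<integral>\<^sup>+v. ennreal (exp (\<nu> * v) * exp (- (l * r * cosh v))) \<partial>lborel) =
      (\<integral>\<^sup>+v. ennreal (indicator {0<..} v * (exp (\<nu> * v) * exp (- (l * r * cosh v)) + exp (\<nu> * - v)
          * exp (- (l * r * cosh (- v))))) \<partial>lborel)"
      by (rule nn_integral_fold_half_line) (auto simp: cosh_field_def[abs_def])
    also have "\<dots> = (\<integral>\<^sup>+v. ennreal 2 * ennreal (?B v) \<partial>lborel)"
      by (simp only: eq) (intro nn_integral_cong ennreal_mult', simp)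
    finally show ?thesis .
  qed
  also have "\<dots> = ennreal 2 * (\<integral>\<^sup>+v. ennreal (?B v) \<partial>lborel)"
    by (rule nn_integral_cmult) (auto simp: cosh_field_def)
  finally have eq: "ennreal (mix_integral \<nu> l r)
      = ennreal (2 * (r / (2 * l)) powr \<nu>) * (\<integral>\<^sup>+v. ennreal (?B v) \<partial>lborel)"
    by (simp add: ennreal_mult' mult_ac)
  have pos: "0 < 2 * (r / (2 * l)) powr \<nu>" using assms by simp
  have "(\<integral>\<^sup>+v. ennreal (?B v) \<partial>lborel) < \<infinity>"
  proof (rule ccontr)
    assume "\<not> ?thesis"
    then have "(\<integral>\<^sup>+v. ennreal (?B v) \<partial>lborel) = \<infinity>" by (simp add: less_top[symmetric])
    with eq pos show False by (simp add: ennreal_mult_eq_top_iff ennreal_mult_top)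
  qed
  then have "integrable lborel ?B"
    by (intro integrableI_nonneg) (auto simp: cosh_field_def)
  then have "(\<integral>\<^sup>+v. ennreal (?B v) \<partial>lborel) = ennreal (besselK \<nu> (l * r))"
    by (subst nn_integral_eq_integral)
      (auto simp: besselK_def set_lebesgue_integral_def cosh_real_nonneg)
  moreover have "0 \<le> besselK \<nu> (l * r)"
    unfolding besselK_def set_lebesgue_integral_def
    by (intro Bochner_Integration.integral_nonneg) (auto simp: cosh_real_nonneg)
  ultimately show ?thesis
    using eq pos by (simp add: ennreal_mult'[symmetric] mix_integral_nonneg)
qed

section \<open>Convolution of exponential kernels\<close>

text \<open>
  The exponential is a mixture of Gaussians, corresponding to the elementary Bessel function of
  order \<open>1/2\<close>. Only the even part of \<open>exp (v / 2)\<close> contributes to the integral over \<open>v\<close>, and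
  since \<open>cosh v = 1 + 2 (sinh (v / 2))\<^sup>2\<close> the substitution \<open>y = sinh (v / 2)\<close> makes it Gaussian.
\<close>
lemma mix_integral_half:
  assumes "l > 0" "r \<ge> 0"
  shows "mix_integral (1 / 2) l r = sqrt pi / l * exp (- (l * r))"
proof (cases "r = 0")
  case True
  have "ennreal (mix_integral (1 / 2) l 0) = ennreal (Gamma (1/2) / (l\<^sup>2) powr (1/2))"
    using nn_integral_mix_kernel[OF assms(1), of "1/2" 0] nn_integral_Gamma_scaled[of "l\<^sup>2"
        "1/2"] assms
    by (simp add: mix_kernel_def)
  moreover have "Gamma (1/2) / (l\<^sup>2) powr (1/2) = sqrt pi / l"
    using assms by (simp add: powr_half_sqrt Gamma_one_half_real)
  ultimately show ?thesis using True assms by (simp add: mix_integral_nonneg)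
next
  case False
  define z where "z = l * r"
  have r: "r > 0" and z: "z > 0" using False assms by (auto simp: z_def)
  let ?h = "\<lambda>v. exp (1 / 2 * v) * exp (- (z * cosh v))"
  let ?k = "\<lambda>v. cosh (v / 2) * exp (- (z * cosh v))"
  have "(\<integral>\<^sup>+v. ennreal (?h v) \<partial>lborel) = (\<integral>\<^sup>+v. ennreal (indicator {0<..} v * (?h v + ?h (- v)))
      \<partial>lborel)"
    by (rule nn_integral_fold_half_line) (auto simp: cosh_field_def[abs_def])
  also have "\<dots> = (\<integral>\<^sup>+v. ennreal (indicator {0<..} v * (?k v + ?k (- v))) \<partial>lborel)"
  proof (intro nn_integral_cong)
    fix v :: real
    have "?h v + ?h (- v) = ?k v + ?k (- v)"
      by (simp add: cosh_field_def[of "v/2"] algebra_simps)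
    then show "ennreal (indicator {0<..} v * (?h v + ?h (- v)))
        = ennreal (indicator {0<..} v * (?k v + ?k (- v)))"
      by simp
  qed
  also have "\<dots> = (\<integral>\<^sup>+v. ennreal (?k v) \<partial>lborel)"
    by (rule nn_integral_fold_half_line[symmetric]) (auto simp:
        cosh_field_def[abs_def] cosh_real_nonneg)
  also have "\<dots> = (\<integral>\<^sup>+v. ennreal (2 * exp (- z) * exp (- (2 * z * (sinh (v / 2))\<^sup>2)))
      * ennreal (cosh (v / 2) / 2) \<partial>lborel)"
  proof (intro nn_integral_cong)
    fix v :: real
    have "cosh v = 1 + 2 * (sinh (v / 2))\<^sup>2"
      using cosh_double[of "v / 2"] cosh_square_eq[of "v/2"] by simp
    then have "exp (- (z * cosh v)) = exp (- z) * exp (- (2 * z * (sinh (v / 2))\<^sup>2))"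
      by (simp add: exp_add[symmetric] algebra_simps)
    then show "ennreal (?k v) = ennreal (2 * exp (- z) * exp (- (2 * z * (sinh (v / 2))\<^sup>2)))
        * ennreal (cosh (v / 2) / 2)"
      by (simp add: ennreal_mult'[symmetric] mult_ac)
  qed
  also have "\<dots> = (\<integral>\<^sup>+y. ennreal (2 * exp (- z) * exp (- (2 * z * y\<^sup>2)))
      * indicator (range (\<lambda>v::real. sinh (v / 2))) y \<partial>lborel)"
    by (rule nn_integral_increasing_substitution[symmetric])
      (auto intro!: derivative_eq_intros continuous_intros simp: cosh_real_nonneg)
  also have "range (\<lambda>v::real. sinh (v / 2)) = UNIV"
  proof -
    have "y = sinh (2 * arsinh y / 2)" for y :: real by simp
    then show ?thesis by blast
  qed
  also have "(\<integral>\<^sup>+y. ennreal (2 * exp (- z) * exp (- (2 * z * y\<^sup>2))) * indicator UNIV y \<partial>lborel)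
      = ennreal (2 * exp (- z)) * (\<integral>\<^sup>+y. ennreal (exp (- (2 * z * y\<^sup>2))) \<partial>lborel)"
    by (subst nn_integral_cmult[symmetric]) (auto simp: ennreal_mult')
  also have "\<dots> = ennreal (2 * exp (- z) * sqrt (pi / (2 * z)))"
    using z nn_integral_gaussian[of "2 * z"] by (simp add: ennreal_mult')
  finally have "ennreal (mix_integral (1/2) l r)
      = ennreal ((r / (2 * l)) powr (1/2)) * ennreal (2 * exp (- z) * sqrt (pi / (2 * z)))"
    using nn_integral_mix_kernel_exp_substitution[OF assms(1) r, of
        "1/2"] nn_integral_mix_kernel[OF assms(1), of "1/2" r]
    by (simp add: z_def)
  also have "\<dots> = ennreal (sqrt (r / (2 * l)) * (2 * exp (- z) * sqrt (pi / (2 * z))))"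
    using assms by (simp add: ennreal_mult' powr_half_sqrt)
  also have "sqrt (r / (2 * l)) * (2 * exp (- z) * sqrt (pi / (2 * z))) = sqrt pi / l * exp (- z)"
  proof -
    have "sqrt (r / (2 * l)) * sqrt (pi / (2 * z)) = sqrt (pi / (2 * l)\<^sup>2)"
      using r assms by (simp add: real_sqrt_mult[symmetric] z_def power2_eq_square)
    also have "\<dots> = sqrt pi / (2 * l)" using assms by (simp add: real_sqrt_divide real_sqrt_mult)
    finally have "sqrt (r / (2 * l)) * sqrt (pi / (2 * z)) = sqrt pi / (2 * l)" .
    moreover have "sqrt (r / (2 * l)) * (2 * exp (- z) * sqrt (pi / (2 * z))) =
        (sqrt (r / (2 * l)) * sqrt (pi / (2 * z))) * (2 * exp (- z))" by (simp only: mult_ac)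
    ultimately show ?thesis by simp
  qed
  finally show ?thesis
    using assms by (simp add: mix_integral_nonneg z_def)
qed

lemma nn_integral_Beta_scaled:
  assumes a: "a > (0::real)"
  shows "(\<integral>\<^sup>+s. ennreal (indicator {0<..} s * indicator {0<..} (\<sigma> - s) * (s * (\<sigma> - s)) powr (a - 1))
      \<partial>lborel) =
    ennreal (indicator {0<..} \<sigma> * \<sigma> powr (2 * a - 1) * Beta a a)"
proof (cases "\<sigma> > 0")
  case True
  let ?b = "\<lambda>x. indicator {0..1} x * (x powr (a - 1) * (1 - x) powr (a - 1))"
  have "(\<integral>\<^sup>+s. ennreal (indicator {0<..} s * indicator {0<..} (\<sigma> - s) * (s * (\<sigma> - s)) powr (a - 1))
      \<partial>lborel)
     = ennreal \<bar>\<sigma>\<bar> * (\<integral>\<^sup>+x. ennreal (indicator {0<..} (0 + \<sigma> * x)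
         * indicator {0<..} (\<sigma> - (0 + \<sigma> * x)) * ((0 + \<sigma> * x) * (\<sigma> - (0 + \<sigma> * x))) powr (a - 1))
         \<partial>lborel)"
    by (rule nn_integral_real_affine) (use True in auto)
  also have "(\<integral>\<^sup>+x. ennreal (indicator {0<..} (0 + \<sigma> * x) * indicator {0<..} (\<sigma> - (0 + \<sigma> * x))
      * ((0 + \<sigma> * x) * (\<sigma> - (0 + \<sigma> * x))) powr (a - 1)) \<partial>lborel)
     = (\<integral>\<^sup>+x. ennreal (\<sigma> powr (2 * a - 2)) * ennreal (?b x) \<partial>lborel)"
  proof (intro nn_integral_cong)
    fix x :: real
    have e: "\<sigma> - \<sigma> * x = \<sigma> * (1 - x)" by (simp add: algebra_simps)
    consider "0 < x \<and> x < 1" | "x \<le> 0" | "x \<ge> 1" by linarith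
    then show "ennreal (indicator {0<..} (0 + \<sigma> * x) * indicator {0<..} (\<sigma> - (0 + \<sigma> * x))
        * ((0 + \<sigma> * x) * (\<sigma> - (0 + \<sigma> * x))) powr (a - 1))
       = ennreal (\<sigma> powr (2 * a - 2)) * ennreal (?b x)"
    proof cases
      case 1
      have "\<sigma> powr (2 * a - 2) = \<sigma> powr (a - 1) * \<sigma> powr (a - 1)"
        by (simp add: powr_add[symmetric])
      then show ?thesis using 1 True by (simp add: e powr_mult ennreal_mult'[symmetric] mult_ac)
    next
      case 2
      then have "\<sigma> * x \<le> 0" using True by (simp add: mult_nonneg_nonpos)
      then show ?thesis using 2 by (auto simp: indicator_def)
    next
      case 3
      then have "\<sigma> * 1 \<le> \<sigma> * x" using True by (intro mult_left_mono) auto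
      then show ?thesis using 3 by (auto simp: indicator_def)
    qed
  qed
  also have "\<dots> = ennreal (\<sigma> powr (2 * a - 2)) * (\<integral>\<^sup>+x. ennreal (?b x) \<partial>lborel)"
    by (rule nn_integral_cmult) auto
  also have "(\<integral>\<^sup>+x. ennreal (?b x) \<partial>lborel) = ennreal (Beta a a)"
    using nn_integral_has_integral_lebesgue[OF _ has_integral_Beta_real[OF a a]] by simp
  also have "ennreal \<bar>\<sigma>\<bar> * (ennreal (\<sigma> powr (2 * a - 2)) * ennreal (Beta a a))
      = ennreal (\<sigma> powr (2 * a - 1) * Beta a a)"
  proof -
    have "\<sigma> powr (2 * a - 1) = \<sigma> * \<sigma> powr (2 * a - 2)"
      using True powr_mult_base[of \<sigma> "2 * a - 2"] by simp
    then show ?thesis using True by (simp add: ennreal_mult' mult.assoc)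
  qed
  finally show ?thesis using True by simp
next
  case False
  then have "indicator {0<..} s * indicator {0<..} (\<sigma> - s) = (0::real)" for s
    by (auto simp: indicator_def)
  then show ?thesis using False by (simp only: mult_zero_left) simp
qed

text \<open>
  In polar-like coordinates \<open>\<sigma> = s + s'\<close> a function of the sum sees only the convolution of the
  two powers, which is the Beta integral scaled to the interval from 0 to \<open>\<sigma>\<close>.
\<close>
lemma nn_integral_Beta_convolution:
  assumes a: "a > (0::real)" and [measurable]: "H \<in> borel_measurable borel" and H: "\<And>\<sigma>. 0 \<le> H \<sigma>"
  shows "(\<integral>\<^sup>+s. \<integral>\<^sup>+s'. ennreal (indicator {0<..} s * indicator {0<..} s' * (s * s') powr (a - 1)
      * H (s + s')) \<partial>lborel \<partial>lborel) =
    ennreal (Beta a a) * (\<integral>\<^sup>+\<sigma>. ennreal (indicator {0<..} \<sigma> * \<sigma> powr (2 * a - 1) * H \<sigma>) \<partial>lborel)"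
proof -
  let ?g = "\<lambda>s \<sigma>. indicator {0<..} s * indicator {0<..} (\<sigma> - s) * (s * (\<sigma> - s)) powr (a - 1)"
  have "(\<integral>\<^sup>+s. \<integral>\<^sup>+s'. ennreal (indicator {0<..} s * indicator {0<..} s' * (s * s') powr (a - 1)
      * H (s + s')) \<partial>lborel \<partial>lborel)
     = (\<integral>\<^sup>+s. \<integral>\<^sup>+\<sigma>. ennreal (?g s \<sigma> * H \<sigma>) \<partial>lborel \<partial>lborel)"
  proof (rule nn_integral_cong)
    fix s :: real
    show "(\<integral>\<^sup>+s'. ennreal (indicator {0<..} s * indicator {0<..} s' * (s * s') powr (a - 1)
        * H (s + s')) \<partial>lborel)
       = (\<integral>\<^sup>+\<sigma>. ennreal (?g s \<sigma> * H \<sigma>) \<partial>lborel)"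
      by (subst (2) nn_integral_real_affine[where c = 1 and t = s]) auto
  qed
  also have "\<dots> = (\<integral>\<^sup>+\<sigma>. \<integral>\<^sup>+s. ennreal (?g s \<sigma> * H \<sigma>) \<partial>lborel \<partial>lborel)"
    by (rule lborel_pair.Fubini') (auto simp: case_prod_unfold cong: measurable_cong_sets)
  also have "\<dots> = (\<integral>\<^sup>+\<sigma>. ennreal (Beta a a) * ennreal (indicator {0<..} \<sigma> * \<sigma> powr (2 * a - 1) * H \<sigma>)
      \<partial>lborel)"
  proof (intro nn_integral_cong)
    fix \<sigma>
    have "(\<integral>\<^sup>+s. ennreal (?g s \<sigma> * H \<sigma>) \<partial>lborel) = (\<integral>\<^sup>+s. ennreal (?g s \<sigma>) \<partial>lborel) * ennreal (H \<sigma>)"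
      by (subst nn_integral_multc[symmetric]) (auto simp: ennreal_mult'' H)
    also have "\<dots> = ennreal (indicator {0<..} \<sigma> * \<sigma> powr (2 * a - 1) * Beta a a) * ennreal (H \<sigma>)"
      by (simp only: nn_integral_Beta_scaled[OF a])
    finally have *: "(\<integral>\<^sup>+s. ennreal (?g s \<sigma> * H \<sigma>) \<partial>lborel) =
      ennreal (indicator {0<..} \<sigma> * \<sigma> powr (2 * a - 1) * Beta a a) * ennreal (H \<sigma>)" .
    show "(\<integral>\<^sup>+s. ennreal (?g s \<sigma> * H \<sigma>) \<partial>lborel)
        = ennreal (Beta a a) * ennreal (indicator {0<..} \<sigma> * \<sigma> powr (2 * a - 1) * H \<sigma>)"
    proof -
      have B: "0 \<le> Beta a a"
        using a by (auto simp: Beta_def intro!: mult_nonneg_nonneg divide_nonneg_nonneg)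
      show ?thesis
        by (simp only: * ennreal_mult''[OF H, symmetric] ennreal_mult'[OF B, symmetric]) (simp only:
            mult_ac)
    qed
  qed
  also have "\<dots> = ennreal (Beta a a) * (\<integral>\<^sup>+\<sigma>. ennreal (indicator {0<..} \<sigma> * \<sigma> powr (2 * a - 1) * H \<sigma>)
      \<partial>lborel)"
    by (rule nn_integral_cmult) auto
  finally show ?thesis .
qed

text \<open>
  The factor that remains when the convolution of two exponential kernels is written as a single
  mixture of Gaussians.
\<close>
definition conv_const :: "nat \<Rightarrow> real" where
  "conv_const d = (4 * pi) powr (real d / 2) / pi * Beta ((real d + 1) / 2) ((real d + 1) / 2)"

text \<open>
  Both exponentials are mixtures of Gaussians. After Tonelli the inner integral is a convolution
  of Gaussians with parameters \<open>1 / (4 s)\<close> and \<open>1 / (4 s')\<close>; the result depends on \<open>s + s'\<close> and,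
  through a power, on \<open>s s'\<close>, which is the situation of the Beta integral.
\<close>
lemma nn_integral_exp_norm_convolution:
  fixes t :: "'a::euclidean_space"
  assumes l: "l > 0"
  shows "(\<integral>\<^sup>+u. ennreal (exp (- (l * norm u)) * exp (- (l * norm (t - u)))) \<partial>lborel) =
    ennreal (conv_const DIM('a) * l\<^sup>2 * mix_integral (real DIM('a) / 2 + 1) l (norm t))"
proof -
  let ?d = "real DIM('a)"
  let ?k = "\<lambda>r s. mix_kernel (1/2) l r s"
  define c where "c = l\<^sup>2 / pi"
  have c: "c > 0" using l by (simp add: c_def)
  define H where "H \<sigma> = (4 * pi) powr (?d / 2)
      * (\<sigma> powr (- ?d / 2) * exp (- (l\<^sup>2 * \<sigma>) - (norm t)\<^sup>2 / (4 * \<sigma>)))" for \<sigma>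
  have [measurable]: "H \<in> borel_measurable borel" unfolding H_def[abs_def] by measurable
  have "(\<integral>\<^sup>+u. ennreal (exp (- (l * norm u)) * exp (- (l * norm (t - u)))) \<partial>lborel) =
     (\<integral>\<^sup>+u. ennreal c * (\<integral>\<^sup>+s. \<integral>\<^sup>+s'. ennreal (?k (norm u) s * ?k (norm (t - u)) s') \<partial>lborel
         \<partial>lborel) \<partial>lborel)"
  proof (intro nn_integral_cong)
    fix u :: 'a
    have "(\<integral>\<^sup>+s. \<integral>\<^sup>+s'. ennreal (?k (norm u) s * ?k (norm (t - u)) s') \<partial>lborel \<partial>lborel)
       = (\<integral>\<^sup>+s. ennreal (?k (norm u) s) * ennreal (mix_integral (1/2) l (norm (t - u))) \<partial>lborel)"
    proof (intro nn_integral_cong)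
      fix s
      show "(\<integral>\<^sup>+s'. ennreal (?k (norm u) s * ?k (norm (t - u)) s') \<partial>lborel)
          = ennreal (?k (norm u) s) * ennreal (mix_integral (1/2) l (norm (t - u)))"
        using nn_integral_mix_kernel[OF l, of "1/2" "norm (t - u)"]
        by (simp add: ennreal_mult' mix_kernel_nonneg nn_integral_cmult)
    qed
    also have "\<dots> = ennreal (mix_integral (1/2) l (norm u))
        * ennreal (mix_integral (1/2) l (norm (t - u)))"
      using nn_integral_mix_kernel[OF l, of "1/2" "norm u"] by (simp add: nn_integral_multc)
    also have "\<dots> = ennreal (pi / l\<^sup>2 * (exp (- (l * norm u)) * exp (- (l * norm (t - u)))))"
      using l by (simp add: mix_integral_half ennreal_mult'[symmetric] power2_eq_square)
    finally show "ennreal (exp (- (l * norm u)) * exp (- (l * norm (t - u)))) =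
      ennreal c * (\<integral>\<^sup>+s. \<integral>\<^sup>+s'. ennreal (?k (norm u) s * ?k (norm (t - u)) s') \<partial>lborel \<partial>lborel)"
      using l by (simp add: c_def ennreal_mult'[symmetric])
  qed
  also have "\<dots> = ennreal c * (\<integral>\<^sup>+u. (\<integral>\<^sup>+s. \<integral>\<^sup>+s'. ennreal (?k (norm u) s * ?k (norm (t - u)) s')
      \<partial>lborel \<partial>lborel) \<partial>lborel)"
    unfolding mix_kernel_def by (rule nn_integral_cmult) measurable
  also have "(\<integral>\<^sup>+u. (\<integral>\<^sup>+s. \<integral>\<^sup>+s'. ennreal (?k (norm u) s * ?k (norm (t - u)) s') \<partial>lborel \<partial>lborel)
      \<partial>lborel)
     = (\<integral>\<^sup>+s. \<integral>\<^sup>+u. \<integral>\<^sup>+s'. ennreal (?k (norm u) s * ?k (norm (t - u)) s') \<partial>lborel \<partial>lborel \<partial>lborel)"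
  proof -
    show ?thesis unfolding mix_kernel_def by (rule lborel_pair.Fubini') measurable
  qed
  also have "\<dots> = (\<integral>\<^sup>+s. \<integral>\<^sup>+s'. \<integral>\<^sup>+u. ennreal (?k (norm u) s * ?k (norm (t - u)) s') \<partial>lborel \<partial>lborel
      \<partial>lborel)"
  proof -
    show ?thesis unfolding mix_kernel_def by (intro nn_integral_cong lborel_pair.Fubini') measurable
  qed
  also have "\<dots> = (\<integral>\<^sup>+s. \<integral>\<^sup>+s'. ennreal (indicator {0<..} s * indicator {0<..} s'
      * (s * s') powr ((?d + 1) / 2 - 1) * H (s + s')) \<partial>lborel \<partial>lborel)"
  proof (intro nn_integral_cong)
    fix s s' :: real
    show "(\<integral>\<^sup>+u. ennreal (?k (norm u) s * ?k (norm (t - u)) s') \<partial>lborel) =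
      ennreal (indicator {0<..} s * indicator {0<..} s' * (s * s') powr ((?d + 1) / 2 - 1)
          * H (s + s'))"
    proof (cases "s > 0 \<and> s' > 0")
      case True
      then have pos: "s > 0" "s' > 0" by auto
      define a where "a = 1 / (4 * s)"
      define b where "b = 1 / (4 * s')"
      have ab: "a > 0" "b > 0" using pos by (auto simp: a_def b_def)
      define K where "K = (s * s') powr (- 1 / 2) * exp (- (l\<^sup>2 * (s + s')))"
      have "?k (norm u) s * ?k (norm (t - u)) s'
          = K * (exp (- (a * (norm u)\<^sup>2)) * exp (- (b * (norm (t - u))\<^sup>2)))" for u
      proof -
        have "exp (- (l\<^sup>2 * s) - (norm u)\<^sup>2 / (4 * s))
            = exp (- (l\<^sup>2 * s)) * exp (- (a * (norm u)\<^sup>2))"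
          "exp (- (l\<^sup>2 * s') - (norm (t - u))\<^sup>2 / (4 * s'))
              = exp (- (l\<^sup>2 * s')) * exp (- (b * (norm (t - u))\<^sup>2))"
          "exp (- (l\<^sup>2 * (s + s'))) = exp (- (l\<^sup>2 * s)) * exp (- (l\<^sup>2 * s'))"
          by (simp_all add: a_def b_def exp_add[symmetric] algebra_simps)
        then show ?thesis
          using pos by (simp add: mix_kernel_def K_def powr_mult mult_ac)
      qed
      then have "(\<integral>\<^sup>+u. ennreal (?k (norm u) s * ?k (norm (t - u)) s') \<partial>lborel) =
        ennreal K * (\<integral>\<^sup>+u. ennreal (exp (- (a * (norm u)\<^sup>2)) * exp (- (b * (norm (t - u))\<^sup>2)))
            \<partial>lborel)"
        by (subst nn_integral_cmult[symmetric]) (auto simp: ennreal_mult' K_def)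
      also have "\<dots> = ennreal (K * ((pi / (a + b)) powr (?d / 2)
          * exp (- (a * b / (a + b) * (norm t)\<^sup>2))))"
        unfolding gaussian_convolution[OF ab] by (simp add: ennreal_mult' K_def)
      also have "pi / (a + b) = 4 * pi * (s * s') / (s + s')"
        using pos by (simp add: a_def b_def field_simps)
      also have "a * b / (a + b) * (norm t)\<^sup>2 = (norm t)\<^sup>2 / (4 * (s + s'))"
        using pos by (simp add: a_def b_def field_simps)
      also have "(4 * pi * (s * s') / (s + s')) powr (?d / 2)
          = (4 * pi) powr (?d / 2) * (s * s') powr (?d / 2) * (s + s') powr (- ?d / 2)"
        using pos by (simp add: powr_mult powr_divide powr_minus_divide)
      also have "K * ((4 * pi) powr (?d / 2) * (s * s') powr (?d / 2) * (s + s') powr (- ?d / 2)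
          * exp (- ((norm t)\<^sup>2 / (4 * (s + s'))))) =
         ((s * s') powr (- 1 / 2) * (s * s') powr (?d / 2)) * H (s + s')"
      proof -
        have "exp (- (l\<^sup>2 * (s + s')) - (norm t)\<^sup>2 / (4 * (s + s'))) =
            exp (- (l\<^sup>2 * (s + s'))) * exp (- ((norm t)\<^sup>2 / (4 * (s + s'))))"
          by (simp add: exp_add[symmetric])
        then show ?thesis by (simp only: K_def H_def mult_ac)
      qed
      also have "(s * s') powr (- 1 / 2) * (s * s') powr (?d / 2)
          = (s * s') powr ((?d + 1) / 2 - 1)"
        unfolding powr_add[symmetric] by (simp add: field_simps)
      finally show ?thesis using pos by simp
    next
      case False
      then show ?thesis by (auto simp: mix_kernel_def indicator_def)
    qed
  qed
  also have "\<dots> = ennreal (Beta ((?d + 1) / 2) ((?d + 1) / 2)) *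
      (\<integral>\<^sup>+\<sigma>. ennreal (indicator {0<..} \<sigma> * \<sigma> powr (2 * ((?d + 1) / 2) - 1) * H \<sigma>) \<partial>lborel)"
    by (rule nn_integral_Beta_convolution) (auto simp: H_def)
  also have "(\<integral>\<^sup>+\<sigma>. ennreal (indicator {0<..} \<sigma> * \<sigma> powr (2 * ((?d + 1) / 2) - 1) * H \<sigma>) \<partial>lborel)
      = (\<integral>\<^sup>+\<sigma>. ennreal ((4 * pi) powr (?d / 2)) * ennreal (mix_kernel (?d / 2 + 1) l (norm t) \<sigma>)
          \<partial>lborel)"
  proof (intro nn_integral_cong)
    fix \<sigma> :: real
    have "\<sigma> powr (2 * ((?d + 1) / 2) - 1) * \<sigma> powr (- ?d / 2) = \<sigma> powr (?d / 2 + 1 - 1)"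
      unfolding powr_add[symmetric] by (simp add: field_simps)
    then have "indicator {0<..} \<sigma> * \<sigma> powr (2 * ((?d + 1) / 2) - 1) * H \<sigma> =
        (4 * pi) powr (?d / 2) * mix_kernel (?d / 2 + 1) l (norm t) \<sigma>"
      unfolding mix_kernel_def H_def by (simp split: split_indicator)
    then show "ennreal (indicator {0<..} \<sigma> * \<sigma> powr (2 * ((?d + 1) / 2) - 1) * H \<sigma>) =
       ennreal ((4 * pi) powr (?d / 2)) * ennreal (mix_kernel (?d / 2 + 1) l (norm t) \<sigma>)"
      by (simp add: ennreal_mult')
  qed
  also have "\<dots> = ennreal ((4 * pi) powr (?d / 2)) * ennreal (mix_integral (?d / 2 + 1) l (norm t))"
    using l by (subst nn_integral_cmult) (auto simp: nn_integral_mix_kernel)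
  also have "ennreal c * (ennreal (Beta ((?d + 1) / 2) ((?d + 1) / 2)) * \<dots>) =
      ennreal (conv_const DIM('a) * l\<^sup>2 * mix_integral (?d / 2 + 1) l (norm t))"
  proof -
    have "0 \<le> Beta ((?d + 1) / 2) ((?d + 1) / 2)"
      by (auto simp: Beta_def intro!: mult_nonneg_nonneg divide_nonneg_nonneg)
    then show ?thesis using c by (simp add: ennreal_mult'[symmetric] conv_const_def c_def
        mix_integral_nonneg mult_ac)
  qed
  finally show ?thesis .
qed

section \<open>The Bessel function and the spectral density as Gaussian mixtures\<close>

text \<open>
  This includes the limit \<open>r \<rightarrow> 0\<close>, where the Bessel function itself is singular.
\<close>
lemma mix_integral_tendsto:
  assumes l: "l > 0" and \<nu>: "\<nu> > 0" and r: "r \<longlonglongrightarrow> r0"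
  shows "(\<lambda>n. mix_integral \<nu> l (r n)) \<longlonglongrightarrow> mix_integral \<nu> l r0"
  unfolding mix_integral_def
proof (rule integral_dominated_convergence[where w = "mix_kernel \<nu> l 0"])
  show "AE s in lborel. (\<lambda>n. mix_kernel \<nu> l (r n) s) \<longlonglongrightarrow> mix_kernel \<nu> l r0 s"
  proof (rule AE_I2)
    fix s
    show "(\<lambda>n. mix_kernel \<nu> l (r n) s) \<longlonglongrightarrow> mix_kernel \<nu> l r0 s"
      unfolding mix_kernel_def divide_inverse by (intro tendsto_intros r)
  qed
  show "AE s in lborel. norm (mix_kernel \<nu> l (r n) s) \<le> mix_kernel \<nu> l 0 s" for n
    using mix_kernel_le[of \<nu> l "r n"] by (auto simp: abs_of_nonneg[OF mix_kernel_nonneg])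
qed (auto intro: integrable_mix_kernel assms)

lemma norm_powr_besselK_eq_mix_integral:
  fixes t :: "'a::euclidean_space"
  assumes l: "l > 0" and \<nu>: "\<nu> > 0"
  shows "l powr (- \<nu>) * norm_powr_besselK \<nu> l t = 2 powr (\<nu> - 1) * mix_integral \<nu> l (norm t)"
proof -
  define F where "F = (\<lambda>s::'a. norm s powr \<nu> * besselK \<nu> (l * norm s))"
  define c where "c = l powr \<nu> * 2 powr (\<nu> - 1)"
  have F: "F s = c * mix_integral \<nu> l (norm s)" if "s \<noteq> 0" for s
  proof -
    have "(norm s / (2 * l)) powr \<nu> = norm s powr \<nu> / (2 powr \<nu> * l powr \<nu>)"
      using l by (simp add: powr_divide powr_mult)
    then show ?thesis
      using mix_integral_eq_besselK[of l "norm s" \<nu>] that l \<nu>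
      by (simp add: F_def c_def powr_diff)
  qed
  have "norm_powr_besselK \<nu> l t = c * mix_integral \<nu> l (norm t)"
  proof (cases "t = 0")
    case True
    have "(F \<longlongrightarrow> c * mix_integral \<nu> l 0) (at 0)"
      unfolding tendsto_at_iff_sequentially
    proof (intro allI impI)
      fix X :: "nat \<Rightarrow> 'a"
      assume X: "\<forall>i. X i \<in> UNIV - {0}" "X \<longlonglongrightarrow> 0"
      have "(\<lambda>n. c * mix_integral \<nu> l (norm (X n))) \<longlonglongrightarrow> c * mix_integral \<nu> l 0"
        by (intro tendsto_intros mix_integral_tendsto l \<nu> tendsto_norm_zero X)
      then show "(F \<circ> X) \<longlonglongrightarrow> c * mix_integral \<nu> l 0"
        using X F by (simp add: comp_def)
    qed
    then have "Lim (at 0) F = c * mix_integral \<nu> l 0"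
      by (intro tendsto_Lim) auto
    then show ?thesis using True by (simp add: norm_powr_besselK_def F_def)
  next
    case False
    then show ?thesis using F[of t] by (simp add: norm_powr_besselK_def F_def)
  qed
  then show ?thesis using l by (simp add: c_def powr_minus)
qed

lemma mix_kernel_nat_eq:
  "mix_kernel (real d / 2 + 1) l r s = indicator {0<..} s
      * (s powr (real d / 2) * exp (- (l\<^sup>2 * s) - r\<^sup>2 / (4 * s)))"
  by (simp add: mix_kernel_def)

lemma nn_integral_exp_power:
  assumes "c > 0"
  shows "(\<integral>\<^sup>+s. ennreal (indicator {0<..} s * (s ^ d * exp (- (c * s)))) \<partial>lborel)
      = ennreal (Gamma (real d + 1) / c ^ (d + 1))"
proof -
  have "(\<integral>\<^sup>+s. ennreal (indicator {0<..} s * (s ^ d * exp (- (c * s)))) \<partial>lborel) =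
     (\<integral>\<^sup>+s. ennreal (indicator {0<..} s * (s powr (real d + 1 - 1) * exp (- (c * s)))) \<partial>lborel)"
    by (intro nn_integral_cong) (auto simp: powr_realpow split: split_indicator)
  also have "\<dots> = ennreal (Gamma (real d + 1) / c powr (real d + 1))"
    by (rule nn_integral_Gamma_scaled) (use assms in auto)
  also have "c powr (real d + 1) = c ^ (d + 1)"
    using assms powr_realpow[of c "d + 1"] by (simp add: add.commute)
  finally show ?thesis .
qed

text \<open>
  The left-hand side is the weight of the Gamma integral for \<open>1 / (|\<omega>|\<^sup>2 + l\<^sup>2)\<^bsup>d+1\<^esup>\<close> times the
  Fourier transform of the Gaussian at \<open>s\<close>.
\<close>
lemma gaussian_mixture_kernel:
  assumes "s > 0"
  shows "s ^ d * exp (- (l\<^sup>2 * s)) * ((pi / s) powr (real d / 2) * exp (- (r\<^sup>2 / (4 * s)))) =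
    pi powr (real d / 2) * mix_kernel (real d / 2 + 1) l r s"
proof -
  have "s ^ d * (pi / s) powr (real d / 2) = pi powr (real d / 2)
      * (s powr real d / s powr (real d / 2))"
    using assms by (simp add: powr_divide powr_realpow)
  also have "s powr real d / s powr (real d / 2) = s powr (real d / 2)"
    unfolding powr_diff[symmetric] by simp
  finally have e: "s ^ d * (pi / s) powr (real d / 2)
      = pi powr (real d / 2) * s powr (real d / 2)" .
  have "s ^ d * exp (- (l\<^sup>2 * s)) * ((pi / s) powr (real d / 2) * exp (- (r\<^sup>2 / (4 * s)))) =
     (s ^ d * (pi / s) powr (real d / 2)) * (exp (- (l\<^sup>2 * s)) * exp (- (r\<^sup>2 / (4 * s))))"
    by (simp only: mult_ac)
  also have "\<dots> = pi powr (real d / 2) * mix_kernel (real d / 2 + 1) l r s"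
    unfolding e mix_kernel_nat_eq using assms by (simp add: exp_add[symmetric])
  finally show ?thesis .
qed

text \<open>
  The density \<open>1 / (|\<omega>|\<^sup>2 + l\<^sup>2)\<^bsup>d+1\<^esup>\<close> is a mixture of Gaussians by the Gamma integral in \<open>s\<close>.
  Exchanging the integrals, which Tonelli justifies, replaces each Gaussian by its transform.
\<close>
lemma nn_integral_cauchy_density:
  assumes l: "l > 0"
  shows "(\<integral>\<^sup>+\<omega>. ennreal (1 / ((norm (\<omega>::'a::euclidean_space))\<^sup>2 + l\<^sup>2) ^ (DIM('a) + 1)) \<partial>lborel) =
    ennreal (pi powr (real DIM('a) / 2) / Gamma (real DIM('a) + 1) * mix_integral (real DIM('a) / 2
        + 1) l 0)" (is ?nn)
    and cauchy_density_fourier: "(CLINT \<omega>|lborel. exp (\<i> * of_real ((\<omega>::'a) \<bullet> t)) *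
      complex_of_real (1 / ((norm \<omega>)\<^sup>2 + l\<^sup>2) ^ (DIM('a) + 1))) =
    complex_of_real (pi powr (real DIM('a) / 2) / Gamma (real DIM('a) + 1)
        * mix_integral (real DIM('a) / 2 + 1) l (norm t))" (is ?ft)
proof -
  let ?d = "DIM('a)"
  define G where "G = Gamma (real ?d + 1)"
  have G: "G > 0" by (simp add: G_def)
  define k where "k \<omega> s = indicator {0<..} s * (s ^ ?d * exp (- (((norm \<omega>)\<^sup>2 + l\<^sup>2) * s)))"
      for \<omega> :: 'a and s :: real
  have k0: "0 \<le> k \<omega> s" for \<omega> s by (simp add: k_def split: split_indicator)
  have km[measurable]: "(\<lambda>(\<omega>, s). k \<omega> s) \<in> borel_measurable (borel \<Otimes>\<^sub>M borel)"
    unfolding k_def by measurable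
  have lw: "(norm \<omega>)\<^sup>2 + l\<^sup>2 > 0" for \<omega> :: 'a using l by (simp add: add_nonneg_pos)
  have ks: "(\<integral>\<^sup>+s. ennreal (k \<omega> s) \<partial>lborel) = ennreal (G / ((norm \<omega>)\<^sup>2 + l\<^sup>2) ^ (?d + 1))" for \<omega>
    unfolding k_def G_def by (rule nn_integral_exp_power[OF lw])
  have intks: "integrable lborel (k \<omega>)" "(LINT s|lborel. k \<omega> s) = G / ((norm \<omega>)\<^sup>2 + l\<^sup>2) ^ (?d + 1)"
      for \<omega>
  proof -
    show 1: "integrable lborel (k \<omega>)"
      using ks[of \<omega>] by (intro integrableI_nonneg) (auto simp: k0)
    show "(LINT s|lborel. k \<omega> s) = G / ((norm \<omega>)\<^sup>2 + l\<^sup>2) ^ (?d + 1)"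
    proof -
      have "ennreal (LINT s|lborel. k \<omega> s) = ennreal (G / ((norm \<omega>)\<^sup>2 + l\<^sup>2) ^ (?d + 1))"
        using ks[of \<omega>] nn_integral_eq_integral[OF 1] by (simp add: k0)
      moreover have "0 \<le> (LINT s|lborel. k \<omega> s)"
        by (rule Bochner_Integration.integral_nonneg) (rule k0)
      ultimately show ?thesis using G lw[of \<omega>] by (simp add: ennreal_inj[OF _ less_imp_le])
    qed
  qed
  have kexp: "k \<omega> s = (indicator {0<..} s * (s ^ ?d * exp (- (l\<^sup>2 * s))))
      * exp (- (s * (norm \<omega>)\<^sup>2))" for \<omega> s
    by (simp add: k_def exp_add[symmetric] algebra_simps split: split_indicator)
  have kw: "(\<integral>\<^sup>+\<omega>. ennreal (k \<omega> s) \<partial>lborel) = ennreal (pi powr (real ?d / 2)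
      * mix_kernel (real ?d / 2 + 1) l 0 s)" for s
  proof (cases "s > 0")
    case True
    have "(\<integral>\<^sup>+\<omega>. ennreal (k \<omega> s) \<partial>lborel) = ennreal (s ^ ?d * exp (- (l\<^sup>2 * s)))
        * (\<integral>\<^sup>+\<omega>. ennreal (exp (- (s * (norm (\<omega>::'a))\<^sup>2))) \<partial>lborel)"
      unfolding kexp using True by (subst nn_integral_cmult[symmetric]) (auto simp: ennreal_mult')
    also have "\<dots> = ennreal (s ^ ?d * exp (- (l\<^sup>2 * s)) * ((pi / s) powr (real ?d / 2)))"
      using nn_integral_gaussian_euclidean[OF True, where 'a='a] True by (simp add: ennreal_mult')
    finally show ?thesis using gaussian_mixture_kernel[OF True, of ?d l 0] by simp
  qed (simp add: k_def mix_kernel_def)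
  have tot: "(\<integral>\<^sup>+\<omega>. \<integral>\<^sup>+s. ennreal (k \<omega> s) \<partial>lborel \<partial>lborel)
      = ennreal (pi powr (real ?d / 2) * mix_integral (real ?d / 2 + 1) l 0)"
  proof -
    have "(\<integral>\<^sup>+\<omega>. \<integral>\<^sup>+s. ennreal (k \<omega> s) \<partial>lborel \<partial>lborel)
        = (\<integral>\<^sup>+s. \<integral>\<^sup>+\<omega>. ennreal (k \<omega> s) \<partial>lborel \<partial>lborel)"
      by (rule lborel_pair.Fubini') (use km in \<open>auto simp: case_prod_unfold k_def\<close>)
    also have "\<dots> = ennreal (pi powr (real ?d / 2))
        * (\<integral>\<^sup>+s. ennreal (mix_kernel (real ?d / 2 + 1) l 0 s) \<partial>lborel)"
      unfolding kw by (subst nn_integral_cmult[symmetric]) (auto simp: ennreal_mult')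
    also have "\<dots> = ennreal (pi powr (real ?d / 2) * mix_integral (real ?d / 2 + 1) l 0)"
      using l by (subst nn_integral_mix_kernel) (auto simp: ennreal_mult')
    finally show ?thesis .
  qed
  show ?nn
  proof -
    have "(\<integral>\<^sup>+\<omega>. ennreal (1 / ((norm (\<omega>::'a))\<^sup>2 + l\<^sup>2) ^ (?d + 1)) \<partial>lborel) =
       (\<integral>\<^sup>+\<omega>. ennreal (1 / G) * (\<integral>\<^sup>+s. ennreal (k \<omega> s) \<partial>lborel) \<partial>lborel)"
      unfolding ks using G by (intro nn_integral_cong) (simp add: ennreal_mult'[symmetric])
    also have "\<dots> = ennreal (1 / G) * ennreal (pi powr (real ?d / 2) * mix_integral (real ?d / 2 + 1)
        l 0)"
      unfolding tot[symmetric] by (rule nn_integral_cmult) measurable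
    finally show ?thesis using G by (simp add: ennreal_mult'[symmetric] G_def)
  qed
  let ?e = "\<lambda>\<omega>. exp (\<i> * of_real ((\<omega>::'a) \<bullet> t))"
  have ine: "integrable (lborel \<Otimes>\<^sub>M lborel) (\<lambda>(\<omega>, s). ?e \<omega> * complex_of_real (k \<omega> s))"
  proof (rule integrableI_bounded)
    show m: "(\<lambda>(\<omega>, s). ?e \<omega> * complex_of_real (k \<omega> s)) \<in> borel_measurable (lborel \<Otimes>\<^sub>M lborel)"
      unfolding k_def by measurable
    have "(\<integral>\<^sup>+x. ennreal (norm (case x of (\<omega>, s) \<Rightarrow> ?e \<omega> * complex_of_real (k \<omega> s)))
        \<partial>(lborel \<Otimes>\<^sub>M lborel))
      = (\<integral>\<^sup>+x. (case x of (\<omega>, s) \<Rightarrow> ennreal (k \<omega> s)) \<partial>(lborel \<Otimes>\<^sub>M lborel))"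
      by (intro nn_integral_cong) (auto simp: norm_mult k0)
    also have "\<dots> = (\<integral>\<^sup>+\<omega>. \<integral>\<^sup>+s. ennreal (k \<omega> s) \<partial>lborel \<partial>lborel)"
      by (subst lborel.nn_integral_fst[symmetric]) (auto simp: case_prod_unfold k_def)
    finally show "(\<integral>\<^sup>+x. ennreal (norm (case x of (\<omega>, s) \<Rightarrow> ?e \<omega> * complex_of_real (k \<omega> s)))
        \<partial>(lborel \<Otimes>\<^sub>M lborel)) < \<infinity>"
      unfolding tot by simp
  qed
  have inner: "(CLINT \<omega>|lborel. ?e \<omega> * complex_of_real (k \<omega> s)) =
      complex_of_real (pi powr (real ?d / 2) * mix_kernel (real ?d / 2 + 1) l (norm t) s)" for s
  proof (cases "s > 0")
    case True
    have "(CLINT \<omega>|lborel. ?e \<omega> * complex_of_real (k \<omega> s)) =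
       (CLINT \<omega>|lborel. complex_of_real (s ^ ?d * exp (- (l\<^sup>2 * s)))
           * (?e \<omega> * complex_of_real (exp (- (s * (norm \<omega>)\<^sup>2)))))"
      unfolding kexp using True by (intro Bochner_Integration.integral_cong refl) simp
    also have "\<dots> = complex_of_real (s ^ ?d * exp (- (l\<^sup>2 * s)))
        * (CLINT \<omega>|lborel. ?e \<omega> * complex_of_real (exp (- (s * (norm \<omega>)\<^sup>2))))"
      by (rule integral_mult_right_zero)
    also have "\<dots> = complex_of_real (s ^ ?d * exp (- (l\<^sup>2 * s))
        * ((pi / s) powr (real ?d / 2) * exp (- ((norm t)\<^sup>2 / (4 * s)))))"
      by (simp only: gaussian_fourier_euclidean[OF True] of_real_mult)
    finally show ?thesis by (simp only: gaussian_mixture_kernel[OF True])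
  qed (simp add: k_def mix_kernel_def)
  have "(CLINT \<omega>|lborel. ?e \<omega> * complex_of_real (1 / ((norm \<omega>)\<^sup>2 + l\<^sup>2) ^ (?d + 1))) =
     (CLINT \<omega>|lborel. complex_of_real (1 / G) * (CLINT s|lborel. ?e \<omega> * complex_of_real (k \<omega> s)))"
  proof (intro Bochner_Integration.integral_cong refl)
    fix \<omega> :: 'a
    show "?e \<omega> * complex_of_real (1 / ((norm \<omega>)\<^sup>2 + l\<^sup>2) ^ (?d + 1))
        = complex_of_real (1 / G) * (CLINT s|lborel. ?e \<omega> * complex_of_real (k \<omega> s))"
      using G by (simp only: integral_mult_right_zero integral_complex_of_real intks) simp
  qed
  also have "\<dots> = complex_of_real (1 / G) * (CLINT \<omega>|lborel. CLINT s|lborel.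
      ?e \<omega> * complex_of_real (k \<omega> s))"
    by (rule integral_mult_right_zero)
  also have "(CLINT \<omega>|lborel. CLINT s|lborel. ?e \<omega> * complex_of_real (k \<omega> s))
      = (CLINT s|lborel. CLINT \<omega>|lborel. ?e \<omega> * complex_of_real (k \<omega> s))"
    by (rule lborel_pair.Fubini_integral[symmetric]) (use ine in simp)
  also have "\<dots> = complex_of_real (pi powr (real ?d / 2) * mix_integral (real ?d / 2 + 1) l
      (norm t))"
    by (simp only: inner integral_complex_of_real mix_integral_def integral_mult_right_zero)
  finally show ?ft by (simp add: G_def)
qed

section \<open>Levy exponents\<close>

lemma cmod_exp_minus_linear_le:
  "cmod (exp (\<i> * of_real x) - 1 - \<i> * of_real x) \<le> x\<^sup>2 / 2"
  "cmod (exp (\<i> * of_real x) - 1 - \<i> * of_real x) \<le> 2 * \<bar>x\<bar>"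
proof -
  show "cmod (exp (\<i> * of_real x) - 1 - \<i> * of_real x) \<le> x\<^sup>2 / 2"
    using iexp_approx1[of x 1] by (simp add: diff_diff_eq power2_eq_square abs_mult)
  show "cmod (exp (\<i> * of_real x) - 1 - \<i> * of_real x) \<le> 2 * \<bar>x\<bar>"
    using iexp_approx2[of x 1] by (simp add: diff_diff_eq)
qed

lemma cmod_exp_minus_one_le: "cmod (exp (\<i> * of_real x) - 1) \<le> \<bar>x\<bar>"
  using iexp_approx1[of x 0] by simp

text \<open>
  A bound with the integrable factor \<open>min 1 (x\<^sup>2)\<close> that is locally uniform in \<open>s\<close>, as dominated
  convergence in \<open>s\<close> needs it.
\<close>
lemma levy_integrand_bound:
  "cmod (exp (\<i> * of_real (s * x)) - 1 - \<i> * of_real (s * trunc x)) \<le> (2 + \<bar>s\<bar> + s\<^sup>2) * min 1 (x\<^sup>2)"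
proof (cases "\<bar>x\<bar> \<le> 1")
  case True
  have "cmod (exp (\<i> * of_real (s * x)) - 1 - \<i> * of_real (s * trunc x)) \<le> (s * x)\<^sup>2 / 2"
    using True cmod_exp_minus_linear_le(1)[of "s * x"] by (simp add: trunc_def)
  also have "\<dots> \<le> (2 + \<bar>s\<bar> + s\<^sup>2) * x\<^sup>2"
  proof -
    have "s\<^sup>2 / 2 \<le> 2 + \<bar>s\<bar> + s\<^sup>2"
      using zero_le_power2[of s] abs_ge_zero[of s] by linarith
    then show ?thesis
      using mult_right_mono[of "s\<^sup>2 / 2" "2 + \<bar>s\<bar> + s\<^sup>2" "x\<^sup>2"] by (simp add: power_mult_distrib)
  qed
  also have "x\<^sup>2 = min 1 (x\<^sup>2)" using True by (simp add: abs_square_le_1)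
  finally show ?thesis .
next
  case False
  then have m: "min 1 (x\<^sup>2) = 1" using abs_square_le_1[of x] by (auto simp: min_def)
  have "cmod (exp (\<i> * of_real (s * x)) - 1 - \<i> * of_real (s * trunc x)) \<le>
      cmod (exp (\<i> * of_real (s * x)) - 1) + cmod (\<i> * of_real (s * trunc x))"
    by (rule norm_triangle_ineq4)
  also have "cmod (exp (\<i> * of_real (s * x)) - 1) \<le> cmod (exp (\<i> * of_real (s * x))) + cmod 1"
    by (rule norm_triangle_ineq4)
  also have "cmod (exp (\<i> * of_real (s * x))) = 1" by (rule norm_exp_i_times)
  also have "cmod (\<i> * of_real (s * trunc x)) = \<bar>s\<bar>"
    using False by (auto simp: norm_mult trunc_def abs_mult sgn_if)
  also have "1 + cmod 1 + \<bar>s\<bar> \<le> (2 + \<bar>s\<bar> + s\<^sup>2) * min 1 (x\<^sup>2)"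
    unfolding m by simp
  finally show ?thesis by simp
qed

lemma trunc_measurable [measurable]: "trunc \<in> borel_measurable borel"
  unfolding trunc_def by measurable

locale levy_triplet =
  fixes b :: real and W :: "real measure"
  assumes b_nonneg: "0 \<le> b" and levy: "levy_measure W"
begin

lemma sets_W [measurable_cong, simp]: "sets W = sets borel"
  using levy by (simp add: levy_measure_def)

lemma space_W [simp]: "space W = UNIV"
  using sets_eq_imp_space_eq[OF sets_W] by simp

lemma AE_W_nonzero: "AE x in W. x \<noteq> 0"
  using levy by (intro AE_I[of _ _ "{0}"]) (auto simp: levy_measure_def)

lemma integrable_min_square: "integrable W (\<lambda>x. min 1 (x\<^sup>2))"
  using levy by (intro integrableI_nonneg) (auto simp: levy_measure_def)

lemma integrable_levy_integrand:
  "integrable W (\<lambda>x. exp (\<i> * of_real (s * x)) - 1 - \<i> * of_real (s * trunc x))"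
proof (rule Bochner_Integration.integrable_bound)
  show "integrable W (\<lambda>x. (2 + \<bar>s\<bar> + s\<^sup>2) * min 1 (x\<^sup>2))"
    by (intro integrable_mult_right integrable_min_square)
  show "AE x in W. cmod (exp (\<i> * of_real (s * x)) - 1 - \<i> * of_real (s * trunc x))
      \<le> norm ((2 + \<bar>s\<bar> + s\<^sup>2) * min 1 (x\<^sup>2))"
    by (intro AE_I2 order_trans[OF levy_integrand_bound]) simp
qed measurable

definition psi :: "real \<Rightarrow> real" where "psi s = - Re (levy_exponent b W s)"

lemma integrable_one_minus_cos: "integrable W (\<lambda>x. 1 - cos (s * x))"
proof -
  have "integrable W (\<lambda>x. - Re (exp (\<i> * of_real (s * x)) - 1 - \<i> * of_real (s * trunc x)))"
    by (intro integrable_minus integrable_Re integrable_levy_integrand)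
  then show ?thesis by (simp add: Re_exp)
qed

lemma psi_eq: "psi s = b / 2 * s\<^sup>2 + (LINT x|W. 1 - cos (s * x))"
proof -
  have "Re (levy_exponent b W s) = - (b / 2 * s\<^sup>2)
      + (LINT x|W. Re (exp (\<i> * of_real (s * x)) - 1 - \<i> * of_real (s * trunc x)))"
    by (simp only: levy_exponent_def integral_Re[OF integrable_levy_integrand] plus_complex.sel
        uminus_complex.sel Re_complex_of_real)
  also have "(LINT x|W. Re (exp (\<i> * of_real (s * x)) - 1 - \<i> * of_real (s * trunc x)))
      = (LINT x|W. - (1 - cos (s * x)))"
    by (intro Bochner_Integration.integral_cong) (auto simp: Re_exp)
  also have "\<dots> = - (LINT x|W. 1 - cos (s * x))" by (rule integral_minus)
  finally show ?thesis by (simp add: psi_def)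
qed

lemma psi_nonneg: "0 \<le> psi s"
  unfolding psi_eq using b_nonneg by (intro add_nonneg_nonneg Bochner_Integration.integral_nonneg)
      auto

lemma psi_0 [simp]: "psi 0 = 0" by (simp add: psi_eq)

lemma ennreal_psi: "ennreal (psi s) = ennreal (b / 2 * s\<^sup>2) + (\<integral>\<^sup>+x. ennreal (1 - cos (s * x)) \<partial>W)"
proof -
  have "(\<integral>\<^sup>+x. ennreal (1 - cos (s * x)) \<partial>W) = ennreal (LINT x|W. 1 - cos (s * x))"
    by (intro nn_integral_eq_integral integrable_one_minus_cos) auto
  then show ?thesis
    unfolding psi_eq using b_nonneg
    by (subst ennreal_plus) (auto intro!: Bochner_Integration.integral_nonneg)
qed

lemma psi_tendsto:
  assumes "s \<longlonglongrightarrow> s0" shows "(\<lambda>n. psi (s n)) \<longlonglongrightarrow> psi s0"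
proof -
  obtain B where B: "\<And>n. \<bar>s n\<bar> \<le> B" "B \<ge> 0"
    using convergent_imp_Bseq[OF convergentI[OF assms]] by (auto simp: Bseq_def intro: less_imp_le)
  have "(\<lambda>n. LINT x|W. 1 - cos (s n * x)) \<longlonglongrightarrow> (LINT x|W. 1 - cos (s0 * x))"
  proof (rule integral_dominated_convergence[where w = "\<lambda>x. (2 + B + B\<^sup>2) * min 1 (x\<^sup>2)"])
    show "integrable W (\<lambda>x. (2 + B + B\<^sup>2) * min 1 (x\<^sup>2))"
      by (intro integrable_mult_right integrable_min_square)
    show "AE x in W. (\<lambda>n. 1 - cos (s n * x)) \<longlonglongrightarrow> 1 - cos (s0 * x)"
      by (intro AE_I2 tendsto_intros assms)
    fix n
    show "AE x in W. norm (1 - cos (s n * x)) \<le> (2 + B + B\<^sup>2) * min 1 (x\<^sup>2)"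
    proof (rule AE_I2)
      fix x
      have "norm (1 - cos (s n * x)) = \<bar>Re (exp (\<i> * of_real (s n * x)) - 1 - \<i>
          * of_real (s n * trunc x))\<bar>"
        by (simp add: Re_exp)
      also have "\<dots> \<le> (2 + \<bar>s n\<bar> + (s n)\<^sup>2) * min 1 (x\<^sup>2)"
        by (rule order_trans[OF abs_Re_le_cmod levy_integrand_bound])
      also have "\<dots> \<le> (2 + B + B\<^sup>2) * min 1 (x\<^sup>2)"
        using B(1)[of n] B(2) by (intro mult_right_mono add_mono) (auto simp:
            abs_le_square_iff[symmetric])
      finally show "norm (1 - cos (s n * x)) \<le> (2 + B + B\<^sup>2) * min 1 (x\<^sup>2)" .
    qed
  qed auto
  then show ?thesis unfolding psi_eq by (intro tendsto_intros assms)
qed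

lemma psi_measurable [measurable]: "psi \<in> borel_measurable borel"
proof (rule borel_measurable_continuous_onI)
  show "continuous_on UNIV psi"
    by (auto simp: continuous_on_sequentially comp_def intro: psi_tendsto)
qed

text \<open>
  The number \<open>- K''(0)\<close> if it is finite; kept in the extended half-line because its finiteness
  is a conclusion and not an assumption.
\<close>
definition variance_rate :: ennreal where
  "variance_rate = ennreal b + (\<integral>\<^sup>+x. ennreal (x\<^sup>2) \<partial>W)"

end

lemma one_minus_cos_le: "1 - cos x \<le> x\<^sup>2 / (2::real)"
proof -
  have "1 - cos x = - Re (exp (\<i> * of_real x) - 1 - \<i> * of_real x)"
    by (simp add: Re_exp)
  then show ?thesis
    using abs_Re_le_cmod[of "exp (\<i> * of_real x) - 1 - \<i> * of_real x"]
      cmod_exp_minus_linear_le(1)[of x] by linarith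
qed

text \<open>
  Second derivatives at 0 are taken along the sequence \<open>1 / (k + 1)\<close>, so that Fatou's lemma and
  dominated convergence for sequences apply.
\<close>
lemma cos_difference_quotient_tendsto:
  "(\<lambda>k. (real (Suc k))\<^sup>2 * (1 - cos (x / real (Suc k)))) \<longlonglongrightarrow> x\<^sup>2 / 2"
proof (cases "x = 0")
  case False
  have "((\<lambda>h::real. (1 - cos h) / h\<^sup>2) \<longlongrightarrow> 1 / 2) (at 0)" by real_asymp
  moreover have "filterlim (\<lambda>k. x / real (Suc k)) (at 0) sequentially"
    using False by (intro filterlim_atI LIMSEQ_Suc[OF lim_const_over_n]) auto
  ultimately have "(\<lambda>k. (1 - cos (x / real (Suc k))) / (x / real (Suc k))\<^sup>2) \<longlonglongrightarrow> 1 / 2"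
    by (rule filterlim_compose)
  then have "(\<lambda>k. x\<^sup>2 * ((1 - cos (x / real (Suc k))) / (x / real (Suc k))\<^sup>2)) \<longlonglongrightarrow> x\<^sup>2 * (1 / 2)"
    by (rule tendsto_mult[OF tendsto_const])
  moreover have "x\<^sup>2 * ((1 - cos (x / real (Suc k))) / (x / real (Suc k))\<^sup>2)
      = (real (Suc k))\<^sup>2 * (1 - cos (x / real (Suc k)))" for k
    using False by (simp add: power_divide del: of_nat_Suc)
  ultimately show ?thesis by (simp del: of_nat_Suc)
qed simp

lemma cos_difference_quotient_le:
  "(real (Suc k))\<^sup>2 * (1 - cos (x / real (Suc k))) \<le> x\<^sup>2 / 2"
proof -
  have "(real (Suc k))\<^sup>2 * (1 - cos (x / real (Suc k)))
      \<le> (real (Suc k))\<^sup>2 * ((x / real (Suc k))\<^sup>2 / 2)"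
    by (intro mult_left_mono one_minus_cos_le) auto
  then show ?thesis by (simp add: power_divide)
qed

lemma sin_difference_quotient_tendsto:
  "(\<lambda>k. real (Suc k) * sin (x / real (Suc k))) \<longlonglongrightarrow> (x::real)"
proof (cases "x = 0")
  case False
  have "((\<lambda>h::real. sin h / h) \<longlongrightarrow> 1) (at 0)" by real_asymp
  moreover have "filterlim (\<lambda>k. x / real (Suc k)) (at 0) sequentially"
    using False by (intro filterlim_atI LIMSEQ_Suc[OF lim_const_over_n]) auto
  ultimately have "(\<lambda>k. sin (x / real (Suc k)) / (x / real (Suc k))) \<longlonglongrightarrow> 1"
    by (rule filterlim_compose)
  then have "(\<lambda>k. x * (sin (x / real (Suc k)) / (x / real (Suc k)))) \<longlonglongrightarrow> x * 1"
    by (rule tendsto_mult[OF tendsto_const])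
  moreover have "x * (sin (x / real (Suc k)) / (x / real (Suc k)))
      = real (Suc k) * sin (x / real (Suc k))" for k
    using False by (simp del: of_nat_Suc)
  ultimately show ?thesis by simp
qed simp

context levy_triplet begin

text \<open>
  The variance rate is the second-order coefficient of \<open>\<psi>\<close> at 0. When it is infinite only this
  inequality is left, and it is what later excludes that case.
\<close>
lemma psi_fatou:
  "ennreal (y\<^sup>2 / 2) * variance_rate \<le> liminf (\<lambda>k. ennreal ((real (Suc k))\<^sup>2)
      * ennreal (psi (y / real (Suc k))))"
proof -
  let ?c = "\<lambda>k x. ennreal ((real (Suc k))\<^sup>2 * (1 - cos (y / real (Suc k) * x)))"
  have lim: "(\<lambda>k. ?c k x) \<longlonglongrightarrow> ennreal ((y * x)\<^sup>2 / 2)" for x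
    using cos_difference_quotient_tendsto[of "y * x"] by (intro tendsto_ennrealI) simp
  have "ennreal (y\<^sup>2 / 2) * variance_rate = ennreal (y\<^sup>2 / 2 * b)
      + (\<integral>\<^sup>+x. ennreal ((y * x)\<^sup>2 / 2) \<partial>W)"
    unfolding variance_rate_def using b_nonneg
    by (subst distrib_left, subst nn_integral_cmult[symmetric]) (auto simp:
        ennreal_mult'[symmetric] power_mult_distrib)
  also have "(\<integral>\<^sup>+x. ennreal ((y * x)\<^sup>2 / 2) \<partial>W) = (\<integral>\<^sup>+x. liminf (\<lambda>k. ?c k x) \<partial>W)"
    by (intro nn_integral_cong lim_imp_Liminf[OF _ lim, symmetric]) auto
  also have "\<dots> \<le> liminf (\<lambda>k. \<integral>\<^sup>+x. ?c k x \<partial>W)"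
    by (rule nn_integral_liminf) measurable
  finally have "ennreal (y\<^sup>2 / 2) * variance_rate
      \<le> ennreal (y\<^sup>2 / 2 * b) + liminf (\<lambda>k. \<integral>\<^sup>+x. ?c k x \<partial>W)"
    by (simp add: add_left_mono)
  also have "\<dots> = liminf (\<lambda>k. ennreal (y\<^sup>2 / 2 * b) + (\<integral>\<^sup>+x. ?c k x \<partial>W))"
    by (rule Liminf_const_add[symmetric]) simp
  also have "(\<lambda>k. ennreal (y\<^sup>2 / 2 * b) + (\<integral>\<^sup>+x. ?c k x \<partial>W))
      = (\<lambda>k. ennreal ((real (Suc k))\<^sup>2) * ennreal (psi (y / real (Suc k))))"
  proof
    fix k
    have "(\<integral>\<^sup>+x. ?c k x \<partial>W) = ennreal ((real (Suc k))\<^sup>2)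
        * (\<integral>\<^sup>+x. ennreal (1 - cos (y / real (Suc k) * x)) \<partial>W)"
      by (subst nn_integral_cmult[symmetric]) (auto simp: ennreal_mult')
    moreover have "ennreal (y\<^sup>2 / 2 * b) = ennreal ((real (Suc k))\<^sup>2)
        * ennreal (b / 2 * (y / real (Suc k))\<^sup>2)"
      by (subst ennreal_mult'[symmetric]) (auto simp: power_divide mult.commute simp del:
          of_nat_Suc)
    ultimately show "ennreal (y\<^sup>2 / 2 * b) + (\<integral>\<^sup>+x. ?c k x \<partial>W)
        = ennreal ((real (Suc k))\<^sup>2) * ennreal (psi (y / real (Suc k)))"
      by (simp add: ennreal_psi distrib_left)
  qed
  finally show ?thesis .
qed

end

locale levy_triplet_variance = levy_triplet +
  assumes finite_variance: "variance_rate < \<infinity>"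
begin

lemma integrable_square_W: "integrable W (\<lambda>x. x\<^sup>2)"
  using finite_variance by (intro integrableI_nonneg) (auto simp: variance_rate_def)

definition variance_coeff :: real where "variance_coeff = b + (LINT x|W. x\<^sup>2)"

lemma variance_rate_eq: "variance_rate = ennreal variance_coeff"
  unfolding variance_rate_def variance_coeff_def using b_nonneg
  by (subst nn_integral_eq_integral[OF integrable_square_W]) (auto simp: ennreal_plus)

lemma variance_coeff_nonneg: "0 \<le> variance_coeff"
  using b_nonneg by (simp add: variance_coeff_def)

lemma psi_le: "psi s \<le> variance_coeff / 2 * s\<^sup>2"
proof -
  have "(LINT x|W. 1 - cos (s * x)) \<le> (LINT x|W. s\<^sup>2 / 2 * x\<^sup>2)"
  proof (intro integral_mono integrable_one_minus_cos integrable_mult_right integrable_square_W)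
    fix x show "1 - cos (s * x) \<le> s\<^sup>2 / 2 * x\<^sup>2" using one_minus_cos_le[of "s * x"]
        by (simp add: power_mult_distrib)
  qed
  then show ?thesis unfolding psi_eq variance_coeff_def by (simp add: algebra_simps)
qed

lemma psi_scaled_tendsto: "(\<lambda>k. (real (Suc k))\<^sup>2 * psi (1 / real (Suc k))) \<longlonglongrightarrow> variance_coeff / 2"
proof -
  have "(\<lambda>k. LINT x|W. (real (Suc k))\<^sup>2 * (1 - cos (1 / real (Suc k) * x))) \<longlonglongrightarrow> (LINT x|W. x\<^sup>2 / 2)"
  proof (rule integral_dominated_convergence[where w = "\<lambda>x. x\<^sup>2 / 2"])
    show "AE x in W. (\<lambda>k. (real (Suc k))\<^sup>2 * (1 - cos (1 / real (Suc k) * x))) \<longlonglongrightarrow> x\<^sup>2 / 2"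
      using cos_difference_quotient_tendsto by simp
    show "AE x in W. norm ((real (Suc k))\<^sup>2 * (1 - cos (1 / real (Suc k) * x))) \<le> x\<^sup>2 / 2" for k
      using cos_difference_quotient_le[of k] by simp
    show "integrable W (\<lambda>x. x\<^sup>2 / 2)" using integrable_square_W by simp
  qed measurable
  moreover have "(real (Suc k))\<^sup>2 * psi (1 / real (Suc k))
      = b / 2 + (LINT x|W. (real (Suc k))\<^sup>2 * (1 - cos (1 / real (Suc k) * x)))" for k
    unfolding psi_eq by (simp add: distrib_left power_divide del: of_nat_Suc)
  moreover have "(\<lambda>k. b / 2 + (LINT x|W. (real (Suc k))\<^sup>2 * (1 - cos (1 / real (Suc k) * x))))
      \<longlonglongrightarrow> b / 2 + (LINT x|W. x\<^sup>2 / 2)"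
    by (intro tendsto_add[OF tendsto_const]) fact
  ultimately show ?thesis by (simp add: variance_coeff_def add_divide_distrib del: of_nat_Suc)
qed

text \<open>
  The imaginary part is \<open>\<integral> (sin (s x) - s \<tau>(x)) W(dx)\<close>, where the truncation makes the integrand
  \<open>O(s x\<^sup>2)\<close> for small and for large jumps. Together with the bound on \<open>\<psi>\<close> it controls the real
  part of the characteristic function to second order.
\<close>
lemma Im_levy_exponent_le:
  assumes "\<bar>s\<bar> \<le> 1" shows "\<bar>Im (levy_exponent b W s)\<bar> \<le> 2 * variance_coeff * \<bar>s\<bar>"
proof -
  have "Im (levy_exponent b W s) = (LINT x|W.
      Im (exp (\<i> * of_real (s * x)) - 1 - \<i> * of_real (s * trunc x)))"
    by (simp only: levy_exponent_def integral_Im[OF integrable_levy_integrand] plus_complex.sel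
        uminus_complex.sel Im_complex_of_real)
  also have "\<bar>\<dots>\<bar> \<le> (LINT x|W. \<bar>Im (exp (\<i> * of_real (s * x)) - 1 - \<i> * of_real (s * trunc x))\<bar>)"
    by (rule integral_abs_bound)
  also have "\<dots> \<le> (LINT x|W. 2 * \<bar>s\<bar> * x\<^sup>2)"
  proof (intro integral_mono integrable_abs integrable_Im integrable_levy_integrand
      integrable_mult_right integrable_square_W)
    fix x
    have eq: "Im (exp (\<i> * of_real (s * x)) - 1 - \<i> * of_real (s * trunc x))
        = sin (s * x) - s * trunc x"
      by (simp add: Im_exp)
    show "\<bar>Im (exp (\<i> * of_real (s * x)) - 1 - \<i> * of_real (s * trunc x))\<bar> \<le> 2 * \<bar>s\<bar> * x\<^sup>2"
    proof (cases "\<bar>x\<bar> \<le> 1")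
      case True
      have "cmod (exp (\<i> * of_real (s * x)) - 1 - \<i> * of_real (s * trunc x)) \<le> (s * x)\<^sup>2 / 2"
        using True cmod_exp_minus_linear_le(1)[of "s * x"] by (simp add: trunc_def)
      also have "\<dots> \<le> 2 * \<bar>s\<bar> * x\<^sup>2"
      proof -
        have "s\<^sup>2 \<le> \<bar>s\<bar>" using assms power_decreasing[of 1 2 "\<bar>s\<bar>"] by simp
        then have "s\<^sup>2 * x\<^sup>2 \<le> \<bar>s\<bar> * x\<^sup>2" by (intro mult_right_mono) auto
        moreover have "0 \<le> \<bar>s\<bar> * x\<^sup>2" by simp
        ultimately show ?thesis unfolding power_mult_distrib by linarith
      qed
      finally show ?thesis using abs_Im_le_cmod order_trans by blast
    next
      case False
      then have x: "\<bar>x\<bar> \<le> x\<^sup>2" "1 \<le> x\<^sup>2" using power_increasing[of 1 2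
          "\<bar>x\<bar>"] power_increasing[of 0 2 "\<bar>x\<bar>"] by auto
      have "\<bar>sin (s * x) - s * trunc x\<bar> \<le> \<bar>sin (s * x)\<bar> + \<bar>s * trunc x\<bar>"
          by (rule abs_triangle_ineq4)
      also have "\<bar>sin (s * x)\<bar> \<le> \<bar>s * x\<bar>" by (rule abs_sin_x_le_abs_x)
      also have "\<bar>s * trunc x\<bar> = \<bar>s\<bar>" using False by (auto simp: trunc_def abs_mult sgn_if)
      also have "\<bar>s * x\<bar> + \<bar>s\<bar> \<le> 2 * \<bar>s\<bar> * x\<^sup>2"
        using mult_left_mono[OF x(1), of "\<bar>s\<bar>"] mult_left_mono[OF x(2), of "\<bar>s\<bar>"]
            by (simp add: abs_mult)
      finally show ?thesis unfolding eq by simp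
    qed
  qed
  also have "\<dots> \<le> 2 * variance_coeff * \<bar>s\<bar>"
    unfolding variance_coeff_def using b_nonneg by (simp add: algebra_simps)
  finally show ?thesis .
qed

lemma levy_exponent_trivial:
  assumes "variance_coeff = 0" shows "levy_exponent b W s = 0"
proof -
  have "0 \<le> (LINT x|W. x\<^sup>2)" by simp
  with assms b_nonneg have b: "b = 0" and i: "(LINT x|W. x\<^sup>2) = 0" unfolding variance_coeff_def
      by linarith+
  have "AE x in W. x\<^sup>2 = 0"
    using integral_nonneg_eq_0_iff_AE[OF integrable_square_W] i by simp
  with AE_W_nonzero have "AE x in W. False" by eventually_elim simp
  then have "(CLINT x|W. exp (\<i> * of_real (s * x)) - 1 - \<i> * of_real (s * trunc x))
      = (CLINT x|W. 0)"
    by (intro integral_cong_AE) auto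
  then show ?thesis by (simp add: levy_exponent_def b)
qed

end

text \<open>
  For first derivatives under an integral a quadratic remainder bound is easier to obtain than
  pointwise limits with a majorant.
\<close>
lemma has_vector_derivative_at_quadratic_bound:
  fixes f :: "real \<Rightarrow> complex"
  assumes "\<And>u. cmod (f (s + u) - f s - of_real u * D) \<le> C * u\<^sup>2"
  shows "(f has_vector_derivative D) (at s)"
  unfolding has_vector_derivative_def has_derivative_at
proof
  show "bounded_linear (\<lambda>x. x *\<^sub>R D)" by (rule bounded_linear_scaleR_left)
  have "((\<lambda>h::real. C * \<bar>h\<bar>) \<longlongrightarrow> C * \<bar>0\<bar>) (at 0)" by (intro tendsto_intros)
  then have lim: "((\<lambda>h::real. C * \<bar>h\<bar>) \<longlongrightarrow> 0) (at 0)" by simp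
  show "((\<lambda>h. norm (f (s + h) - f s - h *\<^sub>R D) / norm h) \<longlongrightarrow> 0) (at 0)"
  proof (rule Lim_null_comparison[OF _ lim], rule eventually_at_filter[THEN iffD2],
      rule always_eventually, intro allI impI)
    fix h :: real assume h: "h \<noteq> 0"
    have "norm (f (s + h) - f s - h *\<^sub>R D) / norm h \<le> C * h\<^sup>2 / \<bar>h\<bar>"
      using assms[of h] by (auto intro!: divide_right_mono simp: scaleR_conv_of_real)
    also have "\<dots> = C * \<bar>h\<bar>" using h by (simp add: power2_eq_square field_simps abs_mult_self_eq)
    finally show "norm (norm (f (s + h) - f s - h *\<^sub>R D) / norm h) \<le> C * \<bar>h\<bar>" by simp
  qed
qed

context levy_triplet_variance begin

text \<open>
  When \<open>W\<close> has a second moment, \<open>x - \<tau>(x)\<close> is integrable and can be split off as a linear term.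
  The rest \<open>exp(i s x) - 1 - i s x\<close> is differentiated under the integral, once with a quadratic
  error bound and once more by dominated convergence.
\<close>
lemma levy_exponent_second_derivative:
  "has_second_derivative_at (levy_exponent b W) (of_real (- variance_coeff)) 0"
proof -
  define R where "R s x = exp (\<i> * of_real (s * x)) - 1 - \<i> * of_real (s * x)" for s x :: real
  define R' where "R' s x = \<i> * of_real x * (exp (\<i> * of_real (s * x)) - 1)" for s x :: real
  define c where "c = (LINT x|W. x - trunc x)"
  define V where "V = (LINT x|W. x\<^sup>2)"
  have V0: "V \<ge> 0" by (simp add: V_def)
  have iR: "integrable W (R s)" for s
  proof (rule Bochner_Integration.integrable_bound)
    show "integrable W (\<lambda>x. s\<^sup>2 / 2 * x\<^sup>2)" by (intro integrable_mult_right integrable_square_W)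
    show "AE x in W. norm (R s x) \<le> norm (s\<^sup>2 / 2 * x\<^sup>2)"
      using cmod_exp_minus_linear_le(1)[of "s * x" for x]
          by (intro AE_I2) (simp add: R_def power_mult_distrib)
  qed (simp add: R_def[abs_def])
  have iR': "integrable W (R' s)" for s
  proof (rule Bochner_Integration.integrable_bound)
    show "integrable W (\<lambda>x. \<bar>s\<bar> * x\<^sup>2)" by (intro integrable_mult_right integrable_square_W)
    show "AE x in W. norm (R' s x) \<le> norm (\<bar>s\<bar> * x\<^sup>2)"
    proof (rule AE_I2)
      fix x
      have "norm (R' s x) \<le> \<bar>x\<bar> * \<bar>s * x\<bar>"
        unfolding R'_def norm_mult using cmod_exp_minus_one_le[of "s * x"]
        by (auto intro!: mult_left_mono simp del: of_real_mult)
      also have "\<dots> = norm (\<bar>s\<bar> * x\<^sup>2)" by (simp add: abs_mult power2_eq_square)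
      finally show "norm (R' s x) \<le> norm (\<bar>s\<bar> * x\<^sup>2)" .
    qed
  qed (simp add: R'_def[abs_def])
  have ic: "integrable W (\<lambda>x. x - trunc x)"
  proof (rule Bochner_Integration.integrable_bound)
    show "integrable W (\<lambda>x. x\<^sup>2)" by (rule integrable_square_W)
    show "AE x in W. norm (x - trunc x) \<le> norm (x\<^sup>2)"
    proof (rule AE_I2)
      fix x :: real
      show "norm (x - trunc x) \<le> norm (x\<^sup>2)"
      proof (cases "\<bar>x\<bar> \<le> 1")
        case False
        then have "\<bar>x - trunc x\<bar> \<le> \<bar>x\<bar>" by (auto simp: trunc_def sgn_if)
        also have "\<dots> \<le> x\<^sup>2" using False power_increasing[of 1 2 "\<bar>x\<bar>"] by simp
        finally show ?thesis by simp
      qed (simp add: trunc_def)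
    qed
  qed simp
  have K: "levy_exponent b W s = - of_real (b / 2 * s\<^sup>2) + ((CLINT x|W. R s x) + \<i> * of_real s
      * of_real c)" for s
  proof -
    have "(CLINT x|W. exp (\<i> * of_real (s * x)) - 1 - \<i> * of_real (s * trunc x)) =
        (CLINT x|W. R s x + \<i> * of_real s * of_real (x - trunc x))"
      by (intro Bochner_Integration.integral_cong) (auto simp: R_def algebra_simps)
    also have "\<dots> = (CLINT x|W. R s x) + (CLINT x|W. \<i> * of_real s * of_real (x - trunc x))"
      by (intro Bochner_Integration.integral_add iR integrable_mult_right integrable_of_real ic)
    also have "(CLINT x|W. \<i> * of_real s * of_real (x - trunc x)) = \<i> * of_real s * of_real c"
      by (simp only: integral_mult_right_zero integral_complex_of_real c_def)
    finally show ?thesis by (simp add: levy_exponent_def)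
  qed
  define K' where "K' s = - of_real (b * s) + ((CLINT x|W. R' s x) + \<i> * of_real c)" for s
  have d1: "(levy_exponent b W has_vector_derivative K' s) (at s)" for s
  proof (rule has_vector_derivative_at_quadratic_bound)
    fix u :: real
    let ?I = "CLINT x|W. R (s + u) x - R s x - of_real u * R' s x"
    have I: "?I = (CLINT x|W. R (s + u) x) - (CLINT x|W. R s x) - of_real u * (CLINT x|W. R' s x)"
      by (simp add: iR iR')
    have "levy_exponent b W (s + u) - levy_exponent b W s - of_real u * K' s
        = - of_real (b / 2 * u\<^sup>2) + ?I"
      unfolding K K'_def I by (simp add: algebra_simps power2_eq_square)
    also have "cmod \<dots> \<le> cmod (- of_real (b / 2 * u\<^sup>2)) + cmod ?I" by (rule norm_triangle_ineq)
    also have "cmod (- of_real (b / 2 * u\<^sup>2)) = b / 2 * u\<^sup>2" using b_nonneg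
        by (simp only: norm_minus_cancel norm_of_real) simp
    also have "cmod ?I \<le> (LINT x|W. u\<^sup>2 / 2 * x\<^sup>2)"
    proof (rule Bochner_Integration.integral_norm_bound_integral)
      show "integrable W (\<lambda>x. R (s + u) x - R s x - of_real u * R' s x)"
        by (intro Bochner_Integration.integrable_diff iR iR' integrable_mult_right)
      show "integrable W (\<lambda>x. u\<^sup>2 / 2 * x\<^sup>2)" by (intro integrable_mult_right integrable_square_W)
      fix x
      have "R (s + u) x - R s x - of_real u * R' s x
          = exp (\<i> * of_real (s * x)) * (exp (\<i> * of_real (u * x)) - 1 - \<i> * of_real (u * x))"
        by (simp add: R_def R'_def algebra_simps exp_add)
      then show "norm (R (s + u) x - R s x - of_real u * R' s x) \<le> u\<^sup>2 / 2 * x\<^sup>2"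
        using cmod_exp_minus_linear_le(1)[of "u * x"]
        by (simp only: norm_mult norm_exp_i_times) (simp add: power_mult_distrib)
    qed
    also have "b / 2 * u\<^sup>2 + (LINT x|W. u\<^sup>2 / 2 * x\<^sup>2) = variance_coeff / 2 * u\<^sup>2"
      unfolding variance_coeff_def by (simp add: algebra_simps add_divide_distrib)
    finally show "cmod (levy_exponent b W (s + u) - levy_exponent b W s - of_real u * K' s)
        \<le> variance_coeff / 2 * u\<^sup>2" by simp
  qed
  have d2: "(K' has_vector_derivative of_real (- variance_coeff)) (at 0)"
    unfolding has_vector_derivative_def has_derivative_at
  proof
    show "bounded_linear (\<lambda>x. x *\<^sub>R complex_of_real (- variance_coeff))"
        by (rule bounded_linear_scaleR_left)
    show "((\<lambda>h. norm (K' (0 + h) - K' 0 - h *\<^sub>R complex_of_real (- variance_coeff)) / norm h) \<longlongrightarrow> 0)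
        (at 0)"
      unfolding tendsto_at_iff_sequentially
    proof (intro allI impI)
      fix X :: "nat \<Rightarrow> real" assume X: "\<forall>i. X i \<in> UNIV - {0}" "X \<longlonglongrightarrow> 0"
      let ?J = "\<lambda>h x. \<i> * of_real x * R h x / of_real h"
      have lim: "(\<lambda>n. CLINT x|W. ?J (X n) x) \<longlonglongrightarrow> (CLINT x|W. 0)"
      proof (rule integral_dominated_convergence[where w = "\<lambda>x. 2 * x\<^sup>2"])
        show "integrable W (\<lambda>x. 2 * x\<^sup>2)" by (intro integrable_mult_right integrable_square_W)
        show "(\<lambda>x. ?J (X n) x) \<in> borel_measurable W" for n by (simp add: R_def)
        show "AE x in W. norm (?J (X n) x) \<le> 2 * x\<^sup>2" for n
        proof (rule AE_I2)
          fix x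
          have h: "X n \<noteq> 0" using X by auto
          have "norm (?J (X n) x) \<le> \<bar>x\<bar> * (2 * \<bar>X n * x\<bar>) / \<bar>X n\<bar>"
            unfolding norm_mult norm_divide R_def using cmod_exp_minus_linear_le(2)[of "X n * x"]
            by (auto intro!: divide_right_mono mult_left_mono simp del: of_real_mult)
          also have "\<dots> = 2 * x\<^sup>2" using h by (simp add: abs_mult power2_eq_square)
          finally show "norm (?J (X n) x) \<le> 2 * x\<^sup>2" .
        qed
        show "AE x in W. (\<lambda>n. ?J (X n) x) \<longlonglongrightarrow> 0"
        proof (rule AE_I2)
          fix x
          have lim: "(\<lambda>n. \<bar>x\<bar> ^ 3 / 2 * \<bar>X n\<bar>) \<longlonglongrightarrow> \<bar>x\<bar> ^ 3 / 2 * \<bar>0\<bar>" by (intro tendsto_intros X)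
          then have lim: "(\<lambda>n. \<bar>x\<bar> ^ 3 / 2 * \<bar>X n\<bar>) \<longlonglongrightarrow> 0" by simp
          show "(\<lambda>n. ?J (X n) x) \<longlonglongrightarrow> 0"
          proof (rule Lim_null_comparison[OF always_eventually lim], rule allI)
            fix n
            have h: "X n \<noteq> 0" using X by auto
            have "norm (?J (X n) x) \<le> \<bar>x\<bar> * ((X n * x)\<^sup>2 / 2) / \<bar>X n\<bar>"
              unfolding norm_mult norm_divide R_def norm_of_real norm_ii mult_1
              by (intro divide_right_mono mult_left_mono cmod_exp_minus_linear_le(1)) auto
            also have "(X n * x)\<^sup>2 = \<bar>X n\<bar> * \<bar>X n\<bar> * \<bar>x\<bar> * \<bar>x\<bar>"
              by (simp add: power2_eq_square)
            also have "\<bar>x\<bar> * (\<bar>X n\<bar> * \<bar>X n\<bar> * \<bar>x\<bar> * \<bar>x\<bar> / 2) / \<bar>X n\<bar> = \<bar>x\<bar> ^ 3 / 2 * \<bar>X n\<bar>"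
            proof -
              have "z * (y * y * z * z / 2) / y = z ^ 3 / 2 * y" if "y \<noteq> 0" for y z :: real
                using that by (simp add: power3_eq_cube)
              from this[of "\<bar>X n\<bar>" "\<bar>x\<bar>"] h show ?thesis by simp
            qed
            finally show "norm (?J (X n) x) \<le> \<bar>x\<bar> ^ 3 / 2 * \<bar>X n\<bar>" .
          qed
        qed
      qed simp
      have eq: "norm (K' (0 + h) - K' 0 - h *\<^sub>R complex_of_real (- variance_coeff)) / norm h
          = norm (CLINT x|W. ?J h x)" if "h \<noteq> 0" for h
      proof -
        have "K' (0 + h) - K' 0 - h *\<^sub>R complex_of_real (- variance_coeff)
            = (CLINT x|W. R' h x) + of_real h * of_real V"
          by (simp add: K'_def R'_def variance_coeff_def V_def scaleR_conv_of_real algebra_simps)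
        also have "of_real h * of_real V = (CLINT x|W. of_real h * of_real (x\<^sup>2))"
          by (simp only: integral_mult_right_zero integral_complex_of_real V_def)
        also have "(CLINT x|W. R' h x) + \<dots> = (CLINT x|W. R' h x + of_real h * of_real (x\<^sup>2))"
          by (intro Bochner_Integration.integral_add[symmetric] iR' integrable_mult_right
              integrable_of_real integrable_square_W)
        also have "\<dots> = (CLINT x|W. of_real h * ?J h x)"
        proof (intro Bochner_Integration.integral_cong refl)
          fix x
          have "of_real h * ?J h x = \<i> * of_real x * R h x" using that by simp
          then show "R' h x + of_real h * of_real (x\<^sup>2) = of_real h * ?J h x"
            by (simp only:) (simp add: R_def R'_def algebra_simps power2_eq_square)
        qed
        also have "\<dots> = of_real h * (CLINT x|W. ?J h x)" by (rule integral_mult_right_zero)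
        finally show ?thesis using that by (simp add: norm_mult norm_divide)
      qed
      have "(\<lambda>n. norm (CLINT x|W. ?J (X n) x)) \<longlonglongrightarrow> 0" using lim by (intro tendsto_norm_zero) simp
      then show "((\<lambda>h. norm (K' (0 + h) - K' 0 - h *\<^sub>R complex_of_real (- variance_coeff)) / norm h)
          \<circ> X) \<longlonglongrightarrow> 0"
        unfolding comp_def using X eq by simp
    qed
  qed
  show ?thesis unfolding has_second_derivative_at_def
    by (intro exI[of _ K'] conjI always_eventually allI d1 d2)
qed

end

section \<open>Square-integrable functions and characteristic functions\<close>

lemma integral_Cauchy_Schwarz:
  fixes f g :: "'a \<Rightarrow> real"
  assumes [measurable]: "f \<in> borel_measurable M" "g \<in> borel_measurable M"
    and f: "integrable M (\<lambda>x. (f x)\<^sup>2)" and g: "integrable M (\<lambda>x. (g x)\<^sup>2)"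
  shows "integrable M (\<lambda>x. f x * g x)"
    and "(LINT x|M. \<bar>f x * g x\<bar>) \<le> sqrt (LINT x|M. (f x)\<^sup>2) * sqrt (LINT x|M. (g x)\<^sup>2)"
proof -
  show int: "integrable M (\<lambda>x. f x * g x)"
  proof (rule Bochner_Integration.integrable_bound)
    show "integrable M (\<lambda>x. (f x)\<^sup>2 + (g x)\<^sup>2)" using f g by simp
    show "AE x in M. norm (f x * g x) \<le> norm ((f x)\<^sup>2 + (g x)\<^sup>2)"
    proof (rule AE_I2)
      fix x
      have "2 * \<bar>f x\<bar> * \<bar>g x\<bar> \<le> (f x)\<^sup>2 + (g x)\<^sup>2"
        using sum_squares_bound[of "\<bar>f x\<bar>" "\<bar>g x\<bar>"] by simp
      moreover have "0 \<le> \<bar>f x\<bar> * \<bar>g x\<bar>" by simp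
      ultimately show "norm (f x * g x) \<le> norm ((f x)\<^sup>2 + (g x)\<^sup>2)"
        unfolding real_norm_def abs_mult by linarith
    qed
  qed simp
  have "(\<integral>\<^sup>+x. ennreal \<bar>f x\<bar> * ennreal \<bar>g x\<bar> \<partial>M)\<^sup>2
      \<le> (\<integral>\<^sup>+x. (ennreal \<bar>f x\<bar>)\<^sup>2 \<partial>M) * (\<integral>\<^sup>+x. (ennreal \<bar>g x\<bar>)\<^sup>2 \<partial>M)"
    by (rule Cauchy_Schwarz_nn_integral) auto
  moreover have "(\<integral>\<^sup>+x. ennreal \<bar>f x\<bar> * ennreal \<bar>g x\<bar> \<partial>M) = ennreal (LINT x|M. \<bar>f x * g x\<bar>)"
    using integrable_abs[OF int] by (subst nn_integral_eq_integral[symmetric]) (auto simp: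
        ennreal_mult' abs_mult)
  moreover have "(\<integral>\<^sup>+x. (ennreal \<bar>f x\<bar>)\<^sup>2 \<partial>M) = ennreal (LINT x|M. (f x)\<^sup>2)"
    using f by (subst nn_integral_eq_integral[symmetric]) (auto simp: ennreal_power)
  moreover have "(\<integral>\<^sup>+x. (ennreal \<bar>g x\<bar>)\<^sup>2 \<partial>M) = ennreal (LINT x|M. (g x)\<^sup>2)"
    using g by (subst nn_integral_eq_integral[symmetric]) (auto simp: ennreal_power)
  ultimately have "(LINT x|M. \<bar>f x * g x\<bar>)\<^sup>2 \<le> (LINT x|M. (f x)\<^sup>2) * (LINT x|M. (g x)\<^sup>2)"
    by (simp add: ennreal_power ennreal_mult'[symmetric])
  then have "sqrt ((LINT x|M. \<bar>f x * g x\<bar>)\<^sup>2) \<le> sqrt ((LINT x|M. (f x)\<^sup>2) * (LINT x|M. (g x)\<^sup>2))"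
    by (rule real_sqrt_le_mono)
  then show "(LINT x|M. \<bar>f x * g x\<bar>) \<le> sqrt (LINT x|M. (f x)\<^sup>2) * sqrt (LINT x|M. (g x)\<^sup>2)"
    by (simp add: real_sqrt_mult)
qed

lemma integrable_square_add:
  fixes f g :: "'a \<Rightarrow> real"
  assumes "f \<in> borel_measurable M" "g \<in> borel_measurable M"
    and "integrable M (\<lambda>x. (f x)\<^sup>2)" "integrable M (\<lambda>x. (g x)\<^sup>2)"
  shows "integrable M (\<lambda>x. (f x + g x)\<^sup>2)" "integrable M (\<lambda>x. (f x - g x)\<^sup>2)"
  using integral_Cauchy_Schwarz(1)[OF assms] assms(3,4)
  by (simp_all add: power2_sum power2_diff mult.assoc)

text \<open>
  Continuity of the inner product in mean square, used for the control measure as well as for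
  the probability measure.
\<close>
lemma L2_tendsto_integral_mult:
  fixes u v :: "nat \<Rightarrow> 'a \<Rightarrow> real"
  assumes [measurable]: "\<And>n. u n \<in> borel_measurable M" "\<And>n. v n \<in> borel_measurable M"
      "f \<in> borel_measurable M" "g \<in> borel_measurable M"
    and u: "\<And>n. integrable M (\<lambda>x. (u n x)\<^sup>2)" and v: "\<And>n. integrable M (\<lambda>x. (v n x)\<^sup>2)"
    and f: "integrable M (\<lambda>x. (f x)\<^sup>2)" and g: "integrable M (\<lambda>x. (g x)\<^sup>2)"
    and uf: "(\<lambda>n. LINT x|M. (u n x - f x)\<^sup>2) \<longlonglongrightarrow> 0"
    and vg: "(\<lambda>n. LINT x|M. (v n x - g x)\<^sup>2) \<longlonglongrightarrow> 0"
  shows "(\<lambda>n. LINT x|M. u n x * v n x) \<longlonglongrightarrow> (LINT x|M. f x * g x)"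
proof -
  define U where "U n = sqrt (LINT x|M. (u n x - f x)\<^sup>2)" for n
  define V where "V n = sqrt (LINT x|M. (v n x - g x)\<^sup>2)" for n
  have U: "U \<longlonglongrightarrow> 0" and V: "V \<longlonglongrightarrow> 0"
    using tendsto_real_sqrt[OF uf] tendsto_real_sqrt[OF vg]
        by (simp_all add: U_def[abs_def] V_def[abs_def])
  have iu: "integrable M (\<lambda>x. (u n x - f x)\<^sup>2)" for n
      by (rule integrable_square_add(2)) (auto intro: u f)
  have iv: "integrable M (\<lambda>x. (v n x - g x)\<^sup>2)" for n
      by (rule integrable_square_add(2)) (auto intro: v g)
  define F where "F = sqrt (LINT x|M. (f x)\<^sup>2)"
  define G where "G = sqrt (LINT x|M. (g x)\<^sup>2)"
  have bound: "\<bar>(LINT x|M. u n x * v n x) - (LINT x|M. f x * g x)\<bar> \<le> U n * V n + U n * G + F * V n"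
      for n
  proof -
    have i: "integrable M (\<lambda>x. (u n x - f x) * (v n x - g x))"
        "integrable M (\<lambda>x. (u n x - f x) * g x)" "integrable M (\<lambda>x. f x * (v n x - g x))"
      "integrable M (\<lambda>x. u n x * v n x)" "integrable M (\<lambda>x. f x * g x)"
      by (intro integral_Cauchy_Schwarz(1); simp add: iu iv f g u v)+
    have "(LINT x|M. u n x * v n x) - (LINT x|M. f x * g x) = (LINT x|M. u n x * v n x - f x * g x)"
      using i by simp
    also have "\<dots> = (LINT x|M. (u n x - f x) * (v n x - g x) + (u n x - f x) * g x + f x
        * (v n x - g x))"
      by (intro Bochner_Integration.integral_cong) (auto simp: algebra_simps)
    also have "\<dots> = (LINT x|M. (u n x - f x) * (v n x - g x)) + (LINT x|M. (u n x - f x) * g x)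
        + (LINT x|M. f x * (v n x - g x))"
      using i by (simp only: Bochner_Integration.integral_add Bochner_Integration.integrable_add)
    finally have "\<bar>(LINT x|M. u n x * v n x) - (LINT x|M. f x * g x)\<bar> \<le>
      \<bar>LINT x|M. (u n x - f x) * (v n x - g x)\<bar> + \<bar>LINT x|M. (u n x - f x) * g x\<bar> + \<bar>LINT x|M.
          f x * (v n x - g x)\<bar>"
      by linarith
    also have "\<bar>LINT x|M. (u n x - f x) * (v n x - g x)\<bar> \<le> U n * V n"
      unfolding U_def V_def by (rule order_trans[OF integral_abs_bound integral_Cauchy_Schwarz(2)])
          (auto simp: iu iv)
    also have "\<bar>LINT x|M. (u n x - f x) * g x\<bar> \<le> U n * G"
      unfolding U_def G_def by (rule order_trans[OF integral_abs_bound integral_Cauchy_Schwarz(2)])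
          (auto simp: iu g)
    also have "\<bar>LINT x|M. f x * (v n x - g x)\<bar> \<le> F * V n"
      unfolding V_def F_def by (rule order_trans[OF integral_abs_bound integral_Cauchy_Schwarz(2)])
          (auto simp: iv f)
    finally show ?thesis by simp
  qed
  have "(\<lambda>n. U n * V n + U n * G + F * V n) \<longlonglongrightarrow> 0 * 0 + 0 * G + F * 0"
    by (intro tendsto_intros U V)
  then have lim: "(\<lambda>n. U n * V n + U n * G + F * V n) \<longlonglongrightarrow> 0" by simp
  have "(\<lambda>n. (LINT x|M. u n x * v n x) - (LINT x|M. f x * g x)) \<longlonglongrightarrow> 0"
    by (rule Lim_null_comparison[OF always_eventually lim]) (use bound in auto)
  then show ?thesis by (simp add: LIM_zero_iff)
qed

context prob_space begin

text \<open>
  Mean square convergence implies convergence in mean, which has an almost surely convergent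
  subsequence; its limit is the mean square limit by Fatou's lemma.
\<close>
lemma L2_Cauchy_convergent:
  fixes u :: "nat \<Rightarrow> 'a \<Rightarrow> real"
  assumes [measurable]: "\<And>n. u n \<in> borel_measurable M"
    and u: "\<And>n. integrable M (\<lambda>x. (u n x)\<^sup>2)"
    and Cauchy: "\<And>e. e > 0 \<Longrightarrow> \<exists>N. \<forall>m\<ge>N. \<forall>n\<ge>N. (LINT x|M. (u m x - u n x)\<^sup>2) < e"
  obtains J and \<rho> :: "nat \<Rightarrow> nat" where "J \<in> borel_measurable M" "integrable M (\<lambda>x. (J x)\<^sup>2)"
    "strict_mono \<rho>" "AE x in M. (\<lambda>n. u (\<rho> n) x) \<longlonglongrightarrow> J x"
    "(\<lambda>n. LINT x|M. (u n x - J x)\<^sup>2) \<longlonglongrightarrow> 0"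
proof -
  have idiff: "integrable M (\<lambda>x. (u m x - u n x)\<^sup>2)" for m n
    by (rule integrable_square_add(2)) (auto intro: u)
  have iu1: "integrable M (u n)" for n by (rule square_integrable_imp_integrable) (auto intro: u)
  have L1: "(LINT x|M. norm (u m x - u n x)) \<le> sqrt (LINT x|M. (u m x - u n x)\<^sup>2)" for m n
    using integral_Cauchy_Schwarz(2)[of "\<lambda>x. u m x - u n x" M "\<lambda>_. 1"] idiff[of m n]
        by (simp add: prob_space)
  have "\<exists>N. \<forall>i\<ge>N. \<forall>j\<ge>N. (LINT x|M. norm (u i x - u j x)) < e" if e: "e > 0" for e
  proof -
    obtain N where N: "\<forall>m\<ge>N. \<forall>n\<ge>N. (LINT x|M. (u m x - u n x)\<^sup>2) < e\<^sup>2"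
      using Cauchy[of "e\<^sup>2"] e by auto
    have "(LINT x|M. norm (u i x - u j x)) < e" if "i \<ge> N" "j \<ge> N" for i j
    proof -
      have "(LINT x|M. norm (u i x - u j x)) \<le> sqrt (LINT x|M. (u i x - u j x)\<^sup>2)" by (rule L1)
      also have "\<dots> < sqrt (e\<^sup>2)" using N that by (intro real_sqrt_less_mono) auto
      finally show ?thesis using e by simp
    qed
    then show ?thesis by blast
  qed
  then obtain \<rho> :: "nat \<Rightarrow> nat" where \<rho>: "strict_mono \<rho>" "AE x in M. Cauchy (\<lambda>i. u (\<rho> i) x)"
    using cauchy_L1_AE_cauchy_subseq[of M u] iu1 by blast
  define J where "J x = lim (\<lambda>i. u (\<rho> i) x)" for x
  have Jm[measurable]: "J \<in> borel_measurable M" unfolding J_def[abs_def] by measurable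
  have AEJ: "AE x in M. (\<lambda>i. u (\<rho> i) x) \<longlonglongrightarrow> J x"
    using \<rho>(2) by eventually_elim (auto simp: J_def convergent_LIMSEQ_iff[symmetric]
        real_Cauchy_convergent)
  have fatou: "(\<integral>\<^sup>+x. ennreal ((u m x - J x)\<^sup>2) \<partial>M) \<le> ennreal e"
    if "e > 0" "\<forall>n\<ge>N. (LINT x|M. (u m x - u n x)\<^sup>2) < e" for e m N
  proof -
    have "(\<integral>\<^sup>+x. ennreal ((u m x - J x)\<^sup>2) \<partial>M)
        = (\<integral>\<^sup>+x. liminf (\<lambda>i. ennreal ((u m x - u (\<rho> i) x)\<^sup>2)) \<partial>M)"
    proof (rule nn_integral_cong_AE)
      show "AE x in M. ennreal ((u m x - J x)\<^sup>2) = liminf (\<lambda>i. ennreal ((u m x - u (\<rho> i) x)\<^sup>2))"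
        using AEJ by eventually_elim (auto intro!: lim_imp_Liminf[symmetric] tendsto_ennrealI
            tendsto_intros)
    qed
    also have "\<dots> \<le> liminf (\<lambda>i. \<integral>\<^sup>+x. ennreal ((u m x - u (\<rho> i) x)\<^sup>2) \<partial>M)"
      by (rule nn_integral_liminf) measurable
    also have "\<dots> \<le> liminf (\<lambda>i. ennreal e)"
    proof (rule Liminf_mono)
      show "\<forall>\<^sub>F i in sequentially. (\<integral>\<^sup>+x. ennreal ((u m x - u (\<rho> i) x)\<^sup>2) \<partial>M) \<le> ennreal e"
        using eventually_ge_at_top[of N]
      proof eventually_elim
        case (elim i)
        then have "\<rho> i \<ge> N" using seq_suble[OF \<rho>(1), of i] by simp
        then show ?case using that idiff[of m "\<rho> i"]
          by (subst nn_integral_eq_integral) (auto intro!: ennreal_leI less_imp_le)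
      qed
    qed
    finally show ?thesis by (simp add: Liminf_const)
  qed
  obtain N0 where N0: "\<forall>m\<ge>N0. \<forall>n\<ge>N0. (LINT x|M. (u m x - u n x)\<^sup>2) < 1" using Cauchy[of 1] by auto
  have J1: "integrable M (\<lambda>x. (u N0 x - J x)\<^sup>2)"
    using fatou[of 1 N0 N0] N0 by (intro integrableI_nonneg) (auto simp:
        less_top[symmetric] top_unique)
  have J2: "integrable M (\<lambda>x. (J x)\<^sup>2)"
    using integrable_square_add(2)[OF _ _ u[of N0] J1] by simp
  have iJ: "integrable M (\<lambda>x. (u n x - J x)\<^sup>2)" for n
    by (rule integrable_square_add(2)) (auto intro: u J2)
  have "(\<lambda>n. LINT x|M. (u n x - J x)\<^sup>2) \<longlonglongrightarrow> 0"
  proof (rule LIMSEQ_I)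
    fix r :: real assume r: "r > 0"
    obtain N where N: "\<forall>m\<ge>N. \<forall>n\<ge>N. (LINT x|M. (u m x - u n x)\<^sup>2) < r / 2" using Cauchy[of "r/2"] r
        by auto
    have "norm ((LINT x|M. (u n x - J x)\<^sup>2) - 0) < r" if "n \<ge> N" for n
    proof -
      have "ennreal (LINT x|M. (u n x - J x)\<^sup>2) \<le> ennreal (r / 2)"
        using fatou[of "r/2" N n] N that r nn_integral_eq_integral[OF iJ[of n]] by simp
      then have "(LINT x|M. (u n x - J x)\<^sup>2) \<le> r / 2" using r by simp
      moreover have "0 \<le> (LINT x|M. (u n x - J x)\<^sup>2)" by simp
      ultimately show ?thesis using r by simp
    qed
    then show "\<exists>no. \<forall>n\<ge>no. norm ((LINT x|M. (u n x - J x)\<^sup>2) - 0) < r" by blast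
  qed
  with that \<rho>(1) AEJ Jm J2 show thesis by blast
qed

definition chf :: "('a \<Rightarrow> real) \<Rightarrow> real \<Rightarrow> complex" where
  "chf Y s = (CLINT w|M. exp (\<i> * of_real (s * Y w)))"

lemma char_distr_eq_chf: "Y \<in> borel_measurable M \<Longrightarrow> char (distr M borel Y) s = chf Y s"
  unfolding char_def chf_def by (subst integral_distr) auto

lemma integrable_exp_i:
  assumes [measurable]: "Y \<in> borel_measurable M"
      shows "integrable M (\<lambda>w. exp (\<i> * of_real (s * Y w)))"
  by (rule integrable_const_bound[where B = 1]) (auto simp: norm_exp_i_times simp del: of_real_mult)

lemma norm_chf_le_1:
  assumes [measurable]: "Y \<in> borel_measurable M" shows "cmod (chf Y s) \<le> 1"
proof -
  have "cmod (chf Y s) \<le> (LINT w|M. cmod (exp (\<i> * of_real (s * Y w))))"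
    unfolding chf_def by (rule integral_norm_bound)
  then show ?thesis by (simp add: prob_space norm_exp_i_times del: of_real_mult)
qed

lemma chf_tendsto:
  assumes [measurable]: "\<And>n. Y n \<in> borel_measurable M" "Z \<in> borel_measurable M"
    and "AE w in M. (\<lambda>n. Y n w) \<longlonglongrightarrow> Z w"
  shows "(\<lambda>n. chf (Y n) s) \<longlonglongrightarrow> chf Z s"
  unfolding chf_def
proof (rule integral_dominated_convergence[where w = "\<lambda>_. 1"])
  show "AE w in M. (\<lambda>n. exp (\<i> * of_real (s * Y n w))) \<longlonglongrightarrow> exp (\<i> * of_real (s * Z w))"
    using assms(3) by eventually_elim (intro tendsto_intros)
  show "AE w in M. norm (exp (\<i> * of_real (s * Y n w))) \<le> 1" for n
    by (simp add: norm_exp_i_times del: of_real_mult)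
qed auto

text \<open>
  If \<open>|\<phi>(s)| = 1\<close> then \<open>exp(i s R)\<close> has variance zero, so it is constant almost surely. Along \<open>s
  = 1, 1/2, 1/3, \<dots>\<close> this forces two typical values of \<open>R\<close> to differ by a multiple of \<open>2 \<pi> n\<close> for
  every \<open>n\<close>, hence to agree.
\<close>
lemma AE_constant_if_norm_chf_1:
  assumes [measurable]: "R \<in> borel_measurable M" and one: "\<And>s. cmod (chf R s) = 1"
  shows "\<exists>c. AE w in M. R w = c"
proof -
  have "AE w in M. exp (\<i> * of_real (s * R w)) = chf R s" for s
  proof -
    let ?e = "\<lambda>w. exp (\<i> * of_real (s * R w))"
    define z where "z = chf R s"
    have i: "integrable M ?e" by (rule integrable_exp_i) simp
    have n: "norm (?e w - z) ^ 2 = 2 - 2 * Re (cnj z * ?e w)" for w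
    proof -
      have "complex_of_real (norm (?e w - z) ^ 2) = (?e w - z) * cnj (?e w - z)"
          by (rule complex_norm_square)
      also have "\<dots> = ?e w * cnj (?e w) + z * cnj z - (cnj z * ?e w + cnj (cnj z * ?e w))"
          by (simp add: algebra_simps)
      also have "?e w * cnj (?e w) = of_real ((norm (?e w))\<^sup>2)"
          by (rule complex_norm_square[symmetric])
      also have "z * cnj z = of_real ((norm z)\<^sup>2)" by (rule complex_norm_square[symmetric])
      also have "cnj z * ?e w + cnj (cnj z * ?e w) = of_real (2 * Re (cnj z * ?e w))"
          by (rule complex_add_cnj)
      finally show ?thesis using one[of s] by (simp only:
          of_real_diff[symmetric] of_real_add[symmetric] of_real_eq_iff z_def norm_exp_i_times) simp
    qed
    have iR: "integrable M (\<lambda>w. Re (cnj z * ?e w))" using i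
        by (intro integrable_Re integrable_mult_right)
    have "(LINT w|M. norm (?e w - z) ^ 2) = 2 - 2 * (LINT w|M. Re (cnj z * ?e w))"
    proof -
      have "(LINT w|M. 2 - 2 * h w) = 2 - 2 * (LINT w|M. h w)" if "integrable M h"
          for h :: "'a \<Rightarrow> real"
        using that by (simp add: prob_space)
      from this[OF iR] show ?thesis unfolding n .
    qed
    also have "(LINT w|M. Re (cnj z * ?e w)) = Re (cnj z * z)"
      using i by (simp only: integral_Re[OF integrable_mult_right[OF i]] integral_mult_right_zero
          z_def chf_def)
    also have "Re (cnj z * z) = 1"
      using one[of s] complex_norm_square[of z]
          by (simp add: z_def mult.commute flip: of_real_power)
    finally have "(LINT w|M. norm (?e w - z) ^ 2) = 0" by simp
    moreover have "integrable M (\<lambda>w. norm (?e w - z) ^ 2)"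
      unfolding n by (intro Bochner_Integration.integrable_diff integrable_const
          integrable_mult_right iR)
    ultimately have "AE w in M. norm (?e w - z) ^ 2 = 0"
      by (subst (asm) integral_nonneg_eq_0_iff_AE) auto
    then show ?thesis by eventually_elim (simp add: z_def)
  qed
  then have "AE w in M. \<forall>n. exp (\<i> * of_real (1 / real (Suc n) * R w)) = chf R (1 / real (Suc n))"
    unfolding AE_all_countable by blast
  then have "\<exists>c. AE w in M. R w = c"
  proof -
    let ?P = "\<lambda>w. \<forall>n. exp (\<i> * of_real (1 / real (Suc n) * R w)) = chf R (1 / real (Suc n))"
    assume P: "AE w in M. ?P w"
    have "\<exists>w. ?P w"
    proof (rule ccontr)
      assume "\<nexists>w. ?P w"
      then have "?P = (\<lambda>w. False)" by (intro ext) blast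
      with P have "AE w in M. False" by (simp only:)
      then show False by simp
    qed
    then obtain w0 where w0: "?P w0" by blast
    have "R w = R w0" if w: "?P w" for w
    proof -
      define D where "D = R w - R w0"
      obtain n :: nat where n: "\<bar>D\<bar> < real n" using reals_Archimedean2 by blast
      have "exp (\<i> * of_real (1 / real (Suc n) * R w))
          = exp (\<i> * of_real (1 / real (Suc n) * R w0))" using w w0 by simp
      then obtain k :: int where k: "\<i> * of_real (1 / real (Suc n) * R w)
          = \<i> * of_real (1 / real (Suc n) * R w0) + complex_of_real (real_of_int (2 * k) * pi) * \<i>"
        unfolding exp_eq by blast
      have "Im (\<i> * of_real (1 / real (Suc n) * R w))
          = Im (\<i> * of_real (1 / real (Suc n) * R w0) + complex_of_real (real_of_int (2 * k) * pi)
          * \<i>)"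
        by (simp only: k)
      then have "1 / real (Suc n) * R w = 1 / real (Suc n) * R w0 + of_int (2 * k) * pi"
          by (simp del: of_nat_Suc)
      then have "D / real (Suc n) = of_int (2 * k) * pi"
          by (simp add: D_def diff_divide_distrib del: of_nat_Suc)
      moreover have "\<bar>D / real (Suc n)\<bar> < 1" using n by (simp add: abs_mult)
      ultimately have "\<bar>of_int (2 * k) * pi\<bar> < 1" by simp
      \<comment> \<open>a nonzero multiple of 2 pi is larger than 1\<close>
      have "k = 0"
      proof (rule ccontr)
        assume "k \<noteq> 0"
        then have "(1::real) \<le> \<bar>of_int (2 * k)\<bar>" by linarith
        then have "1 * 1 \<le> \<bar>of_int (2 * k)\<bar> * pi" using pi_gt3 by (intro mult_mono) auto
        with \<open>\<bar>of_int (2 * k) * pi\<bar> < 1\<close> show False by (simp add: abs_mult)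
      qed
      with \<open>D / real (Suc n) = of_int (2 * k) * pi\<close> show ?thesis
          by (simp add: D_def del: of_nat_Suc)
    qed
    with P have "AE w in M. R w = R w0" by (auto elim: eventually_mono)
    then show ?thesis by blast
  qed
  then show ?thesis .
qed

lemma AE_zero_if_chf_1:
  assumes [measurable]: "R \<in> borel_measurable M" and one: "\<And>s. chf R s = 1"
  shows "AE w in M. R w = 0"
proof -
  obtain c where c: "AE w in M. R w = c" using AE_constant_if_norm_chf_1[of R] one by auto
  have e: "exp (\<i> * of_real (s * c)) = 1" for s
  proof -
    have "chf R s = (CLINT w|M. exp (\<i> * of_real (s * c)))"
      unfolding chf_def using c by (intro integral_cong_AE) (auto elim: eventually_mono)
    then show ?thesis using one[of s] by (simp add: prob_space)
  qed
  have "c = 0"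
  proof (rule ccontr)
    assume "c \<noteq> 0"
    then have "exp (\<i> * of_real pi) = 1" using e[of "pi / c"] by simp
    then show False by simp
  qed
  with c show ?thesis by simp
qed

text \<open>
  Convergence in probability is convergence to 0 of the mean of the truncated distance.
\<close>
lemma tendsto_in_prob_AE_subseq:
  assumes [measurable]: "\<And>n. Z n \<in> borel_measurable M" "Y \<in> borel_measurable M"
    and lim: "tendsto_in_prob M Z Y"
  obtains \<rho> :: "nat \<Rightarrow> nat" where "strict_mono \<rho>" "AE w in M. (\<lambda>n. Z (\<rho> n) w) \<longlonglongrightarrow> Y w"
proof -
  define D where "D n w = min 1 \<bar>Z n w - Y w\<bar>" for n w
  have [measurable]: "D n \<in> borel_measurable M" for n unfolding D_def[abs_def] by measurable
  have D: "0 \<le> D n w" "D n w \<le> 1" for n w by (auto simp: D_def)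
  have iD: "integrable M (D n)" for n by (rule integrable_const_bound[where B = 1]) (auto simp: D)
  have "(\<lambda>n. LINT w|M. norm (D n w)) \<longlonglongrightarrow> 0"
  proof (rule LIMSEQ_I)
    fix r :: real assume r: "r > 0"
    let ?A = "\<lambda>n. {w \<in> space M. \<bar>Z n w - Y w\<bar> \<ge> r / 2}"
    have "(\<lambda>n. prob (?A n)) \<longlonglongrightarrow> 0" using lim r unfolding tendsto_in_prob_def by (meson half_gt_zero)
    from LIMSEQ_D[OF this, of "r/2"] r obtain N where N: "\<And>n. n \<ge> N \<Longrightarrow> prob (?A n) < r / 2" by auto
    have "norm ((LINT w|M. norm (D n w)) - 0) < r" if "n \<ge> N" for n
    proof -
      have "(LINT w|M. norm (D n w)) \<le> (LINT w|M. r / 2 + indicator (?A n) w)"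
      proof (rule integral_mono)
        show "integrable M (\<lambda>w. norm (D n w))" using iD by simp
        show "integrable M (\<lambda>w. r / 2 + indicator (?A n) w)"
            by (intro Bochner_Integration.integrable_add integrable_const) (auto simp:
            less_top[symmetric])
        show "norm (D n w) \<le> r / 2 + indicator (?A n) w" if "w \<in> space M" for w
        proof (cases "w \<in> ?A n")
          case True
          then show ?thesis using r D[of n w] by simp
        next
          case False
          then have "\<bar>Z n w - Y w\<bar> < r / 2" using that by auto
          moreover have "D n w \<le> \<bar>Z n w - Y w\<bar>" by (simp add: D_def)
          ultimately have "D n w \<le> r / 2" by linarith
          then show ?thesis using False D(1)[of n w] by simp
        qed
      qed
      also have "\<dots> = r / 2 + prob (?A n)"
        by (subst Bochner_Integration.integral_add) (auto simp: prob_space less_top[symmetric])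
      also have "\<dots> < r" using N[OF that] by simp
      finally show ?thesis by (simp add: D)
    qed
    then show "\<exists>no. \<forall>n\<ge>no. norm ((LINT w|M. norm (D n w)) - 0) < r" by blast
  qed
  then obtain \<rho> :: "nat \<Rightarrow> nat" where \<rho>: "strict_mono \<rho>" "AE w in M. (\<lambda>n. D (\<rho> n) w) \<longlonglongrightarrow> 0"
    using tendsto_L1_AE_subseq[of M D] iD by blast
  have "AE w in M. (\<lambda>n. Z (\<rho> n) w) \<longlonglongrightarrow> Y w"
    using \<rho>(2)
  proof eventually_elim
    case (elim w)
    have "(\<lambda>n. \<bar>Z (\<rho> n) w - Y w\<bar>) \<longlonglongrightarrow> 0"
    proof (rule Lim_transform_eventually[OF elim])
      have "\<forall>\<^sub>F n in sequentially. D (\<rho> n) w < 1" using elim by (rule order_tendstoD) simp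
      then show "\<forall>\<^sub>F n in sequentially. D (\<rho> n) w = \<bar>Z (\<rho> n) w - Y w\<bar>"
        by eventually_elim (auto simp: D_def min_def split: if_splits)
    qed
    then show ?case using tendsto_rabs_zero_iff LIM_zero_iff by blast
  qed
  with \<rho>(1) that show thesis by blast
qed

end

section \<open>Integrals of simple functions\<close>

text \<open>
  By disjointness at most one summand is active at a point, so functions vanishing at 0 pass
  through the sum.
\<close>
lemma simple_fun_compose:
  assumes "disjoint_family_on B {..<n}" and h0: "h 0 = (0::real)"
  shows "h (simple_fun n a B x) = (\<Sum>i<n. h (a i) * indicator (B i) x)"
proof (cases "\<exists>i<n. x \<in> B i")
  case True
  then obtain i where i: "i < n" "x \<in> B i" by blast
  have other: "x \<notin> B j" if "j < n" "j \<noteq> i" for j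
    using assms(1) i that by (auto simp: disjoint_family_on_def)
  have "(\<Sum>j<n. g j * indicator (B j) x) = g i" for g :: "nat \<Rightarrow> real"
  proof -
    have "(\<Sum>j<n. g j * indicator (B j) x) = (\<Sum>j\<in>{i}. g j * indicator (B j) x)"
      using i other by (intro sum.mono_neutral_right) auto
    then show ?thesis using i by simp
  qed
  then show ?thesis by (simp add: simple_fun_def)
next
  case False
  then have "\<forall>i<n. indicator (B i) x = (0::real)" by auto
  then show ?thesis by (simp add: simple_fun_def h0)
qed

lemma simple_fun_Int: "simple_fun n a (\<lambda>i. P \<inter> B i) x = simple_fun n a B x * indicator P x"
  unfolding simple_fun_def sum_distrib_right by (intro sum.cong) (auto simp: indicator_inter_arith)

lemma simple_fun_measurable [measurable (raw)]:
  assumes "\<And>i. i < n \<Longrightarrow> B i \<in> sets M" shows "simple_fun n a B \<in> borel_measurable M"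
  unfolding simple_fun_def[abs_def] using assms by (intro borel_measurable_sum) auto

lemma sum_lessThan_add: "(\<Sum>i<n + m. f i) = (\<Sum>i<n. f i) + (\<Sum>i<m. f (n + i))"
    for f :: "nat \<Rightarrow> 'a::comm_monoid_add"
  by (induct m) (auto simp: add.assoc)

lemma prod_lessThan_add: "(\<Prod>i<n + m. f i) = (\<Prod>i<n. f i) * (\<Prod>i<m. f (n + i))"
    for f :: "nat \<Rightarrow> 'a::comm_monoid_mult"
  by (induct m) (auto simp: mult.assoc)

locale scattered_measure = prob_space M + levy_triplet b W
  for M :: "'w measure" and b :: real and W :: "real measure" +
  fixes \<mu> :: "'x measure" and S :: "'x set set" and \<Lambda> :: "'x set \<Rightarrow> 'w \<Rightarrow> real"
  assumes index_ring: "index_ring \<mu> S"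
    and random_measure: "id_random_measure M \<mu> (levy_exponent b W) S \<Lambda>"
begin

sublocale ring: ring_of_sets "space \<mu>" S
  using index_ring by (simp add: index_ring_def)

lemma S_sets [measurable_dest]: "A \<in> S \<Longrightarrow> A \<in> sets \<mu>"
  using index_ring by (auto simp: index_ring_def)

lemma S_subset_space: "A \<in> S \<Longrightarrow> A \<subseteq> space \<mu>"
  by (rule sets.sets_into_space) (rule S_sets)

lemma S_INT: "(\<And>n::nat. A n \<in> S) \<Longrightarrow> (\<Inter>n. A n) \<in> S"
  using index_ring by (simp add: index_ring_def image_subset_iff)

lemma \<Lambda>_measurable [measurable (raw)]: "A \<in> S \<Longrightarrow> \<Lambda> A \<in> borel_measurable M"
  using random_measure by (auto simp: id_random_measure_def)

lemma chf_\<Lambda>: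
  assumes "A \<in> S" "emeasure \<mu> A < \<infinity>"
  shows "chf (\<Lambda> A) s = exp (of_real (measure \<mu> A) * levy_exponent b W s)"
  using random_measure assms char_distr_eq_chf[of "\<Lambda> A" s]
  by (auto simp: id_random_measure_def has_cumulant_function_def)

lemma \<Lambda>_null:
  assumes "A \<in> S" "emeasure \<mu> A = 0" shows "AE w in M. \<Lambda> A w = 0"
  using assms by (intro AE_zero_if_chf_1 \<Lambda>_measurable) (auto simp: chf_\<Lambda> measure_def)

lemma \<Lambda>_sums:
  fixes A :: "nat \<Rightarrow> 'x set"
  assumes "\<And>n. A n \<in> S" "disjoint_family A" "(\<Union>n. A n) \<in> S"
  shows "AE w in M. (\<lambda>n. \<Lambda> (A n) w) sums \<Lambda> (\<Union>n. A n) w"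
  using random_measure assms unfolding id_random_measure_def by blast

lemma \<Lambda>_indep:
  fixes A :: "nat \<Rightarrow> 'x set"
  assumes "\<And>n. A n \<in> S" "disjoint_family A"
  shows "indep_vars (\<lambda>_. borel) (\<lambda>n. \<Lambda> (A n)) UNIV"
  using random_measure assms unfolding id_random_measure_def by blast

lemma \<Lambda>_Un:
  assumes A: "A \<in> S" and B: "B \<in> S" and disj: "A \<inter> B = {}"
  shows "AE w in M. \<Lambda> (A \<union> B) w = \<Lambda> A w + \<Lambda> B w"
proof -
  define C where "C n = (if n = 0 then A else if n = 1 then B else {})" for n :: nat
  have U: "(\<Union>n. C n) = A \<union> B"
  proof
    show "A \<union> B \<subseteq> (\<Union>n. C n)" using UN_upper[of 0 UNIV C] UN_upper[of 1 UNIV C] by (auto simp: C_def)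
  qed (auto simp: C_def split: if_splits)
  have "disjoint_family C" using disj by (auto simp: C_def disjoint_family_on_def)
  then have "AE w in M. (\<lambda>n. \<Lambda> (C n) w) sums \<Lambda> (\<Union>n. C n) w"
  proof (rule \<Lambda>_sums[rotated])
    show "C n \<in> S" for n using A B by (simp add: C_def)
    show "(\<Union>n. C n) \<in> S" unfolding U using A B by (rule ring.Un)
  qed
  moreover have "AE w in M. \<Lambda> {} w = 0" by (rule \<Lambda>_null) auto
  ultimately show ?thesis
  proof eventually_elim
    case (elim w)
    have "(\<lambda>n. \<Lambda> (C n) w) sums (\<Sum>n\<in>{0, 1}. \<Lambda> (C n) w)"
      using elim(2) by (intro sums_finite) (auto simp: C_def)
    with elim(1) have "\<Lambda> (\<Union>n. C n) w = (\<Sum>n\<in>{0, 1}. \<Lambda> (C n) w)" by (rule sums_unique2)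
    then show ?case unfolding U by (simp add: C_def)
  qed
qed

text \<open>
  Exhaustion is only demanded up to a null set, since simple functions determine their limit
  only almost everywhere.
\<close>
definition exhausting :: "(nat \<Rightarrow> 'x set) \<Rightarrow> bool" where
  "exhausting A \<longleftrightarrow> range A \<subseteq> S \<and> incseq A \<and> (AE x in \<mu>. \<exists>k. x \<in> A k)"

text \<open>
  The part of \<open>B\<close> that is missed by all \<open>A m\<close> is a countable intersection of sets in the ring,
  hence in the ring, and null; on the rest countable additivity applies. The sets \<open>B\<close> themselves
  may have infinite control measure, where nothing is known about the law of \<open>\<Lambda> B\<close>.
\<close>
lemma \<Lambda>_exhausting_limit:
  assumes A: "exhausting A" and B: "B \<in> S"
  shows "AE w in M. (\<lambda>m. \<Lambda> (A m \<inter> B) w) \<longlonglongrightarrow> \<Lambda> B w"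
proof -
  have AS: "A m \<in> S" for m using A by (auto simp: exhausting_def)
  have inc: "A m \<subseteq> A (Suc m)" for m using A by (auto simp: exhausting_def incseq_Suc_iff)
  define D where "D m = (case m of 0 \<Rightarrow> A 0 \<inter> B | Suc k \<Rightarrow> (A (Suc k) - A k) \<inter> B)" for m
  have DS: "D m \<in> S" for m using AS B by (auto simp: D_def split: nat.split)
  have UD: "(\<Union>i\<le>m. D i) = A m \<inter> B" for m
  proof (induct m)
    case (Suc m)
    then show ?case using inc[of m] by (auto simp: D_def atMost_Suc)
  qed (simp add: D_def)
  \<comment> \<open>the part of B outside of all A m\<close>
  define N where "N = (\<Inter>m. B - A m)"
  have NS: "N \<in> S" unfolding N_def using AS B by (intro S_INT) auto
  have UDN: "(\<Union>m. D m) = B - N"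
  proof -
    have "(\<Union>m. D m) = (\<Union>m. \<Union>i\<le>m. D i)" by auto
    then show ?thesis unfolding UD N_def by auto
  qed
  have disj: "disjoint_family D"
  proof -
    have "D i \<inter> D j = {}" if ij: "i < j" for i j
    proof -
      obtain k where k: "j = Suc k" using ij by (cases j) auto
      have "D i \<subseteq> (\<Union>i\<le>k. D i)" using ij k by (intro UN_upper) auto
      then have "D i \<subseteq> A k" unfolding UD by auto
      then show ?thesis by (auto simp: D_def k)
    qed
    then show ?thesis by (auto simp: disjoint_family_on_def) (metis disjoint_iff linorder_neqE_nat)
  qed
  have "emeasure \<mu> N = 0"
  proof -
    have "AE x in \<mu>. x \<notin> N"
      using A by (auto simp: exhausting_def N_def elim!: eventually_mono)
    then show ?thesis
      using AE_iff_measurable[OF S_sets[OF NS], of "\<lambda>x. x \<notin> N"] S_subset_space[OF NS] by auto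
  qed
  then have 1: "AE w in M. \<Lambda> N w = 0" by (rule \<Lambda>_null[OF NS])
  have "B = (\<Union>m. D m) \<union> N" unfolding UDN by (auto simp: N_def)
  then have 2: "AE w in M. \<Lambda> B w = \<Lambda> (\<Union>m. D m) w + \<Lambda> N w"
    using \<Lambda>_Un[of "\<Union>m. D m" N] NS B UDN by (auto simp: Un_commute)
  have 3: "AE w in M. (\<lambda>n. \<Lambda> (D n) w) sums \<Lambda> (\<Union>n. D n) w"
    using DS disj NS B by (intro \<Lambda>_sums) (auto simp: UDN)
  have "AE w in M. \<Lambda> (A m \<inter> B) w = (\<Sum>i\<le>m. \<Lambda> (D i) w)" for m
  proof (induct m)
    case 0
    then show ?case by (simp add: D_def)
  next
    case (Suc m)
    have e: "A (Suc m) \<inter> B = (A m \<inter> B) \<union> D (Suc m)" using inc[of m] by (auto simp: D_def)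
    have "AE w in M. \<Lambda> ((A m \<inter> B) \<union> D (Suc m)) w = \<Lambda> (A m \<inter> B) w + \<Lambda> (D (Suc m)) w"
      using AS B DS by (intro \<Lambda>_Un) (auto simp: D_def)
    with Suc show ?case unfolding e by eventually_elim simp
  qed
  then have "AE w in M. \<forall>m. \<Lambda> (A m \<inter> B) w = (\<Sum>i\<le>m. \<Lambda> (D i) w)" by (simp add: AE_all_countable)
  with 1 2 3 show ?thesis
  proof eventually_elim
    case (elim w)
    then show ?case by (simp add: sums_def_le)
  qed
qed

lemma chf_sum_indep:
  fixes D :: "nat \<Rightarrow> 'x set"
  assumes D: "\<And>i. i < n \<Longrightarrow> D i \<in> S" and disj: "disjoint_family_on D {..<n}"
  shows "chf (\<lambda>w. \<Sum>i<n. c i * \<Lambda> (D i) w) s = (\<Prod>i<n. chf (\<Lambda> (D i)) (s * c i))"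
proof -
  \<comment> \<open>independence is given for sequences, so the family is padded with empty sets\<close>
  define E where "E i = (if i < n then D i else {})" for i
  have ES: "E i \<in> S" for i using D by (auto simp: E_def)
  have "disjoint_family E" using disj by (auto simp: E_def disjoint_family_on_def)
  then have "indep_vars (\<lambda>_. borel) (\<lambda>i. \<Lambda> (E i)) UNIV" using ES by (intro \<Lambda>_indep) auto
  then have "indep_vars (\<lambda>_. borel) (\<lambda>i. \<Lambda> (E i)) {..<n}" by (rule indep_vars_subset) simp
  then have ind: "indep_vars (\<lambda>_. borel) (\<lambda>i w. exp (\<i> * of_real ((s * c i) * \<Lambda> (E i) w))) {..<n}"
    by (rule indep_vars_compose2) measurable
  have "chf (\<lambda>w. \<Sum>i<n. c i * \<Lambda> (D i) w) s = (CLINT w|M.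
      (\<Prod>i<n. exp (\<i> * of_real ((s * c i) * \<Lambda> (E i) w))))"
    unfolding chf_def
    by (intro Bochner_Integration.integral_cong refl)
      (simp add: E_def sum_distrib_left exp_sum mult.assoc)
  also have "\<dots> = (\<Prod>i<n. CLINT w|M. exp (\<i> * of_real ((s * c i) * \<Lambda> (E i) w)))"
    by (rule indep_vars_lebesgue_integral[OF _ ind]) (simp, rule integrable_exp_i,
        rule \<Lambda>_measurable, rule ES)
  also have "\<dots> = (\<Prod>i<n. chf (\<Lambda> (D i)) (s * c i))"
    unfolding chf_def by (intro prod.cong) (auto simp: E_def)
  finally show ?thesis .
qed

lemma simple_repD:
  assumes "simple_rep S n B" shows "i < n \<Longrightarrow> B i \<in> S" "disjoint_family_on B {..<n}"
  using assms by (auto simp: simple_rep_def)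

lemma simple_rep_Int:
  assumes "simple_rep S n B" "P \<in> S" shows "simple_rep S n (\<lambda>i. P \<inter> B i)"
  using assms by (auto simp: simple_rep_def disjoint_family_on_def)

abbreviation SI :: "nat \<Rightarrow> (nat \<Rightarrow> real) \<Rightarrow> (nat \<Rightarrow> 'x set) \<Rightarrow> 'x set \<Rightarrow> 'w \<Rightarrow> real" where
  "SI \<equiv> simple_stoch_integral \<Lambda>"

lemma SI_measurable [measurable (raw)]:
  assumes "simple_rep S n B" "P \<in> S" shows "SI n a B P \<in> borel_measurable M"
  unfolding simple_stoch_integral_def[abs_def]
  using assms by (intro borel_measurable_sum borel_measurable_times borel_measurable_const
      \<Lambda>_measurable)
    (auto dest: simple_repD)

lemma SI_space: assumes "simple_rep S n B" shows "SI n a B (space \<mu>) = (\<lambda>w. \<Sum>i<n. a i * \<Lambda> (B i) w)"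
proof -
  have "space \<mu> \<inter> B i = B i" if "i < n" for i
    using simple_repD(1)[OF assms that] S_subset_space by auto
  then show ?thesis by (auto simp: simple_stoch_integral_def)
qed

lemma SI_space_measurable [measurable (raw)]:
  assumes "simple_rep S n B" shows "SI n a B (space \<mu>) \<in> borel_measurable M"
  unfolding SI_space[OF assms]
  using assms by (intro borel_measurable_sum borel_measurable_times borel_measurable_const
      \<Lambda>_measurable)
    (auto dest: simple_repD)

lemma SI_Un:
  assumes B: "simple_rep S n B" and P: "P \<in> S" and Q: "Q \<in> S" and disj: "P \<inter> Q = {}"
  shows "AE w in M. SI n a B (P \<union> Q) w = SI n a B P w + SI n a B Q w"
proof -
  have "AE w in M. \<Lambda> ((P \<union> Q) \<inter> B i) w = \<Lambda> (P \<inter> B i) w + \<Lambda> (Q \<inter> B i) w" if "i < n" for i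
    unfolding Int_Un_distrib2 using simple_repD(1)[OF B that] P Q disj by (intro \<Lambda>_Un) auto
  then have "AE w in M. \<forall>i\<in>{..<n}. \<Lambda> ((P \<union> Q) \<inter> B i) w = \<Lambda> (P \<inter> B i) w + \<Lambda> (Q \<inter> B i) w"
    by (subst AE_finite_all) auto
  then show ?thesis
    by eventually_elim (simp add: simple_stoch_integral_def sum.distrib[symmetric] distrib_left)
qed

lemma SI_exhausting_limit:
  assumes A: "exhausting A" and B: "simple_rep S n B"
  shows "AE w in M. (\<lambda>m. SI n a B (A m) w) \<longlonglongrightarrow> SI n a B (space \<mu>) w"
proof -
  have "AE w in M. (\<lambda>m. \<Lambda> (A m \<inter> B i) w) \<longlonglongrightarrow> \<Lambda> (B i) w" if "i < n" for i
    using A simple_repD(1)[OF B that] by (rule \<Lambda>_exhausting_limit)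
  then have "AE w in M. \<forall>i\<in>{..<n}. (\<lambda>m. \<Lambda> (A m \<inter> B i) w) \<longlonglongrightarrow> \<Lambda> (B i) w"
    by (subst AE_finite_all) auto
  then show ?thesis
    unfolding SI_space[OF B]
    by eventually_elim (auto simp: simple_stoch_integral_def intro!: tendsto_intros)
qed

lemma exhausting_in_S: "exhausting A \<Longrightarrow> A m \<in> S"
  by (auto simp: exhausting_def)

lemma exhausting_mono: "exhausting A \<Longrightarrow> m \<le> n \<Longrightarrow> A m \<subseteq> A n"
  by (auto simp: exhausting_def incseq_def)

lemma SI_Diff:
  assumes A: "exhausting A" and B: "simple_rep S n B" and "p \<le> m"
  shows "AE w in M. SI n a B (A m) w = SI n a B (A p) w + SI n a B (A m - A p) w"
proof -
  have "A p \<union> (A m - A p) = A m" using exhausting_mono[OF A \<open>p \<le> m\<close>] by auto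
  then show ?thesis using SI_Un[OF B exhausting_in_S[OF A, of p], of
      "A m - A p" a] exhausting_in_S[OF A] by auto
qed

text \<open>
  Integrals over disjoint sets are independent, even if they belong to different simple
  functions, because all the sets involved form one disjoint family.
\<close>
lemma chf_SI_add:
  assumes B: "simple_rep S n B" and B': "simple_rep S n' B'" and P: "P \<in> S" and Q: "Q \<in> S" and PQ:
      "P \<inter> Q = {}"
  shows "chf (\<lambda>w. SI n a B P w + SI n' a' B' Q w) s = chf (SI n a B P) s * chf (SI n' a' B' Q) s"
proof -
  define D where "D i = (if i < n then P \<inter> B i else Q \<inter> B' (i - n))" for i
  define c where "c i = (if i < n then a i else a' (i - n))" for i
  have DS: "D i \<in> S" if "i < n + n'" for i
    using that P Q simple_repD(1)[OF B] simple_repD(1)[OF B'] by (auto simp: D_def)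
  have "disjoint_family_on D {..<n + n'}"
    unfolding disjoint_family_on_def
  proof (intro ballI impI)
    fix i j assume ij: "i \<in> {..<n + n'}" "j \<in> {..<n + n'}" "i \<noteq> j"
    consider "i < n" "j < n" | "i < n" "n \<le> j" | "n \<le> i" "j < n" | "n \<le> i" "n \<le> j" by linarith
    then show "D i \<inter> D j = {}"
    proof cases
      case 1
      then have "B i \<inter> B j = {}" using ij by (intro disjoint_family_onD[OF simple_repD(2)[OF B]])
          auto
      with 1 show ?thesis by (auto simp: D_def)
    next
      case 4
      then have "i - n \<in> {..<n'}" "j - n \<in> {..<n'}" "i - n \<noteq> j - n" using ij by auto
      then have "B' (i - n) \<inter> B' (j - n) = {}"
          by (intro disjoint_family_onD[OF simple_repD(2)[OF B']]) auto
      with 4 show ?thesis by (auto simp: D_def)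
    qed (use PQ in \<open>auto simp: D_def\<close>)
  qed
  from chf_sum_indep[OF DS this, of c s]
  have "chf (\<lambda>w. \<Sum>i<n + n'. c i * \<Lambda> (D i) w) s = (\<Prod>i<n + n'. chf (\<Lambda> (D i)) (s * c i))" by simp
  moreover have "(\<Sum>i<n + n'. c i * \<Lambda> (D i) w) = SI n a B P w + SI n' a' B' Q w" for w
    unfolding sum_lessThan_add by (simp add: simple_stoch_integral_def c_def D_def)
  moreover have "chf (SI n a B P) s = (\<Prod>i<n. chf (\<Lambda> (D i)) (s * c i))"
    using chf_sum_indep[OF simple_repD[OF simple_rep_Int[OF B P]], of a s]
    by (simp add: simple_stoch_integral_def[abs_def] c_def D_def)
  moreover have "chf (SI n' a' B' Q) s = (\<Prod>i<n'. chf (\<Lambda> (D (n + i))) (s * c (n + i)))"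
    using chf_sum_indep[OF simple_repD[OF simple_rep_Int[OF B' Q]], of a' s]
    by (simp add: simple_stoch_integral_def[abs_def] c_def D_def)
  ultimately show ?thesis by (simp add: prod_lessThan_add)
qed

lemma norm_chf_SI:
  assumes B: "simple_rep S n B" and P: "P \<in> S" "emeasure \<mu> P < \<infinity>"
  shows "cmod (chf (SI n a B P) s) = exp (- (\<Sum>i<n. measure \<mu> (P \<inter> B i) * psi (s * a i)))"
proof -
  have fin: "emeasure \<mu> (P \<inter> B i) < \<infinity>" for i
    using P emeasure_mono[of "P \<inter> B i" P \<mu>] by (auto intro: S_sets le_less_trans)
  have "chf (SI n a B P) s = (\<Prod>i<n. chf (\<Lambda> (P \<inter> B i)) (s * a i))"
    using chf_sum_indep[OF simple_repD[OF simple_rep_Int[OF B P(1)]], of a s]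
    by (simp add: simple_stoch_integral_def[abs_def])
  then have "cmod (chf (SI n a B P) s) = (\<Prod>i<n. cmod (chf (\<Lambda> (P \<inter> B i)) (s * a i)))"
    by (simp add: prod_norm)
  also have "\<dots> = (\<Prod>i<n. exp (- (measure \<mu> (P \<inter> B i) * psi (s * a i))))"
  proof (intro prod.cong refl)
    fix i assume "i \<in> {..<n}"
    then have "P \<inter> B i \<in> S" using simple_repD(1)[OF simple_rep_Int[OF B P(1)]] by auto
    then show "cmod (chf (\<Lambda> (P \<inter> B i)) (s * a i)) = exp (- (measure \<mu> (P \<inter> B i) * psi (s * a i)))"
      using fin[of i] by (simp add: chf_\<Lambda> psi_def)
  qed
  also have "\<dots> = exp (- (\<Sum>i<n. measure \<mu> (P \<inter> B i) * psi (s * a i)))"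
    by (simp add: exp_sum sum_negf[symmetric])
  finally show ?thesis .
qed

lemma nn_integral_psi_simple_fun:
  assumes B: "simple_rep S n B" and P: "P \<in> S" "emeasure \<mu> P < \<infinity>"
  shows "(\<integral>\<^sup>+x\<in>P. ennreal (psi (s * simple_fun n a B x)) \<partial>\<mu>)
      = ennreal (\<Sum>i<n. measure \<mu> (P \<inter> B i) * psi (s * a i))"
proof -
  have fin: "emeasure \<mu> (P \<inter> B i) < \<infinity>" for i
    using P emeasure_mono[of "P \<inter> B i" P \<mu>] by (auto intro: S_sets le_less_trans)
  have meas: "P \<inter> B i \<in> sets \<mu>" if "i < n" for i
    using simple_repD(1)[OF simple_rep_Int[OF B P(1)] that] by (rule S_sets)
  have "(\<integral>\<^sup>+x\<in>P. ennreal (psi (s * simple_fun n a B x)) \<partial>\<mu>)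
      = (\<integral>\<^sup>+x. (\<Sum>i<n. ennreal (psi (s * a i)) * indicator (P \<inter> B i) x) \<partial>\<mu>)"
  proof (intro nn_integral_cong)
    fix x
    have eq: "psi (s * simple_fun n a B x) = (\<Sum>i<n. psi (s * a i) * indicator (B i) x)"
      by (rule simple_fun_compose[OF simple_repD(2)[OF B]]) simp
    show "ennreal (psi (s * simple_fun n a B x)) * indicator P x
        = (\<Sum>i<n. ennreal (psi (s * a i)) * indicator (P \<inter> B i) x)"
    proof (cases "x \<in> P")
      case True
      have "ennreal (\<Sum>i<n. psi (s * a i) * indicator (B i) x)
          = (\<Sum>i<n. ennreal (psi (s * a i) * indicator (B i) x))"
        by (rule sum_ennreal[symmetric]) (simp add: psi_nonneg)
      also have "\<dots> = (\<Sum>i<n. ennreal (psi (s * a i)) * indicator (P \<inter> B i) x)"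
        using True by (intro sum.cong refl) (auto split: split_indicator)
      finally show ?thesis using True eq by simp
    qed simp
  qed
  also have "\<dots> = (\<Sum>i<n. ennreal (psi (s * a i)) * emeasure \<mu> (P \<inter> B i))"
    using meas by (subst nn_integral_sum) (auto simp: nn_integral_cmult_indicator)
  also have "\<dots> = (\<Sum>i<n. ennreal (measure \<mu> (P \<inter> B i) * psi (s * a i)))"
    using fin by (intro sum.cong refl) (simp add: emeasure_eq_ennreal_measure less_top ennreal_mult'
        mult.commute)
  also have "\<dots> = ennreal (\<Sum>i<n. measure \<mu> (P \<inter> B i) * psi (s * a i))"
    by (rule sum_ennreal) (simp add: psi_nonneg)
  finally show ?thesis .
qed

end

section \<open>Exhaustion by level sets and the variance bound\<close>

context scattered_measure begin

text \<open>
  The level sets \<open>{f\<^sub>m > c}\<close> with \<open>c > 0\<close> of simple functions are in the ring, hence so are the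
  sets where all \<open>f\<^sub>m\<close> with \<open>m \<ge> k\<close> lie above \<open>1 / (k + 1)\<close> and not above \<open>k + 1\<close>. A positive
  limit \<open>f\<close> lies eventually between these bounds, and \<open>f \<ge> 1 / (k + 1)\<close> on the \<open>k\<close>-th set makes
  its measure finite when \<open>f\<close> is integrable.
\<close>
lemma exhausting_level_sets:
  fixes f :: "'x \<Rightarrow> real"
  assumes rep: "\<And>k. simple_rep S (n k) (B k)"
    and lim: "AE x in \<mu>. (\<lambda>k. simple_fun (n k) (a k) (B k) x) \<longlonglongrightarrow> f x"
    and pos: "\<And>x. x \<in> space \<mu> \<Longrightarrow> 0 < f x"
    and f[measurable]: "f \<in> borel_measurable \<mu>" and fin: "(\<integral>\<^sup>+x. ennreal (f x) \<partial>\<mu>) < \<infinity>"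
  obtains A where "exhausting A" "\<And>k. emeasure \<mu> (A k) < \<infinity>"
    "\<And>k m x. x \<in> A k \<Longrightarrow> k \<le> m \<Longrightarrow> \<bar>simple_fun (n m) (a m) (B m) x\<bar> \<le> real (Suc k)"
proof -
  define g where "g k = simple_fun (n k) (a k) (B k)" for k
  have lim_g: "AE x in \<mu>. (\<lambda>k. g k x) \<longlonglongrightarrow> f x" using lim by (simp add: g_def)
  define L where "L c k = {x \<in> space \<mu>. c < g k x}" for c k
  have LS: "L c k \<in> S" if "c > 0" for c k
  proof -
    have "L c k = (\<Union>i\<in>{i\<in>{..<n k}. c < a k i}. B k i)"
    proof (intro set_eqI iffI)
      fix x assume x: "x \<in> L c k"
      then have "g k x > 0" "c < g k x" using that by (auto simp: L_def)
      define h where "h y = (if c < y then 1 else 0 :: real)" for y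
      have h0: "h 0 = 0" using that by (simp add: h_def)
      have "h (g k x) = (\<Sum>i<n k. h (a k i) * indicator (B k i) x)"
        unfolding g_def by (rule simple_fun_compose[of "B k" "n k" h "a k" x,
            OF simple_repD(2)[OF rep] h0])
      with \<open>c < g k x\<close> have "(\<Sum>i<n k. h (a k i) * indicator (B k i) x) \<noteq> 0" by (simp add: h_def)
      then obtain i where "i \<in> {..<n k}" "h (a k i) * indicator (B k i) x \<noteq> 0"
        by (rule sum.not_neutral_contains_not_neutral)
      then show "x \<in> (\<Union>i\<in>{i\<in>{..<n k}. c < a k i}. B k i)"
          by (auto simp: h_def indicator_def split: if_splits)
    next
      fix x assume "x \<in> (\<Union>i\<in>{i\<in>{..<n k}. c < a k i}. B k i)"
      then obtain i where i: "i < n k" "c < a k i" "x \<in> B k i" by auto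
      define h where "h y = (if c < y then 1 else 0 :: real)" for y
      have h0: "h 0 = 0" using that by (simp add: h_def)
      have "h (g k x) = (\<Sum>i<n k. h (a k i) * indicator (B k i) x)"
        unfolding g_def by (rule simple_fun_compose[of "B k" "n k" h "a k" x,
            OF simple_repD(2)[OF rep] h0])
      also have "\<dots> \<ge> (\<Sum>i\<in>{i}. h (a k i) * indicator (B k i) x)"
        using i by (intro sum_mono2) (auto simp: h_def)
      finally have "h (g k x) \<ge> 1" using i by (simp add: h_def)
      then have "c < g k x" by (simp add: h_def split: if_splits)
      then show "x \<in> L c k" using i S_subset_space[OF simple_repD(1)[OF rep i(1)]]
          by (auto simp: L_def)
    qed
    also have "\<dots> \<in> S" using simple_repD(1)[OF rep] by (intro ring.finite_UN) auto
    finally show ?thesis .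
  qed
  define A where "A k = (\<Inter>m. L (1 / real (Suc k)) (k + m) - L (real (Suc k)) (k + m))" for k
  have AS: "A k \<in> S" for k unfolding A_def by (intro S_INT ring.Diff LS) auto
  have A_iff: "x \<in> A k \<longleftrightarrow> x \<in> space \<mu> \<and> (\<forall>m\<ge>k. 1 / real (Suc k) < g m x \<and> g m x \<le> real (Suc k))"
      for x k
  proof
    assume "x \<in> A k"
    then have *: "\<And>m. x \<in> L (1 / real (Suc k)) (k + m) - L (real (Suc k)) (k + m)" unfolding A_def
        by blast
    have "1 / real (Suc k) < g m x \<and> g m x \<le> real (Suc k)" if "m \<ge> k" for m
      using *[of "m - k"] that by (auto simp: L_def)
    with *[of 0] show "x \<in> space \<mu> \<and> (\<forall>m\<ge>k. 1 / real (Suc k) < g m x \<and> g m x \<le> real (Suc k))"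
      by (auto simp: L_def)
  next
    assume "x \<in> space \<mu> \<and> (\<forall>m\<ge>k. 1 / real (Suc k) < g m x \<and> g m x \<le> real (Suc k))"
    then show "x \<in> A k" unfolding A_def by (auto simp: L_def not_less)
  qed
  have "incseq A"
  proof (rule incseq_SucI, rule subsetI)
    fix k x assume x: "x \<in> A k"
    have "1 / real (Suc (Suc k)) \<le> 1 / real (Suc k)" by (intro divide_left_mono) auto
    moreover have "real (Suc k) \<le> real (Suc (Suc k))" by simp
    ultimately show "x \<in> A (Suc k)" using x unfolding A_iff
        by (meson Suc_leD le_less_trans order_trans)
  qed
  moreover have "AE x in \<mu>. \<exists>k. x \<in> A k"
    using lim_g AE_space
  proof eventually_elim
    case (elim x)
    have fx: "f x > 0" using pos elim by simp
    obtain k1 :: nat where k1: "2 / f x < real k1" using reals_Archimedean2 by blast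
    obtain k2 :: nat where k2: "2 * f x < real k2" using reals_Archimedean2 by blast
    have "\<forall>\<^sub>F m in sequentially. f x / 2 < g m x" using elim(1) fx by (intro order_tendstoD(1)) auto
    moreover have "\<forall>\<^sub>F m in sequentially. g m x < 2 * f x" using elim(1) fx
        by (intro order_tendstoD(2)) auto
    ultimately have "\<forall>\<^sub>F m in sequentially. f x / 2 < g m x \<and> g m x < 2 * f x"
        by (rule eventually_conj)
    then obtain k3 where k3: "\<And>m. m \<ge> k3 \<Longrightarrow> f x / 2 < g m x \<and> g m x < 2 * f x"
        by (auto simp: eventually_sequentially)
    \<comment> \<open>from index k on the values are within a factor 2 of the limit,
        and k exceeds 2 / f x and 2 f x\<close>
    define k where "k = max k1 (max k2 k3)"
    have kk: "2 / f x < real (Suc k)" "2 * f x < real (Suc k)" using k1 k2 by (auto simp: k_def)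
    have "1 / real (Suc k) < f x / 2" using kk(1) fx by (simp add: field_simps del: of_nat_Suc)
    then have "x \<in> A k" unfolding A_iff using elim(2) k3 kk(2) by (fastforce simp: k_def)
    then show ?case by blast
  qed
  ultimately have exh: "exhausting A" using AS by (auto simp: exhausting_def)
  have finA: "emeasure \<mu> (A k) < \<infinity>" for k
  proof -
    have [measurable]: "A k \<in> sets \<mu>" using AS by (rule S_sets)
    have "emeasure \<mu> (A k) = (\<integral>\<^sup>+x. indicator (A k) x \<partial>\<mu>)" by simp
    also have "\<dots> \<le> (\<integral>\<^sup>+x. ennreal (real (Suc k)) * ennreal (f x) \<partial>\<mu>)"
    proof (rule nn_integral_mono_AE)
      show "AE x in \<mu>. indicator (A k) x \<le> ennreal (real (Suc k)) * ennreal (f x)"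
        using lim_g
      proof eventually_elim
        case (elim x)
        show ?case
        proof (cases "x \<in> A k")
          case True
          then have "1 / real (Suc k) \<le> f x"
            using elim unfolding A_iff by (intro LIMSEQ_le_const[OF elim]) (auto intro!:
                exI[of _ k] less_imp_le)
          then have "1 \<le> real (Suc k) * f x" by (simp add: field_simps del: of_nat_Suc)
          then have "ennreal 1 \<le> ennreal (real (Suc k) * f x)" by (rule ennreal_leI)
          then show ?thesis using True by (simp add: ennreal_mult')
        qed simp
      qed
    qed
    also have "\<dots> = ennreal (real (Suc k)) * (\<integral>\<^sup>+x. ennreal (f x) \<partial>\<mu>)"
        by (rule nn_integral_cmult) measurable
    also have "\<dots> < \<infinity>" using fin by (simp add: ennreal_mult_less_top del: of_nat_Suc)
    finally show ?thesis .
  qed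
  have "\<bar>simple_fun (n m) (a m) (B m) x\<bar> \<le> real (Suc k)" if "x \<in> A k" "k \<le> m" for k m x
  proof -
    have "1 / real (Suc k) < g m x" "g m x \<le> real (Suc k)" using that unfolding A_iff by auto
    moreover have "0 < 1 / real (Suc k)" by simp
    ultimately show ?thesis unfolding g_def[symmetric] by linarith
  qed
  with exh finA that show thesis by blast
qed

text \<open>
  The integral over the whole space is the sum of the integral over \<open>A p\<close> and an independent
  remainder, and characteristic functions are bounded by 1.
\<close>
lemma chf_bound_SI:
  assumes A: "exhausting A" and rep: "simple_rep S n B"
  shows "cmod (chf (SI n a B (space \<mu>)) s) \<le> cmod (chf (SI n a B (A p)) s)"
proof -
  have "cmod (chf (SI n a B (A m)) s) \<le> cmod (chf (SI n a B (A p)) s)" if "p \<le> m" for m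
  proof -
    have S: "A p \<in> S" "A m - A p \<in> S" using exhausting_in_S[OF A] by auto
    have "chf (SI n a B (A m)) s = chf (\<lambda>w. SI n a B (A p) w + SI n a B (A m - A p) w) s"
      unfolding chf_def using SI_Diff[OF A rep that, of a] rep exhausting_in_S[OF A] S
      by (intro integral_cong_AE) (auto elim: eventually_mono)
    also have "\<dots> = chf (SI n a B (A p)) s * chf (SI n a B (A m - A p)) s"
      using S by (intro chf_SI_add rep) auto
    finally have "cmod (chf (SI n a B (A m)) s)
        = cmod (chf (SI n a B (A p)) s) * cmod (chf (SI n a B (A m - A p)) s)"
      by (simp add: norm_mult)
    also have "\<dots> \<le> cmod (chf (SI n a B (A p)) s) * 1"
      using rep S by (intro mult_left_mono norm_chf_le_1) auto
    finally show ?thesis by simp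
  qed
  moreover have "(\<lambda>m. cmod (chf (SI n a B (A m)) s)) \<longlonglongrightarrow> cmod (chf (SI n a B (space \<mu>)) s)"
    using rep exhausting_in_S[OF A] by (intro tendsto_norm chf_tendsto SI_exhausting_limit[OF A
        rep]) auto
  ultimately show ?thesis by (intro LIMSEQ_le_const2) auto
qed

lemma cmod_chf_ge:
  assumes Y: "Y \<in> borel_measurable M" and Y2: "integrable M (\<lambda>w. (Y w)\<^sup>2)"
  shows "1 - s\<^sup>2 / 2 * (LINT w|M. (Y w)\<^sup>2) \<le> cmod (chf Y s)"
proof -
  have "(LINT w|M. 1 - s\<^sup>2 / 2 * (Y w)\<^sup>2) \<le> (LINT w|M. Re (exp (\<i> * of_real (s * Y w))))"
  proof (rule integral_mono)
    show "integrable M (\<lambda>w. 1 - s\<^sup>2 / 2 * (Y w)\<^sup>2)"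
      by (intro Bochner_Integration.integrable_diff integrable_const integrable_mult_right Y2)
    show "integrable M (\<lambda>w. Re (exp (\<i> * of_real (s * Y w))))"
        by (intro integrable_Re integrable_exp_i Y)
    show "1 - s\<^sup>2 / 2 * (Y w)\<^sup>2 \<le> Re (exp (\<i> * of_real (s * Y w)))" for w
      using one_minus_cos_le[of "s * Y w"] by (simp add: Re_exp power_mult_distrib)
  qed
  also have "\<dots> = Re (chf Y s)" unfolding chf_def by (rule integral_Re[OF integrable_exp_i[OF Y]])
  also have "\<dots> \<le> cmod (chf Y s)" by (rule complex_Re_le_cmod)
  finally show ?thesis using Y2 by (simp add: prob_space)
qed

text \<open>
  Over \<open>A p\<close> the integral of \<open>\<psi>(s f\<^sub>k)\<close> is minus the logarithm of the modulus of a
  characteristic function that dominates the one of the integral over the whole space. Fatou's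
  lemma for \<open>k \<rightarrow> \<infinity>\<close> and monotone convergence for \<open>p \<rightarrow> \<infinity>\<close> bound the integral of \<open>\<psi>(s f)\<close> by \<open>- ln
  |\<phi>\<^sub>Y(s)|\<close>. The condition on \<open>s\<close> keeps \<open>|\<phi>\<^sub>Y(s)|\<close> above \<open>1/2\<close>.
\<close>
lemma nn_integral_psi_le:
  fixes f :: "'x \<Rightarrow> real"
  assumes rep: "\<And>k. simple_rep S (n k) (B k)"
    and lim: "AE x in \<mu>. (\<lambda>k. simple_fun (n k) (a k) (B k) x) \<longlonglongrightarrow> f x"
    and A: "exhausting A" and fin: "\<And>k. emeasure \<mu> (A k) < \<infinity>"
    and f[measurable]: "f \<in> borel_measurable \<mu>"
    and Y: "Y \<in> borel_measurable M"
    and limY: "AE w in M. (\<lambda>k. SI (n k) (a k) (B k) (space \<mu>) w) \<longlonglongrightarrow> Y w"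
    and Y2: "integrable M (\<lambda>w. (Y w)\<^sup>2)"
    and s: "s\<^sup>2 * (LINT w|M. (Y w)\<^sup>2) \<le> 1"
  shows "(\<integral>\<^sup>+x. ennreal (psi (s * f x)) \<partial>\<mu>) \<le> ennreal (s\<^sup>2 * (LINT w|M. (Y w)\<^sup>2))"
proof -
  define v where "v = (LINT w|M. (Y w)\<^sup>2)"
  have v: "0 \<le> v" by (simp add: v_def)
  define c where "c k = cmod (chf (SI (n k) (a k) (B k) (space \<mu>)) s)" for k
  define c0 where "c0 = cmod (chf Y s)"
  have c0: "1 / 2 \<le> c0" "1 - s\<^sup>2 / 2 * v \<le> c0"
    using cmod_chf_ge[OF Y Y2, of s] s by (auto simp: v_def c0_def)
  have "c \<longlonglongrightarrow> c0"
    unfolding c_def c0_def using rep Y by (intro tendsto_norm chf_tendsto limY) auto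
  then have lnc: "(\<lambda>k. - ln (c k)) \<longlonglongrightarrow> - ln c0" using c0 by (intro tendsto_intros) auto
  have ev: "\<forall>\<^sub>F k in sequentially. 0 < c k"
    using \<open>c \<longlonglongrightarrow> c0\<close> c0 by (intro order_tendstoD(1)) auto
  have lnc0: "- ln c0 \<le> s\<^sup>2 * v"
  proof -
    define q where "q = s\<^sup>2 / 2 * v"
    have q: "0 \<le> q" "q \<le> 1 / 2" "1 - q \<le> c0" using v s c0 by (auto simp: v_def q_def)
    have "- q - 2 * q\<^sup>2 \<le> ln (1 - q)" by (rule ln_one_minus_pos_lower_bound[OF q(1,2)])
    also have "\<dots> \<le> ln c0" using c0 q by (intro ln_mono) auto
    finally have "- q - 2 * q\<^sup>2 \<le> ln c0" .
    moreover have "2 * q * q \<le> 2 * q * (1 / 2)" using q by (intro mult_left_mono) auto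
    ultimately have "- ln c0 \<le> q + q" unfolding power2_eq_square by linarith
    then show ?thesis by (simp add: q_def mult.commute)
  qed
  have part: "(\<integral>\<^sup>+x\<in>A p. ennreal (psi (s * f x)) \<partial>\<mu>) \<le> ennreal (- ln c0)" for p
  proof -
    have AS: "A p \<in> S" by (rule exhausting_in_S[OF A])
    have [measurable]: "A p \<in> sets \<mu>" by (rule S_sets[OF AS])
    have [measurable]: "simple_fun (n k) (a k) (B k) \<in> borel_measurable \<mu>" for k
      by (rule simple_fun_measurable) (rule S_sets, rule simple_repD(1)[OF rep])
    have "(\<integral>\<^sup>+x\<in>A p. ennreal (psi (s * f x)) \<partial>\<mu>) =
        (\<integral>\<^sup>+x. liminf (\<lambda>k. ennreal (psi (s * simple_fun (n k) (a k) (B k) x)) * indicator (A p) x)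
            \<partial>\<mu>)"
    proof (rule nn_integral_cong_AE)
      show "AE x in \<mu>. ennreal (psi (s * f x)) * indicator (A p) x =
          liminf (\<lambda>k. ennreal (psi (s * simple_fun (n k) (a k) (B k) x)) * indicator (A p) x)"
        using lim
      proof eventually_elim
        case (elim x)
        have "(\<lambda>k. ennreal (psi (s * simple_fun (n k) (a k) (B k) x)) * indicator (A p) x)
            \<longlonglongrightarrow> ennreal (psi (s * f x)) * indicator (A p) x"
        proof (cases "x \<in> A p")
          case True
          then show ?thesis by (simp, intro tendsto_ennrealI psi_tendsto tendsto_intros elim)
        qed simp
        then show ?case by (intro lim_imp_Liminf[symmetric]) auto
      qed
    qed
    also have "\<dots> \<le> liminf (\<lambda>k. \<integral>\<^sup>+x\<in>A p. ennreal (psi (s * simple_fun (n k) (a k) (B k) x)) \<partial>\<mu>)"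
      by (rule nn_integral_liminf) measurable
    also have "\<dots> \<le> liminf (\<lambda>k. ennreal (- ln (c k)))"
    proof (rule Liminf_mono)
      show "\<forall>\<^sub>F k in sequentially. (\<integral>\<^sup>+x\<in>A p. ennreal (psi (s * simple_fun (n k) (a k) (B k) x)) \<partial>\<mu>)
          \<le> ennreal (- ln (c k))"
        using ev
      proof eventually_elim
        case (elim k)
        define Q where "Q = (\<Sum>i<n k. measure \<mu> (A p \<inter> B k i) * psi (s * a k i))"
        have "c k \<le> cmod (chf (SI (n k) (a k) (B k) (A p)) s)"
          unfolding c_def by (rule chf_bound_SI[OF A rep])
        also have "\<dots> = exp (- Q)" unfolding Q_def by (rule norm_chf_SI[OF rep AS fin])
        finally have "ln (c k) \<le> - Q" using elim ln_mono[of "c k" "exp (- Q)"] by simp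
        then show ?case
          unfolding nn_integral_psi_simple_fun[OF rep AS fin] Q_def by (intro ennreal_leI) simp
      qed
    qed
    also have "\<dots> = ennreal (- ln c0)"
      by (intro lim_imp_Liminf tendsto_ennrealI lnc) simp
    finally show ?thesis .
  qed
  have "(\<integral>\<^sup>+x. ennreal (psi (s * f x)) \<partial>\<mu>) = (\<integral>\<^sup>+x.
      (SUP p. ennreal (psi (s * f x)) * indicator (A p) x) \<partial>\<mu>)"
  proof (rule nn_integral_cong_AE)
    have "AE x in \<mu>. \<exists>k. x \<in> A k" using A by (simp add: exhausting_def)
    then show "AE x in \<mu>. ennreal (psi (s * f x))
        = (SUP p. ennreal (psi (s * f x)) * indicator (A p) x)"
    proof eventually_elim
      case (elim x)
      then obtain k where k: "x \<in> A k" by blast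
      show ?case
      proof (rule antisym)
        show "ennreal (psi (s * f x)) \<le> (SUP p. ennreal (psi (s * f x)) * indicator (A p) x)"
          using k by (intro SUP_upper2[of k]) auto
        show "(SUP p. ennreal (psi (s * f x)) * indicator (A p) x) \<le> ennreal (psi (s * f x))"
          by (rule SUP_least) (auto split: split_indicator)
      qed
    qed
  qed
  also have "\<dots> = (SUP p. \<integral>\<^sup>+x\<in>A p. ennreal (psi (s * f x)) \<partial>\<mu>)"
  proof (rule nn_integral_monotone_convergence_SUP)
    show "incseq (\<lambda>p x. ennreal (psi (s * f x)) * indicator (A p) x)"
      using exhausting_mono[OF A] by (auto simp: incseq_def le_fun_def split: split_indicator)
    show "(\<lambda>x. ennreal (psi (s * f x)) * indicator (A p) x) \<in> borel_measurable \<mu>" for p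
    proof -
      have [measurable]: "A p \<in> sets \<mu>" by (rule S_sets[OF exhausting_in_S[OF A]])
      show ?thesis by measurable
    qed
  qed
  also have "\<dots> \<le> ennreal (- ln c0)" using part by (rule SUP_least)
  also have "\<dots> \<le> ennreal (s\<^sup>2 * v)" by (rule ennreal_leI[OF lnc0])
  finally show ?thesis by (simp add: v_def)
qed

text \<open>
  A finite second moment of the integral bounds the variance rate and the square integral of \<open>f\<close>
  jointly. The product is taken in the extended half-line, where \<open>0 \<cdot> \<infinity> = 0\<close>: a vanishing
  variance rate leaves \<open>f\<close> unconstrained.
\<close>
lemma variance_rate_mult_le:
  fixes f :: "'x \<Rightarrow> real"
  assumes rep: "\<And>k. simple_rep S (n k) (B k)"
    and lim: "AE x in \<mu>. (\<lambda>k. simple_fun (n k) (a k) (B k) x) \<longlonglongrightarrow> f x"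
    and A: "exhausting A" and fin: "\<And>k. emeasure \<mu> (A k) < \<infinity>"
    and f[measurable]: "f \<in> borel_measurable \<mu>"
    and Y: "Y \<in> borel_measurable M"
    and limY: "AE w in M. (\<lambda>k. SI (n k) (a k) (B k) (space \<mu>) w) \<longlonglongrightarrow> Y w"
    and Y2: "integrable M (\<lambda>w. (Y w)\<^sup>2)"
  shows "(\<integral>\<^sup>+x. ennreal ((f x)\<^sup>2 / 2) \<partial>\<mu>) * variance_rate \<le> ennreal (LINT w|M. (Y w)\<^sup>2)"
proof -
  define v where "v = (LINT w|M. (Y w)\<^sup>2)"
  have v: "0 \<le> v" by (simp add: v_def)
  let ?q = "\<lambda>k x. ennreal ((real (Suc k))\<^sup>2) * ennreal (psi (f x / real (Suc k)))"
  have "(\<integral>\<^sup>+x. ennreal ((f x)\<^sup>2 / 2) \<partial>\<mu>) * variance_rate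
      = (\<integral>\<^sup>+x. ennreal ((f x)\<^sup>2 / 2) * variance_rate \<partial>\<mu>)"
    by (rule nn_integral_multc[symmetric]) measurable
  also have "\<dots> \<le> (\<integral>\<^sup>+x. liminf (\<lambda>k. ?q k x) \<partial>\<mu>)"
    by (intro nn_integral_mono psi_fatou)
  also have "\<dots> \<le> liminf (\<lambda>k. \<integral>\<^sup>+x. ?q k x \<partial>\<mu>)"
    by (rule nn_integral_liminf) measurable
  also have "\<dots> \<le> liminf (\<lambda>k::nat. ennreal v)"
  proof (rule Liminf_mono)
    obtain N :: nat where N: "v < real N" using reals_Archimedean2 by blast
    show "\<forall>\<^sub>F k in sequentially. (\<integral>\<^sup>+x. ?q k x \<partial>\<mu>) \<le> ennreal v"
      using eventually_ge_at_top[of N]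
    proof eventually_elim
      case (elim k)
      let ?s = "1 / real (Suc k)"
      have "v \<le> real (Suc k)" using N elim by simp
      also have "\<dots> \<le> (real (Suc k))\<^sup>2" by (rule self_le_power) auto
      finally have "?s\<^sup>2 * v \<le> 1" by (simp add: power_divide divide_simps del: of_nat_Suc)
      then have "(\<integral>\<^sup>+x. ennreal (psi (?s * f x)) \<partial>\<mu>) \<le> ennreal (?s\<^sup>2 * v)"
        unfolding v_def by (intro nn_integral_psi_le[OF rep lim A fin f Y limY Y2])
      then have "ennreal ((real (Suc k))\<^sup>2) * (\<integral>\<^sup>+x. ennreal (psi (?s * f x)) \<partial>\<mu>)
          \<le> ennreal ((real (Suc k))\<^sup>2) * ennreal (?s\<^sup>2 * v)"
        by (rule mult_left_mono) simp
      also have "\<dots> = ennreal v"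
        by (subst ennreal_mult'[symmetric]) (auto simp: power_divide simp del: of_nat_Suc)
      finally show ?case by (subst nn_integral_cmult) (auto simp del: of_nat_Suc)
    qed
  qed
  finally show ?thesis by (simp add: Liminf_const v_def)
qed

end

section \<open>Second moments of the random measure\<close>

context prob_space begin

definition cent :: "('a \<Rightarrow> real) \<Rightarrow> 'a \<Rightarrow> real" where "cent Y w = Y w - expectation Y"

lemma cent_measurable [measurable (raw)]: "Y \<in> borel_measurable M \<Longrightarrow> cent Y \<in> borel_measurable M"
  unfolding cent_def[abs_def] by (intro borel_measurable_diff borel_measurable_const)

lemma expectation_cent: "integrable M Y \<Longrightarrow> expectation (cent Y) = 0"
  unfolding cent_def[abs_def] by (simp add: prob_space)

lemma integrable_cent_square:
  assumes "Y \<in> borel_measurable M" "integrable M (\<lambda>w. (Y w)\<^sup>2)"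
      shows "integrable M (\<lambda>w. (cent Y w)\<^sup>2)"
  unfolding cent_def[abs_def] by (rule integrable_square_add(2)) (use assms in auto)

text \<open>
  Variances can be read off the modulus of the characteristic function, where the unknown mean
  cancels: \<open>1 - |\<phi>|\<^sup>2 = (1 - Re \<phi>) (1 + Re \<phi>) - (Im \<phi>)\<^sup>2\<close>, and at \<open>1 / (k + 1)\<close>, multiplied by
  \<open>(k + 1)\<^sup>2\<close>, the two terms tend to the second moment and to the squared mean.
\<close>
lemma chf_variance_limit:
  assumes Y[measurable]: "Y \<in> borel_measurable M" and Y2: "integrable M (\<lambda>w. (Y w)\<^sup>2)"
  shows "(\<lambda>k. (real (Suc k))\<^sup>2 * (1 - (cmod (chf Y (1 / real (Suc k))))\<^sup>2))
      \<longlonglongrightarrow> expectation (\<lambda>w. (cent Y w)\<^sup>2)"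
proof -
  have Y1: "integrable M Y" by (rule square_integrable_imp_integrable[OF Y Y2])
  define \<phi> where "\<phi> k = chf Y (1 / real (Suc k))" for k
  have R: "Re (\<phi> k) = (LINT w|M. cos (Y w / real (Suc k)))" for k
    unfolding \<phi>_def chf_def by (subst integral_Re[OF integrable_exp_i[OF Y], symmetric]) (simp add:
        Re_exp del: of_nat_Suc)
  have I: "Im (\<phi> k) = (LINT w|M. sin (Y w / real (Suc k)))" for k
    unfolding \<phi>_def chf_def by (subst integral_Im[OF integrable_exp_i[OF Y], symmetric]) (simp add:
        Im_exp del: of_nat_Suc)
  have ic: "integrable M (\<lambda>w. cos (Y w / real (Suc k)))" for k
    by (rule integrable_const_bound[where B = 1]) auto
  have "(\<lambda>k. LINT w|M. (real (Suc k))\<^sup>2 * (1 - cos (Y w / real (Suc k)))) \<longlonglongrightarrow> (LINT w|M. (Y w)\<^sup>2 / 2)"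
  proof (rule integral_dominated_convergence[where w = "\<lambda>w. (Y w)\<^sup>2 / 2"])
    show "AE w in M. (\<lambda>k. (real (Suc k))\<^sup>2 * (1 - cos (Y w / real (Suc k)))) \<longlonglongrightarrow> (Y w)\<^sup>2 / 2"
      by (intro AE_I2 cos_difference_quotient_tendsto)
    show "AE w in M. norm ((real (Suc k))\<^sup>2 * (1 - cos (Y w / real (Suc k)))) \<le> (Y w)\<^sup>2 / 2" for k
      using cos_difference_quotient_le[of k] by (intro AE_I2) simp
    show "integrable M (\<lambda>w. (Y w)\<^sup>2 / 2)" using Y2 by simp
  qed measurable
  moreover have "(LINT w|M. (real (Suc k))\<^sup>2 * (1 - cos (Y w / real (Suc k))))
      = (real (Suc k))\<^sup>2 * (1 - Re (\<phi> k))" for k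
    unfolding R using ic[of k] by (simp add: prob_space del: of_nat_Suc)
  ultimately have l1: "(\<lambda>k. (real (Suc k))\<^sup>2 * (1 - Re (\<phi> k))) \<longlonglongrightarrow> expectation (\<lambda>w. (Y w)\<^sup>2) / 2"
    by simp
  have "(\<lambda>k. LINT w|M. real (Suc k) * sin (Y w / real (Suc k))) \<longlonglongrightarrow> (LINT w|M. Y w)"
  proof (rule integral_dominated_convergence[where w = "\<lambda>w. \<bar>Y w\<bar>"])
    show "AE w in M. (\<lambda>k. real (Suc k) * sin (Y w / real (Suc k))) \<longlonglongrightarrow> Y w"
      by (intro AE_I2 sin_difference_quotient_tendsto)
    show "AE w in M. norm (real (Suc k) * sin (Y w / real (Suc k))) \<le> \<bar>Y w\<bar>" for k
    proof (rule AE_I2)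
      fix w
      have "real (Suc k) * \<bar>sin (Y w / real (Suc k))\<bar> \<le> real (Suc k) * \<bar>Y w / real (Suc k)\<bar>"
        by (intro mult_left_mono abs_sin_x_le_abs_x) auto
      then show "norm (real (Suc k) * sin (Y w / real (Suc k))) \<le> \<bar>Y w\<bar>"
        by (simp add: abs_mult del: of_nat_Suc)
    qed
    show "integrable M (\<lambda>w. \<bar>Y w\<bar>)" using Y1 by simp
  qed measurable
  then have l2: "(\<lambda>k. real (Suc k) * Im (\<phi> k)) \<longlonglongrightarrow> expectation Y"
    unfolding I by (simp del: of_nat_Suc)
  have "\<phi> \<longlonglongrightarrow> (CLINT w|M. 1)"
    unfolding \<phi>_def chf_def
  proof (rule integral_dominated_convergence[where w = "\<lambda>_. 1"])
    show "AE w in M. (\<lambda>k. exp (\<i> * of_real (1 / real (Suc k) * Y w))) \<longlonglongrightarrow> 1"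
    proof (rule AE_I2)
      fix w
      have "(\<lambda>k. 1 / real (Suc k)) \<longlonglongrightarrow> 0" by (rule LIMSEQ_Suc[OF lim_const_over_n])
      then have "(\<lambda>k. exp (\<i> * of_real (1 / real (Suc k) * Y w))) \<longlonglongrightarrow> exp (\<i> * of_real (0 * Y w))"
        by (intro tendsto_intros)
      then show "(\<lambda>k. exp (\<i> * of_real (1 / real (Suc k) * Y w))) \<longlonglongrightarrow> 1" by simp
    qed
    show "AE w in M. norm (exp (\<i> * of_real (1 / real (Suc k) * Y w))) \<le> 1" for k
      by (simp only: norm_exp_i_times) simp
  qed auto
  then have "\<phi> \<longlonglongrightarrow> 1" by (simp add: prob_space)
  then have l3: "(\<lambda>k. Re (\<phi> k)) \<longlonglongrightarrow> 1" using tendsto_Re[of \<phi> 1] by simp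
  have "(\<lambda>k. (real (Suc k))\<^sup>2 * (1 - Re (\<phi> k)) * (1 + Re (\<phi> k)) - (real (Suc k) * Im (\<phi> k))\<^sup>2) \<longlonglongrightarrow>
      expectation (\<lambda>w. (Y w)\<^sup>2) / 2 * (1 + 1) - (expectation Y)\<^sup>2"
    by (intro tendsto_diff tendsto_mult tendsto_power tendsto_add tendsto_const l1 l2 l3)
  moreover have "(real (Suc k))\<^sup>2 * (1 - Re (\<phi> k)) * (1 + Re (\<phi> k)) - (real (Suc k) * Im (\<phi> k))\<^sup>2 =
      (real (Suc k))\<^sup>2 * (1 - (cmod (\<phi> k))\<^sup>2)" for k
    unfolding cmod_power2 by (simp add: algebra_simps power2_eq_square)
  moreover have "expectation (\<lambda>w. (cent Y w)\<^sup>2) = expectation (\<lambda>w. (Y w)\<^sup>2) - (expectation Y)\<^sup>2"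
    unfolding cent_def using variance_eq[OF Y1 Y2] by simp
  ultimately show ?thesis by (simp add: \<phi>_def)
qed

end

locale scattered_measure_variance = scattered_measure M b W \<mu> S \<Lambda> + levy_triplet_variance b W
  for M :: "'w measure" and b :: real and W :: "real measure" and \<mu> :: "'x measure"
    and S :: "'x set set" and \<Lambda> :: "'x set \<Rightarrow> 'w \<Rightarrow> real"
begin

text \<open>
  By Fatou's lemma it suffices that \<open>1 - Re \<phi>(s) = O(s\<^sup>2)\<close>. With \<open>\<phi> = exp(- p + i q)\<close> and \<open>p \<ge>
  0\<close> this difference is at most \<open>p + q\<^sup>2 / 2\<close>.
\<close>
lemma \<Lambda>_square_integrable:
  assumes A: "A \<in> S" "emeasure \<mu> A < \<infinity>"
  shows "integrable M (\<lambda>w. (\<Lambda> A w)\<^sup>2)"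
proof -
  define a where "a = measure \<mu> A"
  have a: "0 \<le> a" by (simp add: a_def)
  have [measurable]: "\<Lambda> A \<in> borel_measurable M" using A by simp
  define D where "D = a * variance_coeff / 2 + (2 * a * variance_coeff)\<^sup>2 / 2"
  have int: "integrable M (\<lambda>w. 1 - cos (\<Lambda> A w / real (Suc k)))" for k
  proof (rule integrable_const_bound[where B = 2])
    show "AE w in M. norm (1 - cos (\<Lambda> A w / real (Suc k))) \<le> 2"
    proof (rule AE_I2)
      fix w show "norm (1 - cos (\<Lambda> A w / real (Suc k))) \<le> 2"
        using cos_ge_minus_one[of "\<Lambda> A w / real (Suc k)"] cos_le_one[of "\<Lambda> A w / real (Suc k)"]
            by (simp del: of_nat_Suc)
    qed
  qed measurable
  have bound: "(real (Suc k))\<^sup>2 * (LINT w|M. 1 - cos (\<Lambda> A w / real (Suc k))) \<le> D" for k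
  proof -
    let ?s = "1 / real (Suc k)"
    define p where "p = a * psi ?s"
    define q where "q = a * Im (levy_exponent b W ?s)"
    have "p \<ge> 0" using a psi_nonneg by (simp add: p_def)
    have icos: "integrable M (\<lambda>w. cos (\<Lambda> A w / real (Suc k)))"
      by (rule integrable_const_bound[where B = 1]) auto
    have "(LINT w|M. 1 - cos (\<Lambda> A w / real (Suc k))) = 1 - Re (chf (\<Lambda> A) ?s)"
      unfolding chf_def using icos
      by (subst integral_Re[OF integrable_exp_i, symmetric]) (auto simp: Re_exp prob_space simp del:
          of_nat_Suc)
    also have "Re (chf (\<Lambda> A) ?s) = exp (- p) * cos q"
      unfolding chf_\<Lambda>[OF A] by (simp add: Re_exp p_def q_def psi_def a_def)
    also have "1 - exp (- p) * cos q = (1 - exp (- p)) + exp (- p) * (1 - cos q)"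
        by (simp add: algebra_simps)
    also have "\<dots> \<le> p + 1 * (q\<^sup>2 / 2)"
    proof (intro add_mono mult_mono one_minus_cos_le)
      show "1 - exp (- p) \<le> p" using exp_ge_add_one_self[of "- p"] by simp
      show "exp (- p) \<le> 1" using \<open>p \<ge> 0\<close> by simp
    qed auto
    finally have 1: "(LINT w|M. 1 - cos (\<Lambda> A w / real (Suc k))) \<le> p + q\<^sup>2 / 2" by simp
    have "p \<le> a * (variance_coeff / 2 * ?s\<^sup>2)" unfolding p_def using a
        by (intro mult_left_mono psi_le)
    moreover have "q\<^sup>2 \<le> (2 * a * variance_coeff * ?s)\<^sup>2"
    proof -
      have "\<bar>Im (levy_exponent b W ?s)\<bar> \<le> 2 * variance_coeff * \<bar>?s\<bar>"
          by (rule Im_levy_exponent_le) simp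
      from this a have "a * \<bar>Im (levy_exponent b W ?s)\<bar> \<le> a * (2 * variance_coeff * \<bar>?s\<bar>)"
          by (rule mult_left_mono)
      then have "\<bar>q\<bar> \<le> a * (2 * variance_coeff * \<bar>?s\<bar>)"
          unfolding q_def abs_mult abs_of_nonneg[OF a] .
      then have "\<bar>q\<bar> \<le> \<bar>2 * a * variance_coeff * ?s\<bar>" using a variance_coeff_nonneg
          by (simp add: abs_mult mult_ac)
      then show ?thesis by (simp only: abs_le_square_iff)
    qed
    ultimately have "(LINT w|M. 1 - cos (\<Lambda> A w / real (Suc k)))
        \<le> a * (variance_coeff / 2 * ?s\<^sup>2) + (2 * a * variance_coeff * ?s)\<^sup>2 / 2" using 1 by linarith
    also have "\<dots> = D * ?s\<^sup>2"
    proof -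
      have "a * (variance_coeff / 2 * t\<^sup>2) + (2 * a * variance_coeff * t)\<^sup>2 / 2 = D * t\<^sup>2"
          for t :: real
        by (simp add: D_def power_mult_distrib algebra_simps)
      then show ?thesis .
    qed
    finally have "(real (Suc k))\<^sup>2 * (LINT w|M. 1 - cos (\<Lambda> A w / real (Suc k)))
        \<le> (real (Suc k))\<^sup>2 * (D * ?s\<^sup>2)"
      by (rule mult_left_mono) simp
    also have "\<dots> = D" by (simp add: power_divide del: of_nat_Suc)
    finally show ?thesis .
  qed
  have "(\<integral>\<^sup>+w. ennreal ((\<Lambda> A w)\<^sup>2 / 2) \<partial>M) = (\<integral>\<^sup>+w.
      liminf (\<lambda>k. ennreal ((real (Suc k))\<^sup>2 * (1 - cos (\<Lambda> A w / real (Suc k))))) \<partial>M)"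
    by (intro nn_integral_cong lim_imp_Liminf[symmetric] tendsto_ennrealI
        cos_difference_quotient_tendsto) auto
  also have "\<dots> \<le> liminf (\<lambda>k. \<integral>\<^sup>+w. ennreal ((real (Suc k))\<^sup>2 * (1 - cos (\<Lambda> A w / real (Suc k))))
      \<partial>M)"
    by (rule nn_integral_liminf) measurable
  also have "\<dots> \<le> liminf (\<lambda>k::nat. ennreal D)"
  proof (intro Liminf_mono always_eventually allI)
    fix k
    have "(\<integral>\<^sup>+w. ennreal ((real (Suc k))\<^sup>2 * (1 - cos (\<Lambda> A w / real (Suc k)))) \<partial>M)
        = ennreal (LINT w|M. (real (Suc k))\<^sup>2 * (1 - cos (\<Lambda> A w / real (Suc k))))"
      by (intro nn_integral_eq_integral integrable_mult_right int) auto
    also have "\<dots> \<le> ennreal D" using bound[of k] by (intro ennreal_leI) (simp del: of_nat_Suc)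
    finally show "(\<integral>\<^sup>+w. ennreal ((real (Suc k))\<^sup>2 * (1 - cos (\<Lambda> A w / real (Suc k)))) \<partial>M)
        \<le> ennreal D" .
  qed
  finally have "(\<integral>\<^sup>+w. ennreal ((\<Lambda> A w)\<^sup>2 / 2) \<partial>M) \<le> ennreal D" by (simp add: Liminf_const)
  then have "integrable M (\<lambda>w. (\<Lambda> A w)\<^sup>2 / 2)"
    by (intro integrableI_nonneg) (auto intro: le_less_trans)
  then have "integrable M (\<lambda>w. 2 * ((\<Lambda> A w)\<^sup>2 / 2))" by (rule integrable_mult_right)
  moreover have "(\<lambda>w. 2 * ((\<Lambda> A w)\<^sup>2 / 2)) = (\<lambda>w. (\<Lambda> A w)\<^sup>2)" by simp
  ultimately show ?thesis by (simp only:)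
qed

lemma \<Lambda>_integrable:
  assumes A: "A \<in> S" "emeasure \<mu> A < \<infinity>" shows "integrable M (\<Lambda> A)"
  by (rule square_integrable_imp_integrable[OF \<Lambda>_measurable[OF A(1)] \<Lambda>_square_integrable[OF A]])

text \<open>
  Here \<open>|\<phi>|\<^sup>2 = exp (- 2 a \<psi>)\<close> with \<open>a\<close> the measure of \<open>A\<close>, so that the second-order coefficient
  of \<open>\<psi>\<close> determines the variance.
\<close>
lemma \<Lambda>_variance:
  assumes A: "A \<in> S" "emeasure \<mu> A < \<infinity>"
  shows "expectation (\<lambda>w. (cent (\<Lambda> A) w)\<^sup>2) = variance_coeff * measure \<mu> A"
proof -
  define a where "a = measure \<mu> A"
  have a: "0 \<le> a" by (simp add: a_def)
  define p where "p k = 2 * a * psi (1 / real (Suc k))" for k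
  have p0: "0 \<le> p k" for k using a psi_nonneg by (simp add: p_def)
  have norm: "(cmod (chf (\<Lambda> A) (1 / real (Suc k))))\<^sup>2 = exp (- p k)" for k
    unfolding chf_\<Lambda>[OF A] by (simp add: p_def psi_def a_def power2_eq_square exp_add[symmetric] del:
        of_nat_Suc)
  have lp: "(\<lambda>k. (real (Suc k))\<^sup>2 * p k) \<longlonglongrightarrow> variance_coeff * a"
    using tendsto_mult[OF tendsto_const[of "2 * a"] psi_scaled_tendsto] by (simp add: p_def mult_ac)
  have "(\<lambda>k. 1 / real (Suc k)) \<longlonglongrightarrow> 0" by (rule LIMSEQ_Suc[OF lim_const_over_n])
  then have "(\<lambda>k. 2 * a * psi (1 / real (Suc k))) \<longlonglongrightarrow> 2 * a * psi 0"
      by (intro tendsto_intros psi_tendsto)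
  then have p_lim: "p \<longlonglongrightarrow> 0" by (simp add: p_def[abs_def])
  have "(\<lambda>k. (real (Suc k))\<^sup>2 * (1 - exp (- p k))) \<longlonglongrightarrow> variance_coeff * a"
  proof (rule real_tendsto_sandwich[where f = "\<lambda>k. (real (Suc k))\<^sup>2 * p k / (1 + p k)" and h
      = "\<lambda>k. (real (Suc k))\<^sup>2 * p k"])
    show "(\<lambda>k. (real (Suc k))\<^sup>2 * p k) \<longlonglongrightarrow> variance_coeff * a" by (rule lp)
    have "(\<lambda>k. (real (Suc k))\<^sup>2 * p k / (1 + p k)) \<longlonglongrightarrow> variance_coeff * a / (1 + 0)"
        by (intro tendsto_intros lp p_lim) simp
    then show "(\<lambda>k. (real (Suc k))\<^sup>2 * p k / (1 + p k)) \<longlonglongrightarrow> variance_coeff * a" by simp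
    have up: "1 - exp (- p k) \<le> p k" for k using exp_ge_add_one_self[of "- p k"] by simp
    then show "\<forall>\<^sub>F k in sequentially. (real (Suc k))\<^sup>2 * (1 - exp (- p k)) \<le> (real (Suc k))\<^sup>2 * p k"
      by (intro always_eventually allI mult_left_mono) auto
    \<comment> \<open>from \<open>exp p \<ge> 1 + p\<close>\<close>
    have low: "p k / (1 + p k) \<le> 1 - exp (- p k)" for k
    proof -
      have "exp (- p k) \<le> 1 / (1 + p k)"
        using exp_ge_add_one_self[of "p k"] p0[of k] by (simp add: exp_minus divide_simps)
      moreover have "p k / (1 + p k) = 1 - 1 / (1 + p k)" using p0[of k] by (simp add: field_simps)
      ultimately show ?thesis by simp
    qed
    show "\<forall>\<^sub>F k in sequentially. (real (Suc k))\<^sup>2 * p k / (1 + p k)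
        \<le> (real (Suc k))\<^sup>2 * (1 - exp (- p k))"
      using mult_left_mono[OF low, of "(real (Suc k))\<^sup>2" k for k]
          by (intro always_eventually allI) (simp del: of_nat_Suc)
  qed
  moreover have "(\<lambda>k. (real (Suc k))\<^sup>2 * (1 - exp (- p k))) \<longlonglongrightarrow> expectation (\<lambda>w. (cent (\<Lambda> A) w)\<^sup>2)"
    using chf_variance_limit[OF \<Lambda>_measurable[OF A(1)] \<Lambda>_square_integrable[OF A]] unfolding norm .
  ultimately show ?thesis unfolding a_def using LIMSEQ_unique by blast
qed

abbreviation C :: "'x set \<Rightarrow> 'w \<Rightarrow> real" where "C A \<equiv> cent (\<Lambda> A)"

lemma C_square_integrable: "A \<in> S \<Longrightarrow> emeasure \<mu> A < \<infinity> \<Longrightarrow> integrable M (\<lambda>w. (C A w)\<^sup>2)"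
  by (intro integrable_cent_square \<Lambda>_square_integrable) auto

lemma C_mult_integrable:
  assumes "A \<in> S" "emeasure \<mu> A < \<infinity>" "B \<in> S" "emeasure \<mu> B < \<infinity>"
  shows "integrable M (\<lambda>w. C A w * C B w)"
  using assms by (intro integral_Cauchy_Schwarz(1) C_square_integrable) auto

lemma C_disjoint:
  assumes A: "A \<in> S" "emeasure \<mu> A < \<infinity>" and B: "B \<in> S" "emeasure \<mu> B < \<infinity>" and disj: "A \<inter> B = {}"
  shows "expectation (\<lambda>w. C A w * C B w) = 0"
proof -
  define D where "D n = (if n = 0 then A else if n = 1 then B else {})" for n :: nat
  have DS: "D n \<in> S" for n using A B by (simp add: D_def)
  have "disjoint_family D" using disj by (auto simp: D_def disjoint_family_on_def)
  from \<Lambda>_indep[OF DS this] have "indep_vars (\<lambda>_. borel) (\<lambda>n. \<Lambda> (D n)) {0, 1}"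
    by (rule indep_vars_subset) simp
  then have ind: "indep_vars (\<lambda>_. borel) (\<lambda>n w. \<Lambda> (D n) w - expectation (\<Lambda> (D n))) {0, 1}"
    by (rule indep_vars_compose2) measurable
  have fin: "emeasure \<mu> (D n) < \<infinity>" for n using A B by (simp add: D_def)
  have "expectation (\<lambda>w. \<Prod>n\<in>{0, 1}. \<Lambda> (D n) w - expectation (\<Lambda> (D n)))
      = (\<Prod>n\<in>{0, 1}. expectation (\<lambda>w. \<Lambda> (D n) w - expectation (\<Lambda> (D n))))"
    using DS fin by (intro indep_vars_lebesgue_integral[OF _ ind]) (auto intro!: \<Lambda>_integrable)
  also have "\<dots> = 0"
    using expectation_cent[OF \<Lambda>_integrable[OF A]] by (simp add: D_def cent_def[abs_def])
  finally show ?thesis by (simp add: D_def cent_def)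
qed

lemma C_split:
  assumes A: "A \<in> S" "emeasure \<mu> A < \<infinity>" and B: "B \<in> S"
  shows "AE w in M. C A w = C (A \<inter> B) w + C (A - B) w"
proof -
  have f: "emeasure \<mu> (A \<inter> B) < \<infinity>" "emeasure \<mu> (A - B) < \<infinity>"
    using A emeasure_mono[of "A \<inter> B" A \<mu>] emeasure_mono[of "A - B" A \<mu>]
        by (auto intro: S_sets le_less_trans)
  have i: "integrable M (\<Lambda> (A \<inter> B))" "integrable M (\<Lambda> (A - B))" using A B f
      by (auto intro: \<Lambda>_integrable)
  have "A = (A \<inter> B) \<union> (A - B)" by auto
  then have AE: "AE w in M. \<Lambda> A w = \<Lambda> (A \<inter> B) w + \<Lambda> (A - B) w"
    using \<Lambda>_Un[of "A \<inter> B" "A - B"] A B by (auto simp: Un_commute)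
  then have "expectation (\<Lambda> A) = expectation (\<lambda>w. \<Lambda> (A \<inter> B) w + \<Lambda> (A - B) w)"
    using A B by (intro integral_cong_AE borel_measurable_add \<Lambda>_measurable) auto
  also have "\<dots> = expectation (\<Lambda> (A \<inter> B)) + expectation (\<Lambda> (A - B))" using i by simp
  finally have E: "expectation (\<Lambda> A) = expectation (\<Lambda> (A \<inter> B)) + expectation (\<Lambda> (A - B))" .
  show ?thesis using AE by eventually_elim (simp add: cent_def E)
qed

text \<open>
  Both variables share the contribution of \<open>A \<inter> B\<close>; the other parts are independent and centred.
\<close>
lemma C_covariance:
  assumes A: "A \<in> S" "emeasure \<mu> A < \<infinity>" and B: "B \<in> S" "emeasure \<mu> B < \<infinity>"
  shows "expectation (\<lambda>w. C A w * C B w) = variance_coeff * measure \<mu> (A \<inter> B)"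
proof -
  have f: "emeasure \<mu> (A \<inter> B) < \<infinity>" "emeasure \<mu> (A - B) < \<infinity>" "emeasure \<mu> (B - A) < \<infinity>"
    using A B emeasure_mono[of "A \<inter> B" A \<mu>] emeasure_mono[of "A - B" A \<mu>] emeasure_mono[of
        "B - A" B \<mu>]
    by (auto intro: S_sets le_less_trans)
  have s: "A \<inter> B \<in> S" "A - B \<in> S" "B - A \<in> S" using A B by auto
  have "expectation (\<lambda>w. C A w * C B w) =
     expectation (\<lambda>w. (C (A \<inter> B) w)\<^sup>2 + C (A \<inter> B) w * C (B - A) w + C (A - B) w * C (A \<inter> B) w
         + C (A - B) w * C (B - A) w)"
  proof (rule integral_cong_AE)
    show "AE w in M. C A w * C B w = (C (A \<inter> B) w)\<^sup>2 + C (A \<inter> B) w * C (B - A) w + C (A - B) w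
        * C (A \<inter> B) w + C (A - B) w * C (B - A) w"
      using C_split[OF A B(1)] C_split[OF B A(1)]
      by eventually_elim (simp add: algebra_simps power2_eq_square Int_commute)
  qed (use A B s in measurable)
  also have "\<dots> = expectation (\<lambda>w. (C (A \<inter> B) w)\<^sup>2) + expectation (\<lambda>w. C (A \<inter> B) w * C (B - A) w)
      + expectation (\<lambda>w. C (A - B) w * C (A \<inter> B) w) + expectation (\<lambda>w. C (A - B) w * C (B - A) w)"
    using s f by (simp add: C_mult_integrable C_square_integrable)
  also have "\<dots> = variance_coeff * measure \<mu> (A \<inter> B)"
    using s f by (subst C_disjoint, auto)+ (simp add: \<Lambda>_variance)
  finally show ?thesis .
qed

lemma SI_square_integrable:
  assumes B: "simple_rep S n B" and P: "P \<in> S" "emeasure \<mu> P < \<infinity>"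
  shows "integrable M (SI n a B P)" and "cent (SI n a B P) = (\<lambda>w. \<Sum>i<n. a i * C (P \<inter> B i) w)"
    and "integrable M (\<lambda>w. (SI n a B P w)\<^sup>2)"
proof -
  have s: "P \<inter> B i \<in> S" if "i < n" for i using simple_repD(1)[OF simple_rep_Int[OF B P(1)] that] .
  have f: "emeasure \<mu> (P \<inter> B i) < \<infinity>" for i
    using P emeasure_mono[of "P \<inter> B i" P \<mu>] by (auto intro: S_sets le_less_trans)
  show i: "integrable M (SI n a B P)"
    unfolding simple_stoch_integral_def[abs_def] using s f
        by (intro Bochner_Integration.integrable_sum integrable_mult_right \<Lambda>_integrable) auto
  show c: "cent (SI n a B P) = (\<lambda>w. \<Sum>i<n. a i * C (P \<inter> B i) w)"
  proof
    fix w
    have "expectation (SI n a B P) = (\<Sum>i<n. a i * expectation (\<Lambda> (P \<inter> B i)))"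
      unfolding simple_stoch_integral_def[abs_def] using s f
          by (subst Bochner_Integration.integral_sum) (auto intro!: \<Lambda>_integrable)
    then show "cent (SI n a B P) w = (\<Sum>i<n. a i * C (P \<inter> B i) w)"
      by (simp add: cent_def simple_stoch_integral_def right_diff_distrib sum_subtractf)
  qed
  have "integrable M (\<lambda>w. (\<Sum>i<m. a i * \<Lambda> (P \<inter> B i) w)\<^sup>2)" if "m \<le> n" for m
    using that
  proof (induct m)
    case (Suc m)
    have "integrable M (\<lambda>w. (a m * \<Lambda> (P \<inter> B m) w)\<^sup>2)"
      unfolding power_mult_distrib using Suc s f
          by (intro integrable_mult_right \<Lambda>_square_integrable) auto
    then show ?case using Suc s unfolding sum.lessThan_Suc
      by (intro integrable_square_add(1) borel_measurable_sum borel_measurable_times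
          borel_measurable_const \<Lambda>_measurable) auto
  qed simp
  from this[of n] show "integrable M (\<lambda>w. (SI n a B P w)\<^sup>2)"
      by (simp add: simple_stoch_integral_def)
qed

text \<open>
  The integrand that corresponds to integrating a simple function over \<open>P\<close> only. Cutting off to
  sets of finite control measure is what makes simple functions square integrable.
\<close>
definition cut_simple_fun :: "nat \<Rightarrow> (nat \<Rightarrow> real) \<Rightarrow> (nat \<Rightarrow> 'x set) \<Rightarrow> 'x set \<Rightarrow> 'x \<Rightarrow> real" where
  "cut_simple_fun n a B P x = simple_fun n a B x * indicator P x"

lemma cut_simple_fun_eq: "cut_simple_fun n a B P x = (\<Sum>i<n. a i * indicator (P \<inter> B i) x)"
  unfolding cut_simple_fun_def simple_fun_Int[symmetric] by (simp add: simple_fun_def)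

lemma cut_simple_fun_measurable [measurable (raw)]:
  assumes "simple_rep S n B" "P \<in> S" shows "cut_simple_fun n a B P \<in> borel_measurable \<mu>"
  unfolding cut_simple_fun_eq[abs_def] using simple_repD(1)[OF simple_rep_Int[OF assms]]
  by (intro borel_measurable_sum borel_measurable_times borel_measurable_const
      borel_measurable_indicator S_sets) auto

text \<open>
  Bilinear extension of the covariance of the random measure. It is stated for pairs, since the
  two variables of a covariance have different approximating simple functions.
\<close>
lemma SI_isometry:
  assumes B: "simple_rep S n B" and P: "P \<in> S" "emeasure \<mu> P < \<infinity>"
    and B': "simple_rep S n' B'" and P': "P' \<in> S" "emeasure \<mu> P' < \<infinity>"
  shows "integrable \<mu> (\<lambda>x. cut_simple_fun n a B P x * cut_simple_fun n' a' B' P' x)"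
    and "expectation (\<lambda>w. cent (SI n a B P) w * cent (SI n' a' B' P') w)
        = variance_coeff * (LINT x|\<mu>. cut_simple_fun n a B P x * cut_simple_fun n' a' B' P' x)"
proof -
  have s: "P \<inter> B i \<in> S" if "i < n" for i using simple_repD(1)[OF simple_rep_Int[OF B P(1)] that] .
  have s': "P' \<inter> B' i \<in> S" if "i < n'" for i using simple_repD(1)[OF simple_rep_Int[OF B' P'(1)]
      that] .
  have f: "emeasure \<mu> (P \<inter> B i) < \<infinity>" for i
    using P emeasure_mono[of "P \<inter> B i" P \<mu>] by (auto intro: S_sets le_less_trans)
  have f': "emeasure \<mu> (P' \<inter> B' i) < \<infinity>" for i
    using P' emeasure_mono[of "P' \<inter> B' i" P' \<mu>] by (auto intro: S_sets le_less_trans)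
  let ?A = "\<lambda>i j. (P \<inter> B i) \<inter> (P' \<inter> B' j)"
  have fA: "emeasure \<mu> (?A i j) < \<infinity>" for i j
    using P emeasure_mono[of "?A i j" P \<mu>] by (auto intro: S_sets le_less_trans)
  have sA: "?A i j \<in> sets \<mu>" if "i < n" "j < n'" for i j
    using s[OF that(1)] s'[OF that(2)] by (intro S_sets) auto
  have prod: "cut_simple_fun n a B P x * cut_simple_fun n' a' B' P' x
      = (\<Sum>i<n. \<Sum>j<n'. a i * a' j * indicator (?A i j) x)" for x
    unfolding cut_simple_fun_eq sum_product by (intro sum.cong refl) (auto split: split_indicator)
  have iA: "integrable \<mu> (\<lambda>x. a i * a' j * indicator (?A i j) x)" if "i < n" "j < n'" for i j
    using sA[OF that] fA[of i j] by (intro integrable_mult_right integrable_real_indicator) auto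
  show "integrable \<mu> (\<lambda>x. cut_simple_fun n a B P x * cut_simple_fun n' a' B' P' x)"
    unfolding prod using iA by (intro Bochner_Integration.integrable_sum) auto
  have "(LINT x|\<mu>. cut_simple_fun n a B P x * cut_simple_fun n' a' B' P' x)
      = (\<Sum>i<n. LINT x|\<mu>. (\<Sum>j<n'. a i * a' j * indicator (?A i j) x))"
    unfolding prod by (rule Bochner_Integration.integral_sum)
        (intro Bochner_Integration.integrable_sum iA; simp)
  also have "\<dots> = (\<Sum>i<n. \<Sum>j<n'. LINT x|\<mu>. a i * a' j * indicator (?A i j) x)"
    by (intro sum.cong refl Bochner_Integration.integral_sum) (rule iA; simp)
  also have "\<dots> = (\<Sum>i<n. \<Sum>j<n'. a i * a' j * measure \<mu> (?A i j))"
    using sA by (intro sum.cong refl) auto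
  finally have R: "(LINT x|\<mu>. cut_simple_fun n a B P x * cut_simple_fun n' a' B' P' x)
      = (\<Sum>i<n. \<Sum>j<n'. a i * a' j * measure \<mu> (?A i j))" .
  have iC: "integrable M (\<lambda>w. a i * a' j * (C (P \<inter> B i) w * C (P' \<inter> B' j) w))" if "i < n" "j < n'"
      for i j
    using s[OF that(1)] s'[OF that(2)] f f' by (intro integrable_mult_right C_mult_integrable) auto
  have "expectation (\<lambda>w. cent (SI n a B P) w * cent (SI n' a' B' P') w) =
      expectation (\<lambda>w. \<Sum>i<n. \<Sum>j<n'. a i * a' j * (C (P \<inter> B i) w * C (P' \<inter> B' j) w))"
    unfolding SI_square_integrable(2)[OF B P] SI_square_integrable(2)[OF B' P'] sum_product
    by (intro Bochner_Integration.integral_cong refl sum.cong) (simp add: mult_ac)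
  also have "\<dots> = (\<Sum>i<n. expectation (\<lambda>w. \<Sum>j<n'. a i * a' j * (C (P \<inter> B i) w * C (P' \<inter> B' j) w)))"
    by (rule Bochner_Integration.integral_sum) (intro Bochner_Integration.integrable_sum iC; simp)
  also have "\<dots> = (\<Sum>i<n. \<Sum>j<n'. expectation (\<lambda>w. a i * a' j * (C (P \<inter> B i) w * C (P' \<inter> B' j) w)))"
    by (intro sum.cong refl Bochner_Integration.integral_sum) (rule iC; simp)
  also have "\<dots> = (\<Sum>i<n. \<Sum>j<n'. variance_coeff * (a i * a' j * measure \<mu> (?A i j)))"
    using s s' f f' by (intro sum.cong refl) (simp add: C_covariance)
  also have "\<dots> = variance_coeff * (LINT x|\<mu>. cut_simple_fun n a B P x * cut_simple_fun n' a' B' P'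
      x)"
    unfolding R by (simp add: sum_distrib_left)
  finally show "expectation (\<lambda>w. cent (SI n a B P) w * cent (SI n' a' B' P') w)
      = variance_coeff * (LINT x|\<mu>. cut_simple_fun n a B P x * cut_simple_fun n' a' B' P' x)" .
qed

end

section \<open>Mean square limits and the zero-one law\<close>

lemma (in prob_space) chf_add_const:
  "chf (\<lambda>w. Y w + c) s = exp (\<i> * of_real (s * c)) * chf Y s"
proof -
  have "chf (\<lambda>w. Y w + c) s = (CLINT w|M. exp (\<i> * of_real (s * c)) * exp (\<i> * of_real (s * Y w)))"
    unfolding chf_def by (intro Bochner_Integration.integral_cong refl) (simp add:
        exp_add[symmetric] algebra_simps)
  then show ?thesis unfolding chf_def by simp
qed

lemma (in prob_space) chf_uminus:
  "chf (\<lambda>w. - Y w) s = cnj (chf Y s)"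
proof -
  have "chf (\<lambda>w. - Y w) s = (CLINT w|M. cnj (exp (\<i> * of_real (s * Y w))))"
    unfolding chf_def by (intro Bochner_Integration.integral_cong refl) (simp add: exp_cnj)
  then show ?thesis unfolding chf_def by (simp only: Bochner_Integration.integral_cnj)
qed

lemma (in prob_space) expectation_tendsto_of_L2:
  fixes u :: "nat \<Rightarrow> 'a \<Rightarrow> real"
  assumes [measurable]: "\<And>n. u n \<in> borel_measurable M" "v \<in> borel_measurable M"
    and u: "\<And>n. integrable M (\<lambda>w. (u n w)\<^sup>2)" and v: "integrable M (\<lambda>w. (v w)\<^sup>2)"
    and lim: "(\<lambda>n. LINT w|M. (u n w - v w)\<^sup>2) \<longlonglongrightarrow> 0"
  shows "(\<lambda>n. expectation (u n)) \<longlonglongrightarrow> expectation v"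
  using L2_tendsto_integral_mult[of u M "\<lambda>_ _. 1" v "\<lambda>_. 1"] assms by simp

context scattered_measure
begin

text \<open>
  A zero-one law. The variable \<open>R\<close> is the limit of variables \<open>Z p\<close> which are, up to constants,
  integrals over the complement of \<open>A (\<rho> p)\<close>. Truncating \<open>Z p\<close> to \<open>A (\<rho> q) - A (\<rho> p)\<close> and \<open>Z q\<close>
  to \<open>A m - A (\<rho> q)\<close> gives independent variables. In the factorised characteristic function of
  their difference one lets \<open>m\<close>, then \<open>q\<close>, then \<open>p\<close> tend to infinity; this yields \<open>1 = E exp(i s
  (R - R)) = |E exp(i s R)|\<^sup>2\<close>.
\<close>
lemma remainder_constant:
  assumes A: "exhausting A" and rep: "\<And>k. simple_rep S (n k) (B k)"
    and Z: "\<And>p. Z p \<in> borel_measurable M" and R: "R \<in> borel_measurable M"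
    and Zlim: "AE w in M. (\<lambda>p. Z p w) \<longlonglongrightarrow> R w"
    and \<rho>: "filterlim \<rho> at_top sequentially"
    and Zeq: "\<And>p. AE w in M. (\<lambda>m. SI (n p) (a p) (B p) (A m - A (\<rho> p)) w + c p) \<longlonglongrightarrow> Z p w"
  shows "\<exists>c. AE w in M. R w = c"
proof (rule AE_constant_if_norm_chf_1[OF R])
  fix s
  have AS: "A m \<in> S" for m by (rule exhausting_in_S[OF A])
  let ?T = "\<lambda>p m w. SI (n p) (a p) (B p) (A m - A (\<rho> p)) w + c p"
  have Tm[measurable]: "?T p m \<in> borel_measurable M" for p m
    using rep AS by (intro borel_measurable_add SI_measurable borel_measurable_const) auto
  note [measurable] = Z R
  have neg: "SI k (\<lambda>i. - b' i) D P w = - SI k b' D P w" for k b' D P w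
    by (simp add: simple_stoch_integral_def sum_negf)
  have indep: "chf (\<lambda>w. ?T p (\<rho> q) w - ?T q m w) s = chf (?T p (\<rho> q)) s * chf (\<lambda>w. - ?T q m w) s"
    for p q m
  proof -
    let ?U = "SI (n p) (a p) (B p) (A (\<rho> q) - A (\<rho> p))"
    let ?V = "SI (n q) (\<lambda>i. - a q i) (B q) (A m - A (\<rho> q))"
    have e: "(\<lambda>w. ?T p (\<rho> q) w - ?T q m w) = (\<lambda>w. (?U w + ?V w) + (c p - c q))" "(\<lambda>w. - ?T q m w)
        = (\<lambda>w. ?V w + - c q)"
      by (auto simp: neg)
    have "chf (\<lambda>w. ?U w + ?V w) s = chf ?U s * chf ?V s"
      using AS by (intro chf_SI_add rep) auto
    then show ?thesis
      unfolding e chf_add_const by (simp add: exp_add[symmetric] algebra_simps)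
  qed
  \<comment> \<open>the limit in m\<close>
  have 1: "chf (\<lambda>w. ?T p (\<rho> q) w - Z q w) s = chf (?T p (\<rho> q)) s * chf (\<lambda>w. - Z q w) s" for p q
  proof (rule LIMSEQ_unique)
    show "(\<lambda>m. chf (\<lambda>w. ?T p (\<rho> q) w - ?T q m w) s) \<longlonglongrightarrow> chf (\<lambda>w. ?T p (\<rho> q) w - Z q w) s"
    proof (rule chf_tendsto)
      show "AE w in M. (\<lambda>m. ?T p (\<rho> q) w - ?T q m w) \<longlonglongrightarrow> ?T p (\<rho> q) w - Z q w"
        using Zeq[of q] by eventually_elim (intro tendsto_diff tendsto_const)
    qed measurable
    have "(\<lambda>m. chf (\<lambda>w. - ?T q m w) s) \<longlonglongrightarrow> chf (\<lambda>w. - Z q w) s"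
    proof (rule chf_tendsto)
      show "AE w in M. (\<lambda>m. - ?T q m w) \<longlonglongrightarrow> - Z q w"
        using Zeq[of q] by eventually_elim (rule tendsto_minus)
    qed measurable
    then show "(\<lambda>m. chf (\<lambda>w. ?T p (\<rho> q) w - ?T q m w) s) \<longlonglongrightarrow> chf (?T p (\<rho> q)) s * chf (\<lambda>w. - Z q w) s"
      unfolding indep by (intro tendsto_mult tendsto_const)
  qed
  have Zq: "AE w in M. (\<lambda>q. ?T p (\<rho> q) w) \<longlonglongrightarrow> Z p w" for p
    using Zeq[of p] by eventually_elim (rule filterlim_compose[OF _ \<rho>])
  \<comment> \<open>the limit in q, where Z q tends to R and the truncation of Z p to Z p\<close>
  have 2: "chf (\<lambda>w. Z p w - R w) s = chf (Z p) s * chf (\<lambda>w. - R w) s" for p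
  proof (rule LIMSEQ_unique)
    show "(\<lambda>q. chf (\<lambda>w. ?T p (\<rho> q) w - Z q w) s) \<longlonglongrightarrow> chf (\<lambda>w. Z p w - R w) s"
    proof (rule chf_tendsto)
      show "AE w in M. (\<lambda>q. ?T p (\<rho> q) w - Z q w) \<longlonglongrightarrow> Z p w - R w"
        using Zq[of p] Zlim by eventually_elim (rule tendsto_diff)
    qed measurable
    have "(\<lambda>q. chf (?T p (\<rho> q)) s) \<longlonglongrightarrow> chf (Z p) s"
      by (rule chf_tendsto[OF _ _ Zq]) measurable
    moreover have "(\<lambda>q. chf (\<lambda>w. - Z q w) s) \<longlonglongrightarrow> chf (\<lambda>w. - R w) s"
    proof (rule chf_tendsto)
      show "AE w in M. (\<lambda>q. - Z q w) \<longlonglongrightarrow> - R w"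
        using Zlim by eventually_elim (rule tendsto_minus)
    qed measurable
    ultimately show "(\<lambda>q. chf (\<lambda>w. ?T p (\<rho> q) w - Z q w) s) \<longlonglongrightarrow> chf (Z p) s * chf (\<lambda>w. - R w) s"
      unfolding 1 by (rule tendsto_mult)
  qed
  have "chf (\<lambda>w. R w - R w) s = chf R s * chf (\<lambda>w. - R w) s"
  proof (rule LIMSEQ_unique)
    show "(\<lambda>p. chf (\<lambda>w. Z p w - R w) s) \<longlonglongrightarrow> chf (\<lambda>w. R w - R w) s"
    proof (rule chf_tendsto)
      show "AE w in M. (\<lambda>p. Z p w - R w) \<longlonglongrightarrow> R w - R w"
        using Zlim by eventually_elim (intro tendsto_diff tendsto_const)
    qed measurable
    have "(\<lambda>p. chf (Z p) s) \<longlonglongrightarrow> chf R s"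
      by (rule chf_tendsto[OF _ _ Zlim]) measurable
    then show "(\<lambda>p. chf (\<lambda>w. Z p w - R w) s) \<longlonglongrightarrow> chf R s * chf (\<lambda>w. - R w) s"
      unfolding 2 by (intro tendsto_mult tendsto_const)
  qed
  then have "1 = chf R s * cnj (chf R s)" by (simp add: chf_def[of "\<lambda>w. 0"] prob_space chf_uminus)
  then have "complex_of_real 1 = of_real ((cmod (chf R s))\<^sup>2)"
      by (simp only: complex_norm_square) simp
  then have "(cmod (chf R s))\<^sup>2 = 1" by (simp only: of_real_eq_iff)
  then have "cmod (chf R s) = 1 \<or> cmod (chf R s) = - 1" by (simp add: power2_eq_1_iff)
  then show "cmod (chf R s) = 1" using norm_ge_zero[of "chf R s"] by linarith
qed

end

context scattered_measure_variance
begin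

text \<open>
  On \<open>A p\<close> the functions with index at least \<open>p\<close> are uniformly bounded and the measure is
  finite, so they converge in mean square there; the index \<open>N p\<close> is taken so late that the error
  is below \<open>1 / (p + 1)\<close>. Outside \<open>A p\<close> the error is the tail of \<open>\<integral> f\<^sup>2\<close>.
\<close>
lemma cut_simple_fun_L2_approx:
  fixes f :: "'x \<Rightarrow> real"
  assumes rep: "\<And>k. simple_rep S (n k) (B k)"
    and lim: "AE x in \<mu>. (\<lambda>k. simple_fun (n k) (a k) (B k) x) \<longlonglongrightarrow> f x"
    and f[measurable]: "f \<in> borel_measurable \<mu>" and f2: "integrable \<mu> (\<lambda>x. (f x)\<^sup>2)"
    and A: "exhausting A" and fin: "\<And>k. emeasure \<mu> (A k) < \<infinity>"
    and bound: "\<And>k m x. x \<in> A k \<Longrightarrow> k \<le> m \<Longrightarrow> \<bar>simple_fun (n m) (a m) (B m) x\<bar> \<le> real (Suc k)"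
  obtains N :: "nat \<Rightarrow> nat" where "\<And>p. p \<le> N p"
    "(\<lambda>p. LINT x|\<mu>. (cut_simple_fun (n (N p)) (a (N p)) (B (N p)) (A p) x - f x)\<^sup>2) \<longlonglongrightarrow> 0"
proof -
  have AS: "A m \<in> S" for m by (rule exhausting_in_S[OF A])
  have Am[measurable]: "A m \<in> sets \<mu>" for m by (rule S_sets[OF AS])
  define g where "g k = simple_fun (n k) (a k) (B k)" for k
  have gm[measurable]: "g k \<in> borel_measurable \<mu>" for k
    unfolding g_def by (rule simple_fun_measurable) (rule S_sets, rule simple_repD(1)[OF rep])
  have lim: "AE x in \<mu>. (\<lambda>k. g k x) \<longlonglongrightarrow> f x" using lim by (simp add: g_def)
  have bound: "x \<in> A k \<Longrightarrow> k \<le> m \<Longrightarrow> \<bar>g m x\<bar> \<le> real (Suc k)" for x k m using bound by (simp add: g_def)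
  have c1: "(\<lambda>m. LINT x|\<mu>. (g (m + p) x - f x)\<^sup>2 * indicator (A p) x) \<longlonglongrightarrow> (LINT x|\<mu>. 0)" for p
  proof (rule integral_dominated_convergence[where w
      = "\<lambda>x. (2 * real (Suc p))\<^sup>2 * indicator (A p) x"])
    show "integrable \<mu> (\<lambda>x. (2 * real (Suc p))\<^sup>2 * indicator (A p) x)"
      using fin[of p] by (intro integrable_mult_right integrable_real_indicator) auto
    show "AE x in \<mu>. (\<lambda>m. (g (m + p) x - f x)\<^sup>2 * indicator (A p) x) \<longlonglongrightarrow> 0"
      using lim
    proof eventually_elim
      case (elim x)
      have "(\<lambda>m. (g (m + p) x - f x)\<^sup>2 * indicator (A p) x) \<longlonglongrightarrow> (f x - f x)\<^sup>2 * indicator (A p) x"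
        by (intro tendsto_intros LIMSEQ_ignore_initial_segment elim)
      then show ?case by simp
    qed
    show "AE x in \<mu>. norm ((g (m + p) x - f x)\<^sup>2 * indicator (A p) x)
        \<le> (2 * real (Suc p))\<^sup>2 * indicator (A p) x" for m
      using lim
    proof eventually_elim
      case (elim x)
      show ?case
      proof (cases "x \<in> A p")
        case True
        have "\<bar>f x\<bar> \<le> real (Suc p)"
          using bound[OF True] by (intro LIMSEQ_le_const2[OF tendsto_rabs[OF elim]]) auto
        moreover have "\<bar>g (m + p) x\<bar> \<le> real (Suc p)" using bound[OF True] by simp
        ultimately have "\<bar>g (m + p) x - f x\<bar> \<le> 2 * real (Suc p)"
          using abs_triangle_ineq4[of "g (m + p) x" "f x"] by simp
        then have "(g (m + p) x - f x)\<^sup>2 \<le> (2 * real (Suc p))\<^sup>2"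
            by (intro abs_le_square_iff[THEN iffD1]) simp
        then show ?thesis using True by simp
      qed simp
    qed
  qed measurable
  \<comment> \<open>the shift by p ensures that the index is late enough for the bound on A p\<close>
  have "\<exists>m. (LINT x|\<mu>. (g (m + p) x - f x)\<^sup>2 * indicator (A p) x) < 1 / real (Suc p)" for p
  proof -
    have "\<forall>\<^sub>F m in sequentially. (LINT x|\<mu>. (g (m + p) x - f x)\<^sup>2 * indicator (A p) x)
        < 1 / real (Suc p)"
      using c1[of p] by (intro order_tendstoD(2)) auto
    then show ?thesis by (auto simp: eventually_sequentially)
  qed
  then obtain m0 where m0: "\<And>p. (LINT x|\<mu>. (g (m0 p + p) x - f x)\<^sup>2 * indicator (A p) x)
      < 1 / real (Suc p)" by metis
  define N where "N p = m0 p + p" for p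
  have c2: "(\<lambda>p. LINT x|\<mu>. (f x)\<^sup>2 * indicator (- A p) x) \<longlonglongrightarrow> (LINT x|\<mu>. 0)"
  proof (rule integral_dominated_convergence[where w = "\<lambda>x. (f x)\<^sup>2"])
    have "AE x in \<mu>. \<exists>k. x \<in> A k" using A by (simp add: exhausting_def)
    then show "AE x in \<mu>. (\<lambda>p. (f x)\<^sup>2 * indicator (- A p) x) \<longlonglongrightarrow> 0"
    proof eventually_elim
      case (elim x)
      then obtain k where "x \<in> A k" by blast
      then have "\<forall>p\<ge>k. (f x)\<^sup>2 * indicator (- A p) x = 0" using exhausting_mono[OF A]
          by (auto simp: indicator_def)
      then have "\<forall>\<^sub>F p in sequentially. (f x)\<^sup>2 * indicator (- A p) x = 0"
          by (auto simp: eventually_sequentially)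
      then show ?case by (rule tendsto_eventually)
    qed
    show "AE x in \<mu>. norm ((f x)\<^sup>2 * indicator (- A p) x) \<le> (f x)\<^sup>2" for p
        by (auto simp: indicator_def)
    show "(\<lambda>x. (f x)\<^sup>2 * indicator (- A p) x) \<in> borel_measurable \<mu>" for p
    proof -
      have "(\<lambda>x. (f x)\<^sup>2 * (1 - indicator (A p) x)) \<in> borel_measurable \<mu>" by measurable
      moreover have "(\<lambda>x. (f x)\<^sup>2 * (1 - indicator (A p) x)) = (\<lambda>x. (f x)\<^sup>2 * indicator (- A p) x)"
        by (auto simp: indicator_def fun_eq_iff)
      ultimately show ?thesis by simp
    qed
  qed (use f2 in auto)
  have i1: "integrable \<mu> (\<lambda>x. (f x)\<^sup>2 * indicator (- A p) x)" for p
  proof -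
    have "integrable \<mu> (\<lambda>x. (f x)\<^sup>2 - (f x)\<^sup>2 * indicator (A p) x)"
      using f2 by (intro Bochner_Integration.integrable_diff integrable_real_mult_indicator) auto
    moreover have "(\<lambda>x. (f x)\<^sup>2 - (f x)\<^sup>2 * indicator (A p) x)
        = (\<lambda>x. (f x)\<^sup>2 * indicator (- A p) x)"
      by (auto simp: indicator_def fun_eq_iff)
    ultimately show ?thesis by simp
  qed
  have i2: "integrable \<mu> (\<lambda>x. (g (N p) x - f x)\<^sup>2 * indicator (A p) x)" for p
  proof (rule Bochner_Integration.integrable_bound)
    show "integrable \<mu> (\<lambda>x. 2 * ((real (Suc p))\<^sup>2 * indicator (A p) x) + 2 * (f x)\<^sup>2)"
      using fin[of p] f2 by (intro Bochner_Integration.integrable_add integrable_mult_right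
          integrable_real_indicator) auto
    show "AE x in \<mu>. norm ((g (N p) x - f x)\<^sup>2 * indicator (A p) x)
        \<le> norm (2 * ((real (Suc p))\<^sup>2 * indicator (A p) x) + 2 * (f x)\<^sup>2)"
    proof (rule AE_I2)
      fix x
      show "norm ((g (N p) x - f x)\<^sup>2 * indicator (A p) x)
          \<le> norm (2 * ((real (Suc p))\<^sup>2 * indicator (A p) x) + 2 * (f x)\<^sup>2)"
      proof (cases "x \<in> A p")
        case True
        have "\<bar>g (N p) x\<bar> \<le> real (Suc p)" using bound[OF True] by (simp add: N_def)
        then have "(g (N p) x)\<^sup>2 \<le> (real (Suc p))\<^sup>2" by (intro abs_le_square_iff[THEN iffD1]) simp
        moreover have "(g (N p) x - f x)\<^sup>2 \<le> 2 * (g (N p) x)\<^sup>2 + 2 * (f x)\<^sup>2"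
          using zero_le_power2[of "g (N p) x + f x"] by (simp add: power2_sum power2_diff)
        ultimately have "(g (N p) x - f x)\<^sup>2 \<le> 2 * (real (Suc p))\<^sup>2 + 2 * (f x)\<^sup>2" by linarith
        then show ?thesis using True by simp
      qed simp
    qed
  qed measurable
  have eq: "(LINT x|\<mu>. (cut_simple_fun (n (N p)) (a (N p)) (B (N p)) (A p) x - f x)\<^sup>2) =
      (LINT x|\<mu>. (g (N p) x - f x)\<^sup>2 * indicator (A p) x)
          + (LINT x|\<mu>. (f x)\<^sup>2 * indicator (- A p) x)" for p
  proof -
    have "(LINT x|\<mu>. (cut_simple_fun (n (N p)) (a (N p)) (B (N p)) (A p) x - f x)\<^sup>2) =
        (LINT x|\<mu>. (g (N p) x - f x)\<^sup>2 * indicator (A p) x + (f x)\<^sup>2 * indicator (- A p) x)"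
      by (intro Bochner_Integration.integral_cong refl) (auto simp:
          cut_simple_fun_def g_def indicator_def)
    then show ?thesis using i1[of p] i2[of p] by simp
  qed
  have "(\<lambda>p. LINT x|\<mu>. (g (N p) x - f x)\<^sup>2 * indicator (A p) x) \<longlonglongrightarrow> 0"
  proof (rule real_tendsto_sandwich[where f = "\<lambda>_. 0" and h = "\<lambda>p. 1 / real (Suc p)"])
    show "(\<lambda>p. 1 / real (Suc p)) \<longlonglongrightarrow> 0" by (rule LIMSEQ_Suc[OF lim_const_over_n])
    show "\<forall>\<^sub>F p in sequentially. (LINT x|\<mu>. (g (N p) x - f x)\<^sup>2 * indicator (A p) x)
        \<le> 1 / real (Suc p)"
      using m0 by (intro always_eventually allI less_imp_le) (simp add: N_def)
    show "\<forall>\<^sub>F p in sequentially. 0 \<le> (LINT x|\<mu>. (g (N p) x - f x)\<^sup>2 * indicator (A p) x)"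
      by (intro always_eventually allI Bochner_Integration.integral_nonneg) auto
  qed simp
  then have "(\<lambda>p. LINT x|\<mu>. (cut_simple_fun (n (N p)) (a (N p)) (B (N p)) (A p) x - f x)\<^sup>2)
      \<longlonglongrightarrow> 0 + (LINT x|\<mu>. 0)"
    unfolding eq using c2 by (rule tendsto_add)
  then show thesis by (intro that[of N]) (auto simp: N_def)
qed

text \<open>
  \<open>Y\<close> is, up to an additive constant, the mean square limit of integrals of simple functions
  that approximate \<open>f\<close> in mean square.
\<close>
definition L2_integral :: "('x \<Rightarrow> real) \<Rightarrow> ('w \<Rightarrow> real) \<Rightarrow> bool" where
  "L2_integral f Y \<longleftrightarrow> (\<exists>n a B P. (\<forall>p. simple_rep S (n p) (B p) \<and> P p \<in> S \<and> emeasure \<mu> (P p) < \<infinity>) \<and>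
    (\<lambda>p. LINT x|\<mu>. (cut_simple_fun (n p) (a p) (B p) (P p) x - f x)\<^sup>2) \<longlonglongrightarrow> 0 \<and>
    (\<lambda>p. LINT w|M. (cent (SI (n p) (a p) (B p) (P p)) w - cent Y w)\<^sup>2) \<longlonglongrightarrow> 0)"

lemma cut_simple_fun_square_integrable:
  assumes "simple_rep S n B" "P \<in> S" "emeasure \<mu> P < \<infinity>"
  shows "integrable \<mu> (\<lambda>x. (cut_simple_fun n a B P x)\<^sup>2)"
  using SI_isometry(1)[OF assms assms, of a a] by (simp add: power2_eq_square)

text \<open>
  The centred integrals \<open>u p\<close> of \<open>f\<^bsub>N p\<^esub>\<close> over \<open>A p\<close> are Cauchy in mean square by the isometry.
  That their limit \<open>J\<close> is the centred \<open>Y\<close> is not automatic: simple functions that tend to 0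
  almost everywhere may have integrals that do not tend to 0, when their mass escapes to small
  sets. What can survive in this way is \<open>R = Y - J\<close>, and the zero-one law shows that it is
  constant.
\<close>
lemma stochastic_integral_is_L2_integral:
  fixes f :: "'x \<Rightarrow> real"
  assumes rep: "\<And>k. simple_rep S (n k) (B k)"
    and lim: "AE x in \<mu>. (\<lambda>k. simple_fun (n k) (a k) (B k) x) \<longlonglongrightarrow> f x"
    and f[measurable]: "f \<in> borel_measurable \<mu>" and f2: "integrable \<mu> (\<lambda>x. (f x)\<^sup>2)"
    and A: "exhausting A" and fin: "\<And>k. emeasure \<mu> (A k) < \<infinity>"
    and bound: "\<And>k m x. x \<in> A k \<Longrightarrow> k \<le> m \<Longrightarrow> \<bar>simple_fun (n m) (a m) (B m) x\<bar> \<le> real (Suc k)"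
    and Y[measurable]: "Y \<in> borel_measurable M"
    and limY: "AE w in M. (\<lambda>k. SI (n k) (a k) (B k) (space \<mu>) w) \<longlonglongrightarrow> Y w"
    and Y2: "integrable M (\<lambda>w. (Y w)\<^sup>2)"
  shows "L2_integral f Y"
proof -
  have AS: "A m \<in> S" for m by (rule exhausting_in_S[OF A])
  obtain N :: "nat \<Rightarrow> nat" where N: "\<And>p. p \<le> N p"
    and gf: "(\<lambda>p. LINT x|\<mu>. (cut_simple_fun (n (N p)) (a (N p)) (B (N p)) (A p) x - f x)\<^sup>2) \<longlonglongrightarrow> 0"
    using cut_simple_fun_L2_approx[OF rep lim f f2 A fin bound] by blast
  define G where "G p = SI (n (N p)) (a (N p)) (B (N p)) (A p)" for p
  define g where "g p = cut_simple_fun (n (N p)) (a (N p)) (B (N p)) (A p)" for p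
  have gm[measurable]: "g p \<in> borel_measurable \<mu>" for p unfolding g_def using rep AS
      by (rule cut_simple_fun_measurable)
  have g2: "integrable \<mu> (\<lambda>x. (g p x)\<^sup>2)" for p unfolding g_def using rep AS fin
      by (rule cut_simple_fun_square_integrable)
  have gfd: "integrable \<mu> (\<lambda>x. (g p x - f x)\<^sup>2)" for p
      by (rule integrable_square_add(2)) (auto intro: g2 f2)
  have gf: "(\<lambda>p. LINT x|\<mu>. (g p x - f x)\<^sup>2) \<longlonglongrightarrow> 0" using gf by (simp add: g_def)
  define u where "u p = cent (G p)" for p
  have Gm[measurable]: "G p \<in> borel_measurable M" for p unfolding G_def using rep AS by simp
  have um[measurable]: "u p \<in> borel_measurable M" for p unfolding u_def by measurable
  have G2: "integrable M (\<lambda>w. (G p w)\<^sup>2)" for p unfolding G_def using rep AS fin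
      by (rule SI_square_integrable(3))
  have u2: "integrable M (\<lambda>w. (u p w)\<^sup>2)" for p unfolding u_def using Gm G2
      by (rule integrable_cent_square)
  have iso: "expectation (\<lambda>w. u p w * u q w) = variance_coeff * (LINT x|\<mu>. g p x * g q x)"
      "integrable \<mu> (\<lambda>x. g p x * g q x)" for p q
    unfolding u_def G_def g_def using SI_isometry[OF rep AS fin rep AS fin] by auto
  have iuu: "integrable M (\<lambda>w. u p w * u q w)" for p q
      by (rule integral_Cauchy_Schwarz(1)) (auto intro: u2)
  have isod: "expectation (\<lambda>w. (u p w - u q w)\<^sup>2) = variance_coeff * (LINT x|\<mu>. (g p x - g q x)\<^sup>2)"
      for p q
  proof -
    have "expectation (\<lambda>w. (u p w - u q w)\<^sup>2)
        = expectation (\<lambda>w. u p w * u p w - 2 * (u p w * u q w) + u q w * u q w)"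
      by (intro Bochner_Integration.integral_cong refl) (simp add: power2_eq_square algebra_simps)
    also have "\<dots> = expectation (\<lambda>w. u p w * u p w) - 2 * expectation (\<lambda>w. u p w * u q w)
        + expectation (\<lambda>w. u q w * u q w)"
      by (simp add: iuu)
    also have "\<dots> = variance_coeff * ((LINT x|\<mu>. g p x * g p x) - 2 * (LINT x|\<mu>. g p x * g q x)
        + (LINT x|\<mu>. g q x * g q x))"
      unfolding iso by (simp add: algebra_simps)
    also have "(LINT x|\<mu>. g p x * g p x) - 2 * (LINT x|\<mu>. g p x * g q x) + (LINT x|\<mu>. g q x * g q x)
        =
        (LINT x|\<mu>. g p x * g p x - 2 * (g p x * g q x) + g q x * g q x)"
      by (simp add: iso(2))
    also have "\<dots> = (LINT x|\<mu>. (g p x - g q x)\<^sup>2)"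
      by (intro Bochner_Integration.integral_cong refl) (simp add: power2_eq_square algebra_simps)
    finally show ?thesis .
  qed
  have Cauchy: "\<exists>K. \<forall>p\<ge>K. \<forall>q\<ge>K. (LINT w|M. (u p w - u q w)\<^sup>2) < e" if e: "e > 0" for e
  proof -
    \<comment> \<open>adding 1 avoids a case distinction for variance rate 0\<close>
    define e' where "e' = e / 4 / (variance_coeff + 1)"
    have e': "e' > 0" using e variance_coeff_nonneg by (simp add: e'_def)
    have "\<forall>\<^sub>F p in sequentially. (LINT x|\<mu>. (g p x - f x)\<^sup>2) < e'" using gf e'
        by (rule order_tendstoD(2))
    then obtain K where K: "\<And>p. p \<ge> K \<Longrightarrow> (LINT x|\<mu>. (g p x - f x)\<^sup>2) < e'"
        by (auto simp: eventually_sequentially)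
    have "(LINT w|M. (u p w - u q w)\<^sup>2) < e" if "p \<ge> K" "q \<ge> K" for p q
    proof -
      have "(LINT x|\<mu>. (g p x - g q x)\<^sup>2) \<le> (LINT x|\<mu>. 2 * (g p x - f x)\<^sup>2 + 2 * (g q x - f x)\<^sup>2)"
      proof (rule integral_mono)
        show "integrable \<mu> (\<lambda>x. (g p x - g q x)\<^sup>2)"
            by (rule integrable_square_add(2)) (auto intro: g2)
        show "integrable \<mu> (\<lambda>x. 2 * (g p x - f x)\<^sup>2 + 2 * (g q x - f x)\<^sup>2)"
          by (intro Bochner_Integration.integrable_add integrable_mult_right gfd)
        fix x
        have "0 \<le> ((g p x - f x) + (g q x - f x))\<^sup>2" by simp
        then show "(g p x - g q x)\<^sup>2 \<le> 2 * (g p x - f x)\<^sup>2 + 2 * (g q x - f x)\<^sup>2"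
          by (simp add: power2_eq_square algebra_simps)
      qed
      also have "\<dots> = 2 * (LINT x|\<mu>. (g p x - f x)\<^sup>2) + 2 * (LINT x|\<mu>. (g q x - f x)\<^sup>2)"
          by (simp add: gfd)
      also have "\<dots> \<le> 4 * e'" using K[OF that(1)] K[OF that(2)] by simp
      finally have "variance_coeff * (LINT x|\<mu>. (g p x - g q x)\<^sup>2) \<le> variance_coeff * (4 * e')"
          using variance_coeff_nonneg by (intro mult_left_mono)
      also have "\<dots> < (variance_coeff + 1) * (4 * e')" using e' by simp
      also have "\<dots> = e"
      proof -
        have "x * (4 * (e / 4 / x)) = e" if "x \<noteq> 0" for x :: real using that by simp
        from this[of "variance_coeff + 1"] show ?thesis unfolding e'_def using variance_coeff_nonneg
            by simp
      qed
      finally show ?thesis unfolding isod .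
    qed
    then show ?thesis by blast
  qed
  obtain J and \<rho> :: "nat \<Rightarrow> nat" where Jm[measurable]: "J \<in> borel_measurable M" and J2:
      "integrable M (\<lambda>w. (J w)\<^sup>2)"
    and \<rho>: "strict_mono \<rho>" and uJ: "AE w in M. (\<lambda>p. u (\<rho> p) w)
        \<longlonglongrightarrow> J w" and uJ2: "(\<lambda>p. LINT w|M. (u p w - J w)\<^sup>2) \<longlonglongrightarrow> 0"
    using L2_Cauchy_convergent[of u, OF um u2 Cauchy] by blast
  define \<nu> where "\<nu> p = N (\<rho> p)" for p
  have \<rho>_top: "filterlim \<rho> at_top sequentially" using \<rho> by (rule filterlim_subseq)
  have \<nu>_top: "filterlim \<nu> at_top sequentially"
    by (rule filterlim_at_top_mono[OF \<rho>_top]) (auto simp: \<nu>_def N)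
  let ?Y = "\<lambda>k. SI (n k) (a k) (B k) (space \<mu>)"
  define Z where "Z p w = ?Y (\<nu> p) w - u (\<rho> p) w" for p w
  define R where "R w = Y w - J w" for w
  have SYm[measurable]: "?Y k \<in> borel_measurable M" for k by (rule SI_space_measurable[OF rep])
  have Zm: "Z p \<in> borel_measurable M" for p unfolding Z_def[abs_def] by measurable
  have Rm: "R \<in> borel_measurable M" unfolding R_def[abs_def] by measurable
  have "\<exists>c. AE w in M. R w = c"
  proof (rule remainder_constant[OF A rep Zm Rm _ \<rho>_top])
    show "AE w in M. (\<lambda>p. Z p w) \<longlonglongrightarrow> R w"
      using limY uJ
    proof eventually_elim
      case (elim w)
      have "(\<lambda>p. ?Y (\<nu> p) w) \<longlonglongrightarrow> Y w" by (rule filterlim_compose[OF elim(1) \<nu>_top])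
      then show ?case unfolding Z_def R_def using elim(2) by (rule tendsto_diff)
    qed
    fix p
    have "AE w in M. \<forall>m. \<rho> p \<le> m \<longrightarrow> SI (n (\<nu> p)) (a (\<nu> p)) (B (\<nu> p)) (A m) w
        = G (\<rho> p) w + SI (n (\<nu> p)) (a (\<nu> p)) (B (\<nu> p)) (A m - A (\<rho> p)) w"
      unfolding AE_all_countable G_def \<nu>_def[symmetric]
    proof (intro allI)
      fix m
      show "AE w in M. \<rho> p \<le> m \<longrightarrow> SI (n (\<nu> p)) (a (\<nu> p)) (B (\<nu> p)) (A m) w =
        SI (n (\<nu> p)) (a (\<nu> p)) (B (\<nu> p)) (A (\<rho> p)) w + SI (n (\<nu> p)) (a (\<nu> p)) (B (\<nu> p))
            (A m - A (\<rho> p)) w"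
      proof (cases "\<rho> p \<le> m")
        case True
        then show ?thesis using SI_Diff[OF A rep[of "\<nu> p"] True, of "a (\<nu> p)"] by simp
      qed simp
    qed
    with SI_exhausting_limit[OF A rep[of "\<nu> p"], of "a (\<nu> p)"]
    show "AE w in M. (\<lambda>m. SI (n (\<nu> p)) (a (\<nu> p)) (B (\<nu> p)) (A m - A (\<rho> p)) w
        + expectation (G (\<rho> p))) \<longlonglongrightarrow> Z p w"
    proof eventually_elim
      case (elim w)
      have "(\<lambda>m. SI (n (\<nu> p)) (a (\<nu> p)) (B (\<nu> p)) (A m) w - u (\<rho> p) w) \<longlonglongrightarrow> Z p w"
        unfolding Z_def by (intro tendsto_diff tendsto_const elim)
      moreover have "\<forall>\<^sub>F m in sequentially. SI (n (\<nu> p)) (a (\<nu> p)) (B (\<nu> p)) (A m) w - u (\<rho> p) w =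
          SI (n (\<nu> p)) (a (\<nu> p)) (B (\<nu> p)) (A m - A (\<rho> p)) w + expectation (G (\<rho> p))"
        using eventually_ge_at_top[of "\<rho> p"] by eventually_elim (use elim(2) in \<open>simp add:
            u_def cent_def\<close>)
      ultimately show ?case by (rule Lim_transform_eventually)
    qed
  qed
  then obtain c where c: "AE w in M. R w = c" by blast
  have "expectation (u p) = 0" for p
    unfolding u_def by (rule expectation_cent[OF square_integrable_imp_integrable[OF Gm G2]])
  moreover have "(\<lambda>p. expectation (u p)) \<longlonglongrightarrow> expectation J"
    by (rule expectation_tendsto_of_L2[OF um Jm u2 J2 uJ2])
  ultimately have EJ: "expectation J = 0" using LIMSEQ_unique[of "\<lambda>_. 0" 0 "expectation J"] by simp
  \<comment> \<open>the constant is E Y, since the mean square limit J inherits mean 0\<close>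
  have Y1: "integrable M Y" by (rule square_integrable_imp_integrable[OF Y Y2])
  have J1: "integrable M J" by (rule square_integrable_imp_integrable[OF Jm J2])
  have "expectation R = expectation (\<lambda>w. c)" using c Rm by (intro integral_cong_AE) auto
  then have "c = expectation Y" using Y1 J1 EJ by (simp add: R_def[abs_def] prob_space)
  with c have JY: "AE w in M. J w = cent Y w" by (auto simp: R_def cent_def elim: eventually_mono)
  have "(LINT w|M. (u p w - cent Y w)\<^sup>2) = (LINT w|M. (u p w - J w)\<^sup>2)" for p
    using JY by (intro integral_cong_AE) (auto elim: eventually_mono)
  then have "(\<lambda>p. LINT w|M. (u p w - cent Y w)\<^sup>2) \<longlonglongrightarrow> 0" using uJ2 by simp
  then show ?thesis
    unfolding L2_integral_def using gf rep AS fin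
    by (intro exI[of _ "\<lambda>p. n (N p)"] exI[of _ "\<lambda>p. a (N p)"] exI[of _ "\<lambda>p. B (N p)"] exI[of _ A])
      (auto simp: g_def u_def G_def)
qed

lemma L2_integral_covariance:
  assumes Y: "L2_integral f Y" and Z: "L2_integral h Z"
    and Ym[measurable]: "Y \<in> borel_measurable M" "Z \<in> borel_measurable M"
    and Y2: "integrable M (\<lambda>w. (Y w)\<^sup>2)" "integrable M (\<lambda>w. (Z w)\<^sup>2)"
    and f[measurable]: "f \<in> borel_measurable \<mu>" "h \<in> borel_measurable \<mu>"
    and f2: "integrable \<mu> (\<lambda>x. (f x)\<^sup>2)" "integrable \<mu> (\<lambda>x. (h x)\<^sup>2)"
  shows "expectation (\<lambda>w. cent Y w * cent Z w) = variance_coeff * (LINT x|\<mu>. f x * h x)"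
proof -
  obtain n a B P where 1: "\<And>p. simple_rep S (n p) (B p)" "\<And>p. P p \<in> S" "\<And>p. emeasure \<mu> (P p) < \<infinity>"
    "(\<lambda>p. LINT x|\<mu>. (cut_simple_fun (n p) (a p) (B p) (P p) x - f x)\<^sup>2) \<longlonglongrightarrow> 0"
    "(\<lambda>p. LINT w|M. (cent (SI (n p) (a p) (B p) (P p)) w - cent Y w)\<^sup>2) \<longlonglongrightarrow> 0"
    using Y unfolding L2_integral_def by blast
  obtain n' a' B' P' where 2: "\<And>p. simple_rep S (n' p) (B' p)" "\<And>p. P' p \<in> S" "\<And>p. emeasure \<mu> (P' p)
      < \<infinity>"
    "(\<lambda>p. LINT x|\<mu>. (cut_simple_fun (n' p) (a' p) (B' p) (P' p) x - h x)\<^sup>2) \<longlonglongrightarrow> 0"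
    "(\<lambda>p. LINT w|M. (cent (SI (n' p) (a' p) (B' p) (P' p)) w - cent Z w)\<^sup>2) \<longlonglongrightarrow> 0"
    using Z unfolding L2_integral_def by blast
  have "(\<lambda>p. LINT x|\<mu>. cut_simple_fun (n p) (a p) (B p) (P p) x * cut_simple_fun (n' p) (a' p)
      (B' p) (P' p) x) \<longlonglongrightarrow> (LINT x|\<mu>. f x * h x)"
    by (rule L2_tendsto_integral_mult[OF cut_simple_fun_measurable[OF 1(1,2)]
        cut_simple_fun_measurable[OF 2(1,2)] f
        cut_simple_fun_square_integrable[OF 1(1-3)] cut_simple_fun_square_integrable[OF 2(1-3)] f2
            1(4) 2(4)])
  then have l1: "(\<lambda>p. variance_coeff * (LINT x|\<mu>. cut_simple_fun (n p) (a p) (B p) (P p) x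
      * cut_simple_fun (n' p) (a' p) (B' p) (P' p) x)) \<longlonglongrightarrow> variance_coeff * (LINT x|\<mu>. f x * h x)"
    by (rule tendsto_mult[OF tendsto_const])
  have "(\<lambda>p. LINT w|M. cent (SI (n p) (a p) (B p) (P p)) w * cent (SI (n' p) (a' p) (B' p) (P' p))
      w) \<longlonglongrightarrow> (LINT w|M. cent Y w * cent Z w)"
    by (rule L2_tendsto_integral_mult[OF cent_measurable[OF SI_measurable[OF 1(1,2)]]
        cent_measurable[OF SI_measurable[OF 2(1,2)]]
        cent_measurable[OF Ym(1)] cent_measurable[OF Ym(2)]
        integrable_cent_square[OF SI_measurable[OF 1(1,2)] SI_square_integrable(3)[OF 1(1-3)]]
        integrable_cent_square[OF SI_measurable[OF 2(1,2)] SI_square_integrable(3)[OF 2(1-3)]]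
        integrable_cent_square[OF Ym(1) Y2(1)] integrable_cent_square[OF Ym(2) Y2(2)] 1(5) 2(5)])
  then have l2: "(\<lambda>p. variance_coeff * (LINT x|\<mu>. cut_simple_fun (n p) (a p) (B p) (P p) x
      * cut_simple_fun (n' p) (a' p) (B' p) (P' p) x)) \<longlonglongrightarrow> (LINT w|M. cent Y w * cent Z w)"
    unfolding SI_isometry(2)[OF 1(1-3) 2(1-3)] .
  show ?thesis by (rule LIMSEQ_unique[OF l2 l1])
qed

end

section \<open>The kernel of the field\<close>

text \<open>
  The two cases in the definition of \<open>c\<^sub>1\<close> are reconciled by Legendre's duplication formula.
\<close>
lemma const_c1_square: "0 < d \<Longrightarrow> (const_c1 d)\<^sup>2
    = 2 powr (real d - 2) * (Gamma ((real d + 1) / 2))\<^sup>2 / pi"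
proof -
  assume d: "0 < d"
  show ?thesis
  proof (cases "odd d")
    case True
    have "(2 powr (real d / 2 - 1))\<^sup>2 = 2 powr (real d - 2)"
      by (simp add: power2_eq_square powr_add[symmetric])
    then show ?thesis using True by (simp add: const_c1_def power_mult_distrib power_divide)
  next
    case False
    define z where "z = real d / 2"
    have z: "z > 0" "2 * z = real d" "z + 1 / 2 = (real d + 1) / 2" using d
        by (auto simp: z_def add_divide_distrib)
    have "Gamma z * Gamma (z + 1 / 2) = exp ((1 - 2 * z) * ln 2) * sqrt pi * Gamma (2 * z)"
    proof -
      have pos: "complex_of_real y \<notin> \<int>\<^sub>\<le>\<^sub>0" if "y > 0" for y
      proof
        assume "complex_of_real y \<in> \<int>\<^sub>\<le>\<^sub>0"
        then obtain n where "n \<le> 0" "complex_of_real y = of_int n" by (rule nonpos_Ints_cases) auto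
        then have "y = of_int n" by (metis of_real_eq_iff of_real_of_int_eq)
        with \<open>n \<le> 0\<close> that show False by simp
      qed
      have "complex_of_real (Gamma z * Gamma (z + 1 / 2))
          = complex_of_real (exp ((1 - 2 * z) * ln 2) * sqrt pi * Gamma (2 * z))"
        using Gamma_legendre_duplication[of "of_real z"] pos[of z] pos[of "z + 1 / 2"] z(1)
        by (simp flip: Gamma_complex_of_real exp_of_real)
      then show ?thesis by (simp only: of_real_eq_iff)
    qed
    then have "Gamma z * Gamma ((real d + 1) / 2) = 2 powr (1 - real d) * sqrt pi * Gamma (real d)"
      unfolding z(2,3) by (simp add: powr_def)
    then have "Gamma (real d) / Gamma z = Gamma ((real d + 1) / 2) * 2 powr (real d - 1) / sqrt pi"
      using Gamma_real_pos[OF z(1)] by (simp add: field_simps powr_diff)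
    moreover have "const_c1 d = - (2 powr (- real d / 2)) * (Gamma (real d) / Gamma z)"
      using False by (simp add: const_c1_def z_def)
    ultimately have "const_c1 d = - (2 powr (- real d / 2))
        * (Gamma ((real d + 1) / 2) * 2 powr (real d - 1) / sqrt pi)"
      by (simp only:)
    also have "\<dots> = - (Gamma ((real d + 1) / 2) * (2 powr (- real d / 2) * 2 powr (real d - 1)) /
        sqrt pi)" by simp
    also have "2 powr (- real d / 2) * 2 powr (real d - 1) = 2 powr (real d / 2 - (1::real))"
      unfolding powr_add[symmetric] by (simp add: field_simps)
    finally have "(const_c1 d)\<^sup>2 = (Gamma ((real d + 1) / 2))\<^sup>2 * (2 powr (real d / 2 - 1))\<^sup>2 / pi"
      by (simp add: power_mult_distrib power_divide)
    also have "(2 powr (real d / 2 - 1))\<^sup>2 = 2 powr (real d - (2::real))"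
      by (simp add: power2_eq_square powr_add[symmetric])
    finally show ?thesis by (simp add: mult.commute)
  qed
qed

lemma conv_const_eq_c1:
  assumes "0 < d" shows "conv_const d / 4 = (const_c1 d)\<^sup>2
      * (pi powr (real d / 2) / Gamma (real d + 1))"
proof -
  have B: "Beta ((real d + 1) / 2) ((real d + 1) / 2)
      = (Gamma ((real d + 1) / 2))\<^sup>2 / Gamma (real d + 1)"
  proof -
    have "(real d + 1) / 2 + (real d + 1) / 2 = real d + 1" by simp
    then show ?thesis by (simp add: Beta_def power2_eq_square)
  qed
  have "(4 * pi) powr (real d / 2) = 4 powr (real d / 2) * pi powr (real d / 2)"
      by (simp add: powr_mult)
  also have "(4::real) powr (real d / 2) = 2 powr real d"
  proof -
    have "(4::real) powr (real d / 2) = (2 powr 2) powr (real d / 2)" by simp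
    then show ?thesis unfolding powr_powr by simp
  qed
  also have "2 powr real d = 4 * (2::real) powr (real d - 2)" by (simp add: powr_diff)
  finally have "conv_const d = 4 * 2 powr (real d - 2) * pi powr (real d / 2) / pi
      * Beta ((real d + 1) / 2) ((real d + 1) / 2)"
    by (simp add: conv_const_def)
  then show ?thesis unfolding B const_c1_square[OF assms] by simp
qed

lemma conv_const_eq_c2:
  assumes "0 < d" shows "conv_const d / 4 = const_c2 d * 2 powr (real d / 2)"
  unfolding conv_const_eq_c1[OF assms] const_c2_def by (simp add: powr_divide)

lemma conv_const_pos: "0 < conv_const d"
  by (auto simp: conv_const_def Beta_def intro!: mult_pos_pos divide_pos_pos)

lemma nn_integral_norm_translate:
  fixes t :: "'a::euclidean_space"
  assumes [measurable]: "h \<in> borel_measurable borel"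
  shows "(\<integral>\<^sup>+u. h (norm (t - u)) \<partial>lborel) = (\<integral>\<^sup>+u. h (norm (u::'a)) \<partial>lborel)"
proof -
  have "(\<integral>\<^sup>+u. h (norm (u::'a)) \<partial>lborel) = (\<integral>\<^sup>+u. h (norm u) \<partial>distr lborel borel ((+) (- t)))"
    by (subst lborel_distr_plus) simp
  also have "\<dots> = (\<integral>\<^sup>+u. h (norm (- t + u)) \<partial>lborel)" by (subst nn_integral_distr) auto
  also have "\<dots> = (\<integral>\<^sup>+u. h (norm (t - u)) \<partial>lborel)"
    by (intro nn_integral_cong) (metis norm_minus_commute uminus_add_conv_diff)
  finally show ?thesis by simp
qed

text \<open>
  The square of \<open>exp (- l |u| / 2)\<close> is the integrand at hand, so this is the convolution formula
  at 0.
\<close>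
lemma nn_integral_exp_norm:
  fixes t :: "'a::euclidean_space"
  assumes l: "l > 0"
  shows "(\<integral>\<^sup>+u. ennreal (exp (- l * norm (t - u))) \<partial>lborel) =
    ennreal (conv_const DIM('a) * Gamma (real DIM('a) / 2 + 1) * 2 ^ DIM('a) / l ^ DIM('a))"
proof -
  let ?d = "DIM('a)" and ?\<nu> = "real DIM('a) / 2 + 1"
  have l2: "l / 2 > 0" using l by simp
  have "(\<integral>\<^sup>+u. ennreal (exp (- l * norm (t - u))) \<partial>lborel)
      = (\<integral>\<^sup>+u. ennreal (exp (- l * norm (u::'a))) \<partial>lborel)"
    by (rule nn_integral_norm_translate) measurable
  also have "\<dots> = (\<integral>\<^sup>+u. ennreal (exp (- (l / 2 * norm u)) * exp (- (l / 2 * norm (0 - u::'a))))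
      \<partial>lborel)"
    by (intro nn_integral_cong) (simp add: exp_add[symmetric])
  also have "\<dots> = ennreal (conv_const ?d * (l / 2)\<^sup>2 * mix_integral ?\<nu> (l / 2) 0)"
    using nn_integral_exp_norm_convolution[OF l2, of "0::'a"] by simp
  also have "mix_integral ?\<nu> (l / 2) 0 = Gamma ?\<nu> / ((l / 2)\<^sup>2) powr ?\<nu>"
  proof -
    have "ennreal (mix_integral ?\<nu> (l / 2) 0) = ennreal (Gamma ?\<nu> / ((l / 2)\<^sup>2) powr ?\<nu>)"
      using nn_integral_mix_kernel[OF l2, of ?\<nu> 0] nn_integral_Gamma_scaled[of "(l / 2)\<^sup>2" ?\<nu>] l2
      by (simp add: mix_kernel_def)
    then show ?thesis by (simp add: mix_integral_nonneg)
  qed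
  also have "((l / 2)\<^sup>2) powr ?\<nu> = (l / 2) ^ (?d + 2)"
  proof -
    have "((l / 2)\<^sup>2) powr ?\<nu> = ((l / 2) powr 2) powr ?\<nu>" using l2 by (simp add: powr_numeral)
    also have "\<dots> = (l / 2) powr (real (?d + 2))" unfolding powr_powr by (simp add: algebra_simps)
    also have "\<dots> = (l / 2) ^ (?d + 2)" by (rule powr_realpow[OF l2])
    finally show ?thesis .
  qed
  also have "conv_const ?d * (l / 2)\<^sup>2 * (Gamma ?\<nu> / (l / 2) ^ (?d + 2))
      = conv_const ?d * Gamma ?\<nu> * 2 ^ ?d / l ^ ?d"
    using l by (simp add: power_add power_divide power2_eq_square)
  finally show ?thesis .
qed

definition supCAR_kernel :: "'a::euclidean_space \<Rightarrow> real \<times> 'a \<Rightarrow> real" where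
  "supCAR_kernel t = (\<lambda>(l, u). 1 / (2 * l) * exp (- l * norm (t - u)))"

locale positive_prob = P: prob_space \<pi> for \<pi> :: "real measure" +
  assumes sets_pi: "sets \<pi> = sets (restrict_space borel {0<..})"
begin

lemma space_pi: "space \<pi> = {0<..}"
  using sets_eq_imp_space_eq[OF sets_pi] by (simp add: space_restrict_space)

lemma pi_ident [measurable]: "(\<lambda>l. l) \<in> borel_measurable \<pi>"
proof -
  have "(\<lambda>l::real. l) \<in> borel_measurable (restrict_space borel {0<..})"
    by (rule measurable_restrict_space1) simp
  then show ?thesis by (simp cong: measurable_cong_sets add: sets_pi)
qed

lemma pi_borel: "h \<in> borel_measurable borel \<Longrightarrow> h \<in> borel_measurable \<pi>"
  using measurable_compose[OF pi_ident] by blast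

lemma supCAR_kernel_measurable [measurable]: "supCAR_kernel t \<in> borel_measurable
    (control_measure \<pi>)"
proof -
  have "(\<lambda>x. 1 / (2 * fst x) * exp (- fst x * norm (t - snd x))) \<in> borel_measurable
      (control_measure \<pi>)"
    by measurable
  then show ?thesis by (simp add: supCAR_kernel_def case_prod_unfold)
qed

lemma supCAR_kernel_pos: "x \<in> space (control_measure \<pi>) \<Longrightarrow> 0 < supCAR_kernel t x"
  by (auto simp: supCAR_kernel_def space_pair_measure space_pi)

lemma emeasure_control_space: "emeasure (control_measure \<pi> :: (real \<times> 'a::euclidean_space) measure)
    (space (control_measure \<pi>)) = \<infinity>"
proof -
  have "emeasure (control_measure \<pi>) (space \<pi> \<times> (UNIV :: 'a set))
      = emeasure \<pi> (space \<pi>) * emeasure lborel (UNIV :: 'a set)"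
    by (rule lborel.emeasure_pair_measure_Times) auto
  then show ?thesis by (simp add: space_pair_measure P.emeasure_space_1)
qed

lemma nn_integral_supCAR_kernel:
  fixes t :: "'a::euclidean_space"
  assumes fin: "(\<integral>\<^sup>+l. ennreal (1 / l ^ (DIM('a) + 1)) \<partial>\<pi>) < \<infinity>"
  shows "(\<integral>\<^sup>+x. ennreal (supCAR_kernel t x) \<partial>control_measure \<pi>) < \<infinity>"
proof -
  let ?c = "conv_const DIM('a) * Gamma (real DIM('a) / 2 + 1) * 2 ^ DIM('a)"
  have "(\<integral>\<^sup>+x. ennreal (supCAR_kernel t x) \<partial>control_measure \<pi>)
      = (\<integral>\<^sup>+l. \<integral>\<^sup>+u. ennreal (supCAR_kernel t (l, u)) \<partial>lborel \<partial>\<pi>)"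
    by (rule lborel.nn_integral_fst[symmetric]) measurable
  also have "\<dots> = (\<integral>\<^sup>+l. ennreal (?c / 2) * ennreal (1 / l ^ (DIM('a) + 1)) \<partial>\<pi>)"
  proof (rule nn_integral_cong)
    fix l assume "l \<in> space \<pi>"
    then have l: "l > 0" by (simp add: space_pi)
    have "(\<integral>\<^sup>+u. ennreal (supCAR_kernel t (l, u)) \<partial>lborel)
        = ennreal (1 / (2 * l)) * (\<integral>\<^sup>+u. ennreal (exp (- l * norm (t - u))) \<partial>lborel)"
      unfolding supCAR_kernel_def using l by (subst nn_integral_cmult[symmetric]) (auto simp:
          ennreal_mult'[symmetric])
    also have "\<dots> = ennreal (1 / (2 * l) * (?c / l ^ DIM('a)))"
      unfolding nn_integral_exp_norm[OF l] by (rule ennreal_mult'[symmetric]) (use l in simp)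
    also have "1 / (2 * l) * (?c / l ^ DIM('a)) = (?c / 2) * (1 / l ^ (DIM('a) + 1))" by simp
    finally have "(\<integral>\<^sup>+u. ennreal (supCAR_kernel t (l, u)) \<partial>lborel)
        = ennreal ((?c / 2) * (1 / l ^ (DIM('a) + 1)))" .
    also have "\<dots> = ennreal (?c / 2) * ennreal (1 / l ^ (DIM('a) + 1))"
      by (rule ennreal_mult'') (use l in simp)
    finally show "(\<integral>\<^sup>+u. ennreal (supCAR_kernel t (l, u)) \<partial>lborel)
        = ennreal (?c / 2) * ennreal (1 / l ^ (DIM('a) + 1))" .
  qed
  also have "\<dots> = ennreal (?c / 2) * (\<integral>\<^sup>+l. ennreal (1 / l ^ (DIM('a) + 1)) \<partial>\<pi>)"
    by (rule nn_integral_cmult) measurable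
  also have "\<dots> < \<infinity>" using fin by (simp add: ennreal_mult_less_top)
  finally show ?thesis .
qed

lemma mix_integral_measurable: "(\<lambda>l. mix_integral \<nu> l r) \<in> borel_measurable \<pi>"
  unfolding mix_integral_def mix_kernel_def
  by (rule pi_borel) measurable

lemma nn_integral_supCAR_kernel_mult:
  fixes t :: "'a::euclidean_space"
  shows "(\<integral>\<^sup>+x. ennreal (supCAR_kernel 0 x * supCAR_kernel t x) \<partial>control_measure \<pi>) =
    ennreal (conv_const DIM('a) / 4) * (\<integral>\<^sup>+l.
        ennreal (mix_integral (real DIM('a) / 2 + 1) l (norm t)) \<partial>\<pi>)"
proof -
  have "(\<integral>\<^sup>+x. ennreal (supCAR_kernel 0 x * supCAR_kernel t x) \<partial>control_measure \<pi>)
      = (\<integral>\<^sup>+l. \<integral>\<^sup>+u. ennreal (supCAR_kernel 0 (l, u) * supCAR_kernel t (l, u)) \<partial>lborel \<partial>\<pi>)"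
    by (rule lborel.nn_integral_fst[symmetric]) measurable
  also have "\<dots> = (\<integral>\<^sup>+l. ennreal (conv_const DIM('a) / 4)
      * ennreal (mix_integral (real DIM('a) / 2 + 1) l (norm t)) \<partial>\<pi>)"
  proof (rule nn_integral_cong)
    fix l assume "l \<in> space \<pi>"
    then have l: "l > 0" by (simp add: space_pi)
    have "(\<integral>\<^sup>+u. ennreal (supCAR_kernel 0 (l, u) * supCAR_kernel t (l, u)) \<partial>lborel) =
       (\<integral>\<^sup>+u. ennreal (1 / (4 * l\<^sup>2)) * ennreal (exp (- (l * norm u)) * exp (- (l * norm (t - u))))
           \<partial>lborel)"
    proof (intro nn_integral_cong)
      fix u :: 'a
      have "supCAR_kernel 0 (l, u) * supCAR_kernel t (l, u)
          = 1 / (4 * l\<^sup>2) * (exp (- (l * norm u)) * exp (- (l * norm (t - u))))"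
        by (simp add: supCAR_kernel_def power2_eq_square)
      then show "ennreal (supCAR_kernel 0 (l, u) * supCAR_kernel t (l, u))
          = ennreal (1 / (4 * l\<^sup>2)) * ennreal (exp (- (l * norm u)) * exp (- (l * norm (t - u))))"
        by (simp only:) (rule ennreal_mult', simp)
    qed
    also have "\<dots> = ennreal (1 / (4 * l\<^sup>2)) * (\<integral>\<^sup>+u.
        ennreal (exp (- (l * norm u)) * exp (- (l * norm (t - u)))) \<partial>lborel)"
      by (rule nn_integral_cmult) measurable
    also have "\<dots> = ennreal (1 / (4 * l\<^sup>2) * (conv_const DIM('a) * l\<^sup>2
        * mix_integral (real DIM('a) / 2 + 1) l (norm t)))"
      unfolding nn_integral_exp_norm_convolution[OF l] by (rule ennreal_mult'[symmetric]) simp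
    also have "1 / (4 * l\<^sup>2) * (conv_const DIM('a) * l\<^sup>2 * mix_integral (real DIM('a) / 2 + 1) l
        (norm t)) =
        conv_const DIM('a) / 4 * mix_integral (real DIM('a) / 2 + 1) l (norm t)"
      using l by simp
    also have "ennreal (conv_const DIM('a) / 4 * mix_integral (real DIM('a) / 2 + 1) l (norm t)) =
        ennreal (conv_const DIM('a) / 4) * ennreal (mix_integral (real DIM('a) / 2 + 1) l (norm t))"
      by (rule ennreal_mult'') (rule mix_integral_nonneg)
    finally show "(\<integral>\<^sup>+u. ennreal (supCAR_kernel 0 (l, u) * supCAR_kernel t (l, u)) \<partial>lborel) =
        ennreal (conv_const DIM('a) / 4) * ennreal (mix_integral (real DIM('a) / 2 + 1) l (norm t))"
            .
  qed
  also have "\<dots> = ennreal (conv_const DIM('a) / 4)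
      * (\<integral>\<^sup>+l. ennreal (mix_integral (real DIM('a) / 2 + 1) l (norm t)) \<partial>\<pi>)"
    by (rule nn_integral_cmult) (rule measurable_compose[OF mix_integral_measurable
        measurable_ennreal])
  finally show ?thesis .
qed

text \<open>
  The factors \<open>1 / (2 l)\<close> of the two kernels cancel the \<open>l\<^sup>2\<close> of the convolution formula, so
  that no power of \<open>l\<close> remains beside the mixture.
\<close>
lemma supCAR_kernel_inner_product:
  fixes t :: "'a::euclidean_space"
  assumes int: "integrable (control_measure \<pi>) (\<lambda>x. supCAR_kernel 0 x * supCAR_kernel t x)"
  shows "integrable \<pi> (\<lambda>l. mix_integral (real DIM('a) / 2 + 1) l (norm t))"
    and "(LINT x|control_measure \<pi>. supCAR_kernel 0 x * supCAR_kernel t x) =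
      conv_const DIM('a) / 4 * (LINT l|\<pi>. mix_integral (real DIM('a) / 2 + 1) l (norm t))"
proof -
  let ?c = "conv_const DIM('a)" and ?G = "\<lambda>l. mix_integral (real DIM('a) / 2 + 1) l (norm t)"
  have nonneg: "AE x in control_measure \<pi>. 0 \<le> supCAR_kernel 0 x * supCAR_kernel t x"
    using supCAR_kernel_pos by (intro AE_I2 mult_nonneg_nonneg less_imp_le) auto
  have eq: "ennreal (LINT x|control_measure \<pi>. supCAR_kernel 0 x * supCAR_kernel t x)
      = ennreal (?c / 4) * (\<integral>\<^sup>+l. ennreal (?G l) \<partial>\<pi>)"
    unfolding nn_integral_supCAR_kernel_mult[symmetric]
    by (rule nn_integral_eq_integral[symmetric, OF int nonneg])
  have c: "0 < ?c" by (rule conv_const_pos)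
  have "(\<integral>\<^sup>+l. ennreal (?G l) \<partial>\<pi>) < \<infinity>"
  proof (rule ccontr)
    assume "\<not> ?thesis"
    then have "(\<integral>\<^sup>+l. ennreal (?G l) \<partial>\<pi>) = \<infinity>" by (simp add: less_top[symmetric])
    with eq c show False by (simp add: ennreal_mult_top)
  qed
  then show int_G: "integrable \<pi> ?G"
    using mix_integral_measurable by (intro integrableI_nonneg) (auto simp: mix_integral_nonneg)
  have "ennreal (LINT x|control_measure \<pi>. supCAR_kernel 0 x * supCAR_kernel t x)
      = ennreal (?c / 4 * (LINT l|\<pi>. ?G l))"
    unfolding eq nn_integral_eq_integral[OF int_G AE_I2[OF mix_integral_nonneg]]
    by (rule ennreal_mult'[symmetric]) (use c in simp)
  moreover have "0 \<le> (LINT l|\<pi>. ?G l)" by (intro Bochner_Integration.integral_nonneg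
      mix_integral_nonneg)
  moreover have "0 \<le> (LINT x|control_measure \<pi>. supCAR_kernel 0 x * supCAR_kernel t x)"
      by (rule integral_nonneg_AE[OF nonneg])
  ultimately show "(LINT x|control_measure \<pi>. supCAR_kernel 0 x * supCAR_kernel t x)
      = ?c / 4 * (LINT l|\<pi>. ?G l)"
    using c by simp
qed

text \<open>
  Fubini's theorem for \<open>\<pi>\<close> and Lebesgue measure; the majorant is the density itself, whose
  integral over frequencies is the mixture at \<open>r = 0\<close>. At \<open>\<omega> = 0\<close> the integral over \<open>\<pi>\<close> may
  diverge, which concerns only a null set of frequencies.
\<close>
lemma spectral_density_of_mixture:
  fixes r :: "'a::euclidean_space \<Rightarrow> real"
  assumes int0: "integrable \<pi> (\<lambda>l. mix_integral (real DIM('a) / 2 + 1) l 0)"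
    and r: "\<And>t. r t = c * (pi powr (real DIM('a) / 2) / Gamma (real DIM('a) + 1))
        * (LINT l|\<pi>. mix_integral (real DIM('a) / 2 + 1) l (norm t))"
    and c: "0 \<le> c"
  shows "is_spectral_density r (\<lambda>\<omega>. c * (LINT l|\<pi>. 1 / ((norm \<omega>)\<^sup>2 + l\<^sup>2) ^ (DIM('a) + 1)))"
proof -
  let ?K = "pi powr (real DIM('a) / 2) / Gamma (real DIM('a) + 1)" and ?\<nu> = "real DIM('a) / 2 + 1"
  let ?h = "\<lambda>l \<omega>. 1 / ((norm (\<omega>::'a))\<^sup>2 + l\<^sup>2) ^ (DIM('a) + 1)"
  have K: "0 < ?K" by simp
  interpret pair_sigma_finite \<pi> "lborel :: 'a measure" by standard
  have hm[measurable]: "(\<lambda>x. ?h (fst x) (snd x)) \<in> borel_measurable (\<pi> \<Otimes>\<^sub>M lborel)" by measurable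
  have h0: "0 \<le> ?h l \<omega>" for l \<omega> by simp
  have fin: "(\<integral>\<^sup>+x. ennreal (?h (fst x) (snd x)) \<partial>(\<pi> \<Otimes>\<^sub>M lborel)) < \<infinity>"
  proof -
    have "(\<integral>\<^sup>+x. ennreal (?h (fst x) (snd x)) \<partial>(\<pi> \<Otimes>\<^sub>M lborel))
        = (\<integral>\<^sup>+l. \<integral>\<^sup>+\<omega>. ennreal (?h l \<omega>) \<partial>lborel \<partial>\<pi>)"
      by (subst lborel.nn_integral_fst[symmetric]) auto
    also have "\<dots> = (\<integral>\<^sup>+l. ennreal (?K * mix_integral ?\<nu> l 0) \<partial>\<pi>)"
      by (rule nn_integral_cong) (simp only: nn_integral_cauchy_density space_pi greaterThan_iff)
    also have "\<dots> = ennreal (LINT l|\<pi>. ?K * mix_integral ?\<nu> l 0)"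
      using K by (intro nn_integral_eq_integral integrable_mult_right int0 AE_I2 mult_nonneg_nonneg
          mix_integral_nonneg) auto
    finally show ?thesis by simp
  qed
  have inth: "integrable (\<pi> \<Otimes>\<^sub>M lborel) (\<lambda>(l, \<omega>). ?h l \<omega>)"
    using fin h0 hm by (intro integrableI_nonneg) (auto simp: case_prod_unfold)
  have int1: "integrable lborel (\<lambda>\<omega>. LINT l|\<pi>. ?h l \<omega>)"
    using integrable_snd[OF inth] by simp
  have ft: "complex_of_real (r t) = (CLINT \<omega>|lborel. exp (\<i> * of_real (\<omega> \<bullet> t))
      * of_real (c * (LINT l|\<pi>. ?h l \<omega>)))" for t
  proof -
    let ?e = "\<lambda>\<omega>. exp (\<i> * of_real (\<omega> \<bullet> t))"
    have inte: "integrable (\<pi> \<Otimes>\<^sub>M lborel) (\<lambda>(l, \<omega>). ?e \<omega> * complex_of_real (?h l \<omega>))"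
    proof (rule Bochner_Integration.integrable_bound[OF inth])
      show "AE x in \<pi> \<Otimes>\<^sub>M lborel. norm (case x of (l, \<omega>) \<Rightarrow> ?e \<omega> * complex_of_real (?h l \<omega>))
          \<le> norm (case x of (l, \<omega>) \<Rightarrow> ?h l \<omega>)"
        by (intro AE_I2) (auto simp: norm_mult simp del: of_real_divide)
      have "(\<lambda>x. ?e (snd x) * complex_of_real (?h (fst x) (snd x))) \<in> borel_measurable
          (\<pi> \<Otimes>\<^sub>M lborel)" by measurable
      then show "(\<lambda>(l, \<omega>). ?e \<omega> * complex_of_real (?h l \<omega>)) \<in> borel_measurable (\<pi> \<Otimes>\<^sub>M lborel)"
        by (simp add: case_prod_unfold)
    qed
    have "(CLINT \<omega>|lborel. ?e \<omega> * of_real (c * (LINT l|\<pi>. ?h l \<omega>)))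
        = (CLINT \<omega>|lborel. of_real c * (CLINT l|\<pi>. ?e \<omega> * complex_of_real (?h l \<omega>)))"
      by (intro Bochner_Integration.integral_cong refl)
        (simp only: integral_mult_right_zero integral_complex_of_real of_real_mult
            mult.left_commute)
    also have "\<dots> = of_real c * (CLINT \<omega>|lborel. CLINT l|\<pi>. ?e \<omega> * complex_of_real (?h l \<omega>))"
      by (rule integral_mult_right_zero)
    also have "(CLINT \<omega>|lborel. CLINT l|\<pi>. ?e \<omega> * complex_of_real (?h l \<omega>))
        = (CLINT l|\<pi>. CLINT \<omega>|lborel. ?e \<omega> * complex_of_real (?h l \<omega>))"
      by (rule Fubini_integral[OF inte])
    also have "\<dots> = (CLINT l|\<pi>. complex_of_real (?K * mix_integral ?\<nu> l (norm t)))"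
      by (rule Bochner_Integration.integral_cong[OF refl]) (simp only:
          cauchy_density_fourier space_pi greaterThan_iff)
    also have "\<dots> = complex_of_real (?K * (LINT l|\<pi>. mix_integral ?\<nu> l (norm t)))"
      by (simp only: integral_complex_of_real integral_mult_right_zero)
    finally show ?thesis unfolding r by (simp only: of_real_mult mult.assoc)
  qed
  show ?thesis unfolding is_spectral_density_def
    using ft int1 c by (auto intro!: mult_nonneg_nonneg Bochner_Integration.integral_nonneg)
qed

end

section \<open>Covariance and spectral density of the field\<close>

context scattered_measure begin

text \<open>
  Convergence in probability is traded for almost sure convergence of a subsequence, along which
  characteristic functions converge by dominated convergence.
\<close>
lemma has_stoch_integral_AE:
  assumes "has_stoch_integral M \<mu> S \<Lambda> f (space \<mu>) Y"
  obtains n B a where "\<And>k. simple_rep S (n k) (B k)"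
    "AE x in \<mu>. (\<lambda>k. simple_fun (n k) (a k) (B k) x) \<longlonglongrightarrow> f x"
    "AE w in M. (\<lambda>k. SI (n k) (a k) (B k) (space \<mu>) w) \<longlonglongrightarrow> Y w"
proof -
  obtain n a B where rep: "\<And>k. simple_rep S (n k) (B k)"
    and lim: "AE x in \<mu>. (\<lambda>k. simple_fun (n k) (a k) (B k) x) \<longlonglongrightarrow> f x"
    and prob: "tendsto_in_prob M (\<lambda>k. SI (n k) (a k) (B k) (space \<mu>)) Y"
    and Y: "Y \<in> borel_measurable M"
    using assms unfolding has_stoch_integral_def by blast
  obtain \<rho> :: "nat \<Rightarrow> nat" where \<rho>: "strict_mono \<rho>"
    and limY: "AE w in M. (\<lambda>k. SI (n (\<rho> k)) (a (\<rho> k)) (B (\<rho> k)) (space \<mu>) w) \<longlonglongrightarrow> Y w"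
    using tendsto_in_prob_AE_subseq[OF SI_space_measurable[OF rep] Y prob] by blast
  have "AE x in \<mu>. (\<lambda>k. simple_fun (n (\<rho> k)) (a (\<rho> k)) (B (\<rho> k)) x) \<longlonglongrightarrow> f x"
    using lim by eventually_elim (use LIMSEQ_subseq_LIMSEQ[OF _ \<rho>] in \<open>auto simp: comp_def\<close>)
  with rep limY show thesis by (intro that[of "\<lambda>k. n (\<rho> k)" "\<lambda>k. B (\<rho> k)" "\<lambda>k. a (\<rho> k)"]) auto
qed

lemma stoch_integral_variance_rate:
  fixes f :: "'x \<Rightarrow> real"
  assumes Y: "has_stoch_integral M \<mu> S \<Lambda> f (space \<mu>) Y" and Y2: "integrable M (\<lambda>w. (Y w)\<^sup>2)"
    and f: "f \<in> borel_measurable \<mu>" and pos: "\<And>x. x \<in> space \<mu> \<Longrightarrow> 0 < f x"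
    and fin: "(\<integral>\<^sup>+x. ennreal (f x) \<partial>\<mu>) < \<infinity>"
  shows "(\<integral>\<^sup>+x. ennreal ((f x)\<^sup>2 / 2) \<partial>\<mu>) * variance_rate < \<infinity>"
proof -
  obtain n B a where rep: "\<And>k. simple_rep S (n k) (B k)"
    and lim: "AE x in \<mu>. (\<lambda>k. simple_fun (n k) (a k) (B k) x) \<longlonglongrightarrow> f x"
    and limY: "AE w in M. (\<lambda>k. SI (n k) (a k) (B k) (space \<mu>) w) \<longlonglongrightarrow> Y w"
    by (rule has_stoch_integral_AE[OF Y]) (rule that)
  have Ym: "Y \<in> borel_measurable M" using Y by (simp add: has_stoch_integral_def)
  obtain A where A: "exhausting A" "\<And>k. emeasure \<mu> (A k) < \<infinity>"
    and "\<And>k m x. x \<in> A k \<Longrightarrow> k \<le> m \<Longrightarrow> \<bar>simple_fun (n m) (a m) (B m) x\<bar> \<le> real (Suc k)"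
    by (rule exhausting_level_sets[OF rep lim pos f fin]) (assumption, rule that)
  have "(\<integral>\<^sup>+x. ennreal ((f x)\<^sup>2 / 2) \<partial>\<mu>) * variance_rate \<le> ennreal (LINT w|M. (Y w)\<^sup>2)"
    by (rule variance_rate_mult_le[OF rep lim A f Ym limY Y2])
  then show ?thesis by (rule le_less_trans) simp
qed

end

context scattered_measure_variance begin

lemma stoch_integral_L2_integral:
  fixes f :: "'x \<Rightarrow> real"
  assumes Y: "has_stoch_integral M \<mu> S \<Lambda> f (space \<mu>) Y" and Y2: "integrable M (\<lambda>w. (Y w)\<^sup>2)"
    and f: "f \<in> borel_measurable \<mu>" and pos: "\<And>x. x \<in> space \<mu> \<Longrightarrow> 0 < f x"
    and fin: "(\<integral>\<^sup>+x. ennreal (f x) \<partial>\<mu>) < \<infinity>" and f2: "integrable \<mu> (\<lambda>x. (f x)\<^sup>2)"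
  shows "L2_integral f Y"
proof -
  obtain n B a where rep: "\<And>k. simple_rep S (n k) (B k)"
    and lim: "AE x in \<mu>. (\<lambda>k. simple_fun (n k) (a k) (B k) x) \<longlonglongrightarrow> f x"
    and limY: "AE w in M. (\<lambda>k. SI (n k) (a k) (B k) (space \<mu>) w) \<longlonglongrightarrow> Y w"
    by (rule has_stoch_integral_AE[OF Y]) (rule that)
  have Ym: "Y \<in> borel_measurable M" using Y by (simp add: has_stoch_integral_def)
  obtain A where "exhausting A" "\<And>k. emeasure \<mu> (A k) < \<infinity>"
    "\<And>k m x. x \<in> A k \<Longrightarrow> k \<le> m \<Longrightarrow> \<bar>simple_fun (n m) (a m) (B m) x\<bar> \<le> real (Suc k)"
    by (rule exhausting_level_sets[OF rep lim pos f fin]) (assumption, rule that)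
  then show ?thesis by (rule stochastic_integral_is_L2_integral[OF rep lim f f2 _ _ _ Ym limY Y2])
qed

text \<open>
  If the variance rate is 0 then \<open>K = 0\<close>, so \<open>\<Lambda>\<close> vanishes on sets of finite measure, and the
  exhaustion carries this over to all of the ring.
\<close>
lemma stoch_integral_degenerate:
  fixes f :: "'x \<Rightarrow> real"
  assumes variance_coeff: "variance_coeff = 0"
    and Y: "has_stoch_integral M \<mu> S \<Lambda> f (space \<mu>) Y"
    and f: "f \<in> borel_measurable \<mu>" and pos: "\<And>x. x \<in> space \<mu> \<Longrightarrow> 0 < f x"
    and fin: "(\<integral>\<^sup>+x. ennreal (f x) \<partial>\<mu>) < \<infinity>"
  shows "AE w in M. Y w = 0"
proof -
  obtain n B a where rep: "\<And>k. simple_rep S (n k) (B k)"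
    and lim: "AE x in \<mu>. (\<lambda>k. simple_fun (n k) (a k) (B k) x) \<longlonglongrightarrow> f x"
    and limY: "AE w in M. (\<lambda>k. SI (n k) (a k) (B k) (space \<mu>) w) \<longlonglongrightarrow> Y w"
    by (rule has_stoch_integral_AE[OF Y]) (rule that)
  obtain A where A: "exhausting A" "\<And>k. emeasure \<mu> (A k) < \<infinity>"
    and "\<And>k m x. x \<in> A k \<Longrightarrow> k \<le> m \<Longrightarrow> \<bar>simple_fun (n m) (a m) (B m) x\<bar> \<le> real (Suc k)"
    by (rule exhausting_level_sets[OF rep lim pos f fin]) (assumption, rule that)
  have AS: "A m \<in> S" for m by (rule exhausting_in_S[OF A(1)])
  have zero: "AE w in M. \<Lambda> D w = 0" if "D \<in> S" "emeasure \<mu> D < \<infinity>" for D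
    using that by (intro AE_zero_if_chf_1 \<Lambda>_measurable) (auto simp:
        chf_\<Lambda> levy_exponent_trivial[OF variance_coeff])
  have SI0: "AE w in M. SI (n k) (a k) (B k) (A m) w = 0" for k m
  proof -
    have "AE w in M. \<Lambda> (A m \<inter> B k i) w = 0" if "i < n k" for i
    proof (rule zero)
      show "A m \<inter> B k i \<in> S" using simple_repD(1)[OF rep that] AS by auto
      show "emeasure \<mu> (A m \<inter> B k i) < \<infinity>"
        using A(2)[of m] emeasure_mono[of "A m \<inter> B k i" "A m" \<mu>] S_sets[OF AS[of m]]
            by (auto intro: le_less_trans)
    qed
    then have "AE w in M. \<forall>i\<in>{..<n k}. \<Lambda> (A m \<inter> B k i) w = 0" by (subst AE_finite_all) auto
    then show ?thesis by eventually_elim (simp add: simple_stoch_integral_def)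
  qed
  have "AE w in M. SI (n k) (a k) (B k) (space \<mu>) w = 0" for k
  proof -
    have "AE w in M. \<forall>m. SI (n k) (a k) (B k) (A m) w = 0" using SI0 by (simp add: AE_all_countable)
    with SI_exhausting_limit[OF A(1) rep[of k], of "a k"] show ?thesis
      by eventually_elim (simp add: LIMSEQ_const_iff)
  qed
  then have "AE w in M. \<forall>k. SI (n k) (a k) (B k) (space \<mu>) w = 0" by (simp add: AE_all_countable)
  with limY show ?thesis by eventually_elim (simp add: LIMSEQ_const_iff)
qed

end

text \<open>
  For \<open>l \<le> 1/e\<close> the logarithm has modulus at least 1; for other \<open>l\<close> the left-hand side is
  bounded. So a moment condition with logarithms implies the one without.
\<close>
lemma inverse_power_le_log:
  fixes l :: real
  assumes l: "l > 0" and "j \<ge> 1"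
  shows "1 / l ^ (d + 1) \<le> exp 1 ^ (d + 1) + \<bar>ln l\<bar> ^ i / l ^ (d + j)"
proof (cases "l \<le> exp (- 1)")
  case True
  then have "ln l \<le> - 1" using l by (metis exp_gt_zero ln_exp ln_le_cancel_iff)
  then have "1 \<le> \<bar>ln l\<bar> ^ i" by (intro one_le_power) auto
  moreover have "l ^ (d + j) \<le> l ^ (d + 1)"
  proof (rule power_decreasing)
    have "exp (- 1 :: real) \<le> 1" by simp
    with True show "l \<le> 1" by linarith
  qed (use assms in auto)
  ultimately have "1 / l ^ (d + 1) \<le> \<bar>ln l\<bar> ^ i / l ^ (d + j)" using l by (intro frac_le) auto
  moreover have "0 \<le> (exp 1 :: real) ^ (d + 1)" by simp
  ultimately show ?thesis by linarith
next
  case False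
  then have "1 / l \<le> exp 1" using l by (simp add: exp_minus field_simps)
  then have "(1 / l) ^ (d + 1) \<le> exp 1 ^ (d + 1)" using l by (intro power_mono) auto
  moreover have "0 \<le> \<bar>ln l\<bar> ^ i / l ^ (d + j)" using l by simp
  ultimately show ?thesis by (simp only: power_one_over)
qed

lemma (in positive_prob) nn_integral_inverse_power:
  assumes "(\<integral>\<^sup>+l. ennreal (\<bar>ln l\<bar> ^ i / l ^ (d + j)) \<partial>\<pi>) < \<infinity>" and j: "j \<ge> 1"
  shows "(\<integral>\<^sup>+l. ennreal (1 / l ^ (d + 1)) \<partial>\<pi>) < \<infinity>"
proof -
  have "(\<integral>\<^sup>+l. ennreal (1 / l ^ (d + 1)) \<partial>\<pi>) \<le> (\<integral>\<^sup>+l. ennreal (exp 1 ^ (d + 1))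
      + ennreal (\<bar>ln l\<bar> ^ i / l ^ (d + j)) \<partial>\<pi>)"
  proof (rule nn_integral_mono)
    fix l assume "l \<in> space \<pi>"
    then have l: "l > 0" by (simp add: space_pi)
    have "ennreal (1 / l ^ (d + 1)) \<le> ennreal (exp 1 ^ (d + 1) + \<bar>ln l\<bar> ^ i / l ^ (d + j))"
      by (intro ennreal_leI inverse_power_le_log l j)
    also have "\<dots> = ennreal (exp 1 ^ (d + 1)) + ennreal (\<bar>ln l\<bar> ^ i / l ^ (d + j))"
      using l by (intro ennreal_plus) auto
    finally show "ennreal (1 / l ^ (d + 1)) \<le> ennreal (exp 1 ^ (d + 1))
        + ennreal (\<bar>ln l\<bar> ^ i / l ^ (d + j))" .
  qed
  also have "\<dots> = ennreal (exp 1 ^ (d + 1)) + (\<integral>\<^sup>+l. ennreal (\<bar>ln l\<bar> ^ i / l ^ (d + j)) \<partial>\<pi>)"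
    by (subst nn_integral_add) (auto simp: P.emeasure_space_1)
  also have "\<dots> < \<infinity>" using assms by (simp add: ennreal_add_less_top)
  finally show ?thesis .
qed

text \<open>
  The number \<open>v\<close> is the variance rate. Its finiteness comes from one of the variables \<open>X t\<close>: the
  square integral of a positive function on a space of positive measure is not 0, so an infinite
  variance rate would make the product in the variance bound infinite.
\<close>
lemma supCAR_covariance:
  fixes S :: "(real \<times> 'a::euclidean_space) set set" and X :: "'a \<Rightarrow> 'w \<Rightarrow> real"
  assumes field: "supCAR_field M S \<Lambda> b W \<pi> X"
    and cond: "supCAR_cond_i DIM('a) b W \<pi> \<or> supCAR_cond_ii DIM('a) b W \<pi>"
    and X1: "\<And>t. integrable M (X t)" and X2: "\<And>t. integrable M (\<lambda>w. (X t w)\<^sup>2)"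
  obtains v where "0 \<le> v" "has_second_derivative_at (levy_exponent b W) (of_real (- v)) 0"
    "\<And>t. covariance M (X 0) (X t) = v * (conv_const DIM('a) / 4)
        * (LINT l|\<pi>. mix_integral (real DIM('a) / 2 + 1) l (norm t))"
    "\<And>t::'a. v \<noteq> 0 \<Longrightarrow> integrable \<pi> (\<lambda>l. mix_integral (real DIM('a) / 2 + 1) l (norm t))"
proof -
  let ?\<mu> = "control_measure \<pi> :: (real \<times> 'a) measure"
  interpret prob_space M using field by (simp add: supCAR_field_def)
  interpret levy_triplet b W using field by unfold_locales (auto simp: supCAR_field_def)
  interpret scattered_measure M b W ?\<mu> S \<Lambda> using field
      by unfold_locales (auto simp: supCAR_field_def)
  interpret positive_prob \<pi>
  proof (rule positive_prob.intro)
    show "prob_space \<pi>" "positive_prob_axioms \<pi>"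
      using field by (auto simp: supCAR_field_def prob_on_positive_reals_def
          positive_prob_axioms_def)
  qed
  let ?f = "supCAR_kernel :: 'a \<Rightarrow> real \<times> 'a \<Rightarrow> real"
  have Y: "has_stoch_integral M ?\<mu> S \<Lambda> (?f t) (space ?\<mu>) (\<lambda>w. - X t w)" for t
    using field by (simp add: supCAR_field_def supCAR_kernel_def)
  have fin1: "(\<integral>\<^sup>+l. ennreal (1 / l ^ (DIM('a) + 1)) \<partial>\<pi>) < \<infinity>"
    using cond
  proof
    assume "supCAR_cond_i DIM('a) b W \<pi>"
    then show ?thesis using nn_integral_inverse_power[of "DIM('a)" "DIM('a)" 2]
        by (simp add: supCAR_cond_i_def)
  next
    assume "supCAR_cond_ii DIM('a) b W \<pi>"
    then show ?thesis using nn_integral_inverse_power[of "DIM('a) - 1" "DIM('a)" 1]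
        by (simp add: supCAR_cond_ii_def)
  qed
  have fin: "(\<integral>\<^sup>+x. ennreal (?f t x) \<partial>?\<mu>) < \<infinity>" for t by (rule nn_integral_supCAR_kernel[OF fin1])
  have Y2: "integrable M (\<lambda>w. (- X t w)\<^sup>2)" for t using X2 by simp
  have vr: "(\<integral>\<^sup>+x. ennreal ((?f t x)\<^sup>2 / 2) \<partial>?\<mu>) * variance_rate < \<infinity>" for t
    by (rule stoch_integral_variance_rate[OF Y Y2 supCAR_kernel_measurable supCAR_kernel_pos fin])
  have "(\<integral>\<^sup>+x. ennreal ((?f 0 x)\<^sup>2 / 2) \<partial>?\<mu>) \<noteq> 0"
  proof
    assume "(\<integral>\<^sup>+x. ennreal ((?f 0 x)\<^sup>2 / 2) \<partial>?\<mu>) = 0"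
    then have "AE x in ?\<mu>. ennreal ((?f 0 x)\<^sup>2 / 2) = 0" by (subst (asm) nn_integral_0_iff_AE) auto
    moreover have "AE x in ?\<mu>. ennreal ((?f 0 x)\<^sup>2 / 2) \<noteq> 0"
    proof (rule AE_I2)
      fix x assume "x \<in> space ?\<mu>"
      then have "0 < (?f 0 x)\<^sup>2 / 2" using supCAR_kernel_pos[of x 0] by simp
      then show "ennreal ((?f 0 x)\<^sup>2 / 2) \<noteq> 0" by (simp add: ennreal_eq_0_iff)
    qed
    ultimately have "AE x in ?\<mu>. False" by eventually_elim simp
    then have "emeasure ?\<mu> (space ?\<mu>) = 0" by (simp add: AE_iff_measurable[OF sets.top])
    then show False using emeasure_control_space[where 'a='a] by simp
  qed
  then have "variance_rate < \<infinity>"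
    using vr[of 0] by (auto simp: less_top[symmetric] ennreal_mult_eq_top_iff)
  then interpret levy_triplet_variance b W by unfold_locales
  interpret scattered_measure_variance M b W ?\<mu> S \<Lambda> by unfold_locales
  have Xm: "X t \<in> borel_measurable M" for t using X1 by blast
  have cov: "covariance M (X 0) (X t) = expectation (\<lambda>w. cent (\<lambda>w. - X 0 w) w
      * cent (\<lambda>w. - X t w) w)" for t
    unfolding covariance_def cent_def using X1
        by (intro Bochner_Integration.integral_cong refl) (simp add: algebra_simps)
  have sq: "integrable ?\<mu> (\<lambda>x. (?f t x)\<^sup>2)" if "variance_coeff \<noteq> 0" for t
  proof -
    have "(\<integral>\<^sup>+x. ennreal ((?f t x)\<^sup>2 / 2) \<partial>?\<mu>) < \<infinity>"
    proof (rule ccontr)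
      assume "\<not> ?thesis"
      then have "(\<integral>\<^sup>+x. ennreal ((?f t x)\<^sup>2 / 2) \<partial>?\<mu>) = \<infinity>" by (simp add: less_top[symmetric])
      with vr[of t] that variance_coeff_nonneg show False
          by (simp add: variance_rate_eq ennreal_top_mult)
    qed
    then have "integrable ?\<mu> (\<lambda>x. (?f t x)\<^sup>2 / 2)" by (intro integrableI_nonneg) auto
    then have "integrable ?\<mu> (\<lambda>x. 2 * ((?f t x)\<^sup>2 / 2))" by (rule integrable_mult_right)
    moreover have "(\<lambda>x. 2 * ((?f t x)\<^sup>2 / 2)) = (\<lambda>x. (?f t x)\<^sup>2)" by simp
    ultimately show ?thesis by (simp only:)
  qed
  \<comment> \<open>if the variance rate is 0 the kernel need not be square integrable; this case is treated apart\<close>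
  have prod: "integrable ?\<mu> (\<lambda>x. ?f 0 x * ?f t x)" if "variance_coeff \<noteq> 0" for t
    by (rule integral_Cauchy_Schwarz(1)) (use sq[OF that] in auto)
  have main: "covariance M (X 0) (X t) = variance_coeff * (conv_const DIM('a) / 4)
      * (LINT l|\<pi>. mix_integral (real DIM('a) / 2 + 1) l (norm t))" for t
  proof (cases "variance_coeff = 0")
    case True
    have "AE w in M. - X s w = 0" for s
      by (rule stoch_integral_degenerate[OF True Y supCAR_kernel_measurable supCAR_kernel_pos fin])
    then have z: "AE w in M. X s w = 0" for s by simp
    have "expectation (X s) = expectation (\<lambda>w. 0)" for s using z Xm by (intro integral_cong_AE) auto
    then have E: "expectation (X s) = 0" for s by simp
    have "covariance M (X 0) (X t) = expectation (\<lambda>w. 0)"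
      unfolding covariance_def E using z[of 0] Xm
          by (intro integral_cong_AE) (auto elim: eventually_mono)
    then show ?thesis using True by simp
  next
    case False
    have L2: "L2_integral (?f s) (\<lambda>w. - X s w)" for s
      by (rule stoch_integral_L2_integral[OF Y Y2 supCAR_kernel_measurable supCAR_kernel_pos fin
          sq[OF False]])
    have "covariance M (X 0) (X t) = variance_coeff * (LINT x|?\<mu>. ?f 0 x * ?f t x)"
      unfolding cov using Xm by (intro L2_integral_covariance L2 Y2 sq[OF False]
          supCAR_kernel_measurable borel_measurable_uminus) auto
    then show ?thesis unfolding supCAR_kernel_inner_product(2)[OF prod[OF False]] by simp
  qed
  show thesis
    using variance_coeff_nonneg levy_exponent_second_derivative main
        supCAR_kernel_inner_product(1)[OF prod]
    by (rule that)
qed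

theorem theorem3p10:
  fixes M :: "'w measure"
    and S :: "(real \<times> (real ^ 'n)) set set"
    and \<Lambda> :: "(real \<times> (real ^ 'n)) set \<Rightarrow> 'w \<Rightarrow> real"
    and b :: real
    and W \<pi> :: "real measure"
    and X :: "real ^ 'n \<Rightarrow> 'w \<Rightarrow> real"
    and d :: nat
    and r :: "real ^ 'n \<Rightarrow> real"
  defines "d \<equiv> CARD('n)"
    and "r \<equiv> \<lambda>t. covariance M (X 0) (X t)"
  assumes "supCAR_field M S \<Lambda> b W \<pi> X"
    and "supCAR_cond_i d b W \<pi> \<or> supCAR_cond_ii d b W \<pi>"
    and "\<And>t. integrable M (X t)"
    and "\<And>t. integrable M (\<lambda>w. (X t w)\<^sup>2)"
    and "\<And>t. (LINT w|M. X t w) = 0"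
  shows "\<exists>\<kappa>::real.
    has_second_derivative_at (levy_exponent b W) (of_real \<kappa>) 0 \<and>
    (\<forall>t. r t = - const_c2 d * \<kappa> *
      (LINT l|\<pi>. l powr (- real d / 2 - 1) * norm_powr_besselK (real d / 2 + 1) l t)) \<and>
    (\<kappa> \<noteq> 0 \<longrightarrow> (\<forall>t::real ^ 'n. integrable \<pi>
      (\<lambda>l. l powr (- real d / 2 - 1) * norm_powr_besselK (real d / 2 + 1) l t))) \<and>
    is_spectral_density r (\<lambda>\<omega>. - (const_c1 d)\<^sup>2 * \<kappa> *
      (LINT l|\<pi>. 1 / ((norm \<omega>)\<^sup>2 + l\<^sup>2) ^ (d + 1))) \<and>
    (\<forall>\<omega>::real ^ 'n. \<omega> \<noteq> 0 \<longrightarrow> integrable \<pi> (\<lambda>l. 1 / ((norm \<omega>)\<^sup>2 + l\<^sup>2) ^ (d + 1)))"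
proof -
  have dim: "DIM(real ^ 'n) = d" by (simp add: d_def)
  have d: "0 < d" by (simp add: d_def)
  define G where "G l \<rho> = mix_integral (real d / 2 + 1) l \<rho>" for l \<rho>
  obtain v where v: "0 \<le> v" and deriv: "has_second_derivative_at (levy_exponent b W) (of_real (- v))
      0"
    and r: "\<And>t. r t = v * (conv_const d / 4) * (LINT l|\<pi>. G l (norm t))"
    and int: "\<And>t::real ^ 'n. v \<noteq> 0 \<Longrightarrow> integrable \<pi> (\<lambda>l. G l (norm t))"
    using supCAR_covariance[of M S \<Lambda> b W \<pi> X] assms(3-6) unfolding dim r_def G_def by blast
  interpret positive_prob \<pi>
  proof (rule positive_prob.intro)
    show "prob_space \<pi>" "positive_prob_axioms \<pi>"
      using assms(3) by (auto simp: supCAR_field_def prob_on_positive_reals_def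
          positive_prob_axioms_def)
  qed
  have bessel: "l powr (- real d / 2 - 1) * norm_powr_besselK (real d / 2 + 1) l t
      = 2 powr (real d / 2) * G l (norm t)"
    if "l \<in> space \<pi>" for l and t :: "real ^ 'n"
  proof -
    have "l > 0" using that by (simp add: space_pi)
    from norm_powr_besselK_eq_mix_integral[OF this, of "real d / 2 + 1" t]
    have "l powr (- (real d / 2 + 1)) * norm_powr_besselK (real d / 2 + 1) l t
        = 2 powr (real d / 2) * G l (norm t)"
      by (simp add: G_def)
    moreover have "- (real d / 2 + 1) = - real d / 2 - 1" by simp
    ultimately show ?thesis by (simp only:)
  qed
  have bessel_int: "(LINT l|\<pi>. l powr (- real d / 2 - 1) * norm_powr_besselK (real d / 2 + 1) l t) =
      2 powr (real d / 2) * (LINT l|\<pi>. G l (norm t))" for t :: "real ^ 'n"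
    using bessel by (simp cong: Bochner_Integration.integral_cong)
  have "r t = - const_c2 d * (- v) *
      (LINT l|\<pi>. l powr (- real d / 2 - 1) * norm_powr_besselK (real d / 2 + 1) l t)" for t
    unfolding r bessel_int conv_const_eq_c2[OF d] by simp
  moreover have "integrable \<pi> (\<lambda>l. l powr (- real d / 2 - 1) * norm_powr_besselK (real d / 2 + 1) l
      t)"
    if "- v \<noteq> 0" for t :: "real ^ 'n"
  proof -
    have "integrable \<pi> (\<lambda>l. 2 powr (real d / 2) * G l (norm t))" using int that
        by (intro integrable_mult_right) simp
    then show ?thesis by (subst Bochner_Integration.integrable_cong[OF refl bessel])
  qed
  moreover have "is_spectral_density r (\<lambda>\<omega>. - (const_c1 d)\<^sup>2 * - v
      * (LINT l|\<pi>. 1 / ((norm \<omega>)\<^sup>2 + l\<^sup>2) ^ (d + 1)))"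
  proof (cases "v = 0")
    case True
    then show ?thesis using r by (simp add: is_spectral_density_def)
  next
    case False
    have rK: "r t = (const_c1 d)\<^sup>2 * v * (pi powr (real d / 2) / Gamma (real d + 1))
        * (LINT l|\<pi>. G l (norm t))" for t
      unfolding r conv_const_eq_c1[OF d] by simp
    have i0: "integrable \<pi> (\<lambda>l. G l 0)" using int[OF False, of 0] by simp
    have "is_spectral_density r (\<lambda>\<omega>. (const_c1 d)\<^sup>2 * v
        * (LINT l|\<pi>. 1 / ((norm \<omega>)\<^sup>2 + l\<^sup>2) ^ (d + 1)))"
      using spectral_density_of_mixture[of r "(const_c1 d)\<^sup>2 * v"] rK i0 v unfolding dim G_def
          by simp
    then show ?thesis by simp
  qed
  moreover have "integrable \<pi> (\<lambda>l. 1 / ((norm \<omega>)\<^sup>2 + l\<^sup>2) ^ (d + 1))" if "\<omega> \<noteq> 0"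
      for \<omega> :: "real ^ 'n"
  proof (rule P.integrable_const_bound)
    show "AE l in \<pi>. norm (1 / ((norm \<omega>)\<^sup>2 + l\<^sup>2) ^ (d + 1)) \<le> 1 / ((norm \<omega>)\<^sup>2) ^ (d + 1)"
    proof (rule AE_I2)
      fix l :: real
      have "((norm \<omega>)\<^sup>2) ^ (d + 1) \<le> ((norm \<omega>)\<^sup>2 + l\<^sup>2) ^ (d + 1)" by (rule power_mono) auto
      then have "1 / ((norm \<omega>)\<^sup>2 + l\<^sup>2) ^ (d + 1) \<le> 1 / ((norm \<omega>)\<^sup>2) ^ (d + 1)"
        using that by (intro divide_left_mono mult_pos_pos) (auto intro!:
            zero_less_power add_pos_nonneg simp del: power_Suc)
      then show "norm (1 / ((norm \<omega>)\<^sup>2 + l\<^sup>2) ^ (d + 1)) \<le> 1 / ((norm \<omega>)\<^sup>2) ^ (d + 1)" by simp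
    qed
  qed measurable
  ultimately show ?thesis using deriv by (intro exI[of _ "- v"]) blast
qed

end
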